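(* Let $0<\lambda<\frac13$. Then the attractor $\Gamma_\lambda$ of the pinball billiard map $T_\lambda$ in the equilateral triangle of side length $1$ is a transitive invariant set, and there is a Cantor set $C\subset\mathbf{R}$ such that $\Gamma_\lambda$ is homeomorphic to $([0,3]\times C)\setminus \mathrm{Sing}(\lambda)$. Moreover, there is a $T_\lambda$-invariant ergodic Borel probability measure on $\Gamma_\lambda$ which is absolutely continuous with respect to Lebesgue measure on horizontal lines, i.e. whose conditional measures on the horizontal intervals $(i,i+1)\times\{\theta\}$, $i\in\{0,1,2\}$, are absolutely continuous with respect to one-dimensional Lebesgue measure.
   Context: Pinball billiard map in the equilateral triangle. The boundary of an equilateral triangle of side length $1$ is parametrised by arc length $s$ (mod $3$), with vertices at $s=0,1,2$ and sides $(i,i+1)$, $i\in\mathbf{Z}_3=\{0,1,2\}$. Let $\tilde M=\bigl((0,1)\cup(1,2)\cup(2,3)\bigr)\times(-\frac{\pi}{2},\frac{\pi}{2})$; a point $(s,\theta)$ represents a particle leaving the boundary point $s$ at angle $\theta$ from the inward normal, with $\theta>0$ towards increasing $s$. The particle moves in a straight line to the next boundary point; there, the outgoing angle is $\lambda$ times the outgoing angle of elastic reflection. Explicitly, for $s=i+u$ with $u\in(0,1)$, put $\delta(s)=\arctan\left(\frac{1-2u}{\sqrt3}\right)$ (the direction of the opposite vertex). If $\theta>\delta(s)$ (right bounce, on side $i+1$), then $T_\lambda(s,\theta)=\left(i+1+(1-u)\frac{\cos\theta}{\cos(\frac{\pi}{3}-\theta)},\ \lambda(\frac{\pi}{3}-\theta)\right)$;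 if $\theta<\delta(s)$ (left bounce, on side $i-1$), then $T_\lambda(s,\theta)=\left(i-u\frac{\cos\theta}{\cos(\frac{\pi}{3}+\theta)},\ \lambda(-\frac{\pi}{3}-\theta)\right)$, with the first coordinate taken mod $3$. If $\theta=\delta(s)$, the trajectory hits a vertex and $T_\lambda$ is undefined. The singular set $\mathrm{Sing}(\lambda)$ consists of all points located at a vertex ($s\in\{0,1,2,3\}$) together with all points of $\tilde M$ whose trajectory under $T_\lambda$ hits a vertex after finitely many iterates. Let $M=\tilde M\setminus\mathrm{Sing}(\lambda)$, the set of points that can be iterated arbitrarily many times, so $T_\lambda:M\to M$. The attractor is $\Gamma_\lambda=\bigcap_{n\ge0}T_\lambda^n(M)$. A set $\Gamma_\lambda$ is invariant if $T_\lambda(\Gamma_\lambda)\subset\Gamma_\lambda$. It is transitive if for any two non-empty relatively open subsets $U,V$ of $\Gamma_\lambda$ there is $N\ge0$ with $T_\lambda^N(U)\cap V\ne\emptyset$. A Cantor set in $\mathbf{R}$ is a non-empty compact, perfect, totally disconnected subset. Conditional measures are those of the disintegration of the measure along the partition of phase space into horizontal intervals $(i,i+1)\times\{\theta\}$, and are defined for almost every such interval. *)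

theory Defs
  imports "HOL-Probability.Probability" "HOL-Library.Real_Mod"
begin

section \<open>The pinball billiard map in the equilateral triangle\<close>

definition M_tilde :: "(real \<times> real) set" where
  "M_tilde = ({0<..<1} \<union> {1<..<2} \<union> {2<..<3}) \<times> {- pi/2<..<pi/2}"

text \<open>Here \<open>frac s\<close> is the position \<open>u\<close> of the boundary point \<open>s = i + u\<close> on its side \<open>(i, i + 1)\<close>.\<close>

definition vertex_angle :: "real \<Rightarrow> real" where
  "vertex_angle s = arctan ((1 - 2 * frac s) / sqrt 3)"

definition hits_vertex :: "real \<times> real \<Rightarrow> bool" where
  "hits_vertex p \<longleftrightarrow> snd p = vertex_angle (fst p)"

text \<open>
  The map is only meaningful at points of \<^const>\<open>M_tilde\<close> that do not satisfy \<^const>\<open>hits_vertex\<close>.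
\<close>

definition pinball :: "real \<Rightarrow> real \<times> real \<Rightarrow> real \<times> real" where
  "pinball lam = (\<lambda>(s, \<theta>).
     let i = of_int \<lfloor>s\<rfloor>; u = frac s in
     if \<theta> > vertex_angle s then
       ((i + 1 + (1 - u) * (cos \<theta> / cos (pi/3 - \<theta>))) rmod 3, lam * (pi/3 - \<theta>))
     else if \<theta> < vertex_angle s then
       ((i - u * (cos \<theta> / cos (pi/3 + \<theta>))) rmod 3, lam * (- pi/3 - \<theta>))
     else undefined)"

text \<open>
  If some iterate satisfies \<^const>\<open>hits_vertex\<close>, then so does a first one, and the orbit up to that
  one does not involve the unspecified values of \<^const>\<open>pinball\<close>. The case \<open>n = 0\<close> covers the
  points at which the map is undefined. Points located at a vertex are removed for every angle.
\<close>

definition Sing :: "real \<Rightarrow> (real \<times> real) set" where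
  "Sing lam = {0, 1, 2, 3} \<times> UNIV \<union>
     {p \<in> M_tilde. \<exists>n. hits_vertex ((pinball lam ^^ n) p)}"

definition phase_space :: "real \<Rightarrow> (real \<times> real) set" where
  "phase_space lam = M_tilde - Sing lam"

definition attractor :: "real \<Rightarrow> (real \<times> real) set" where
  "attractor lam = (\<Inter>n. (pinball lam ^^ n) ` phase_space lam)"


section \<open>Topological notions\<close>

definition topologically_transitive :: "('a::topological_space \<Rightarrow> 'a) \<Rightarrow> 'a set \<Rightarrow> bool" where
  "topologically_transitive f X \<longleftrightarrow>
     (\<forall>U V. openin (top_of_set X) U \<and> openin (top_of_set X) V \<and> U \<noteq> {} \<and> V \<noteq> {} \<longrightarrow>
        (\<exists>N. (f ^^ N) ` U \<inter> V \<noteq> {}))"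

definition cantor_set :: "real set \<Rightarrow> bool" where
  "cantor_set C \<longleftrightarrow>
     C \<noteq> {} \<and> compact C \<and> (\<forall>x\<in>C. x islimpt C) \<and>
     (\<forall>S. S \<subseteq> C \<and> connected S \<longrightarrow> (\<exists>x. S \<subseteq> {x}))"


section \<open>Invariant measures and disintegration\<close>

definition invariant_measure :: "('a \<Rightarrow> 'a) \<Rightarrow> 'a measure \<Rightarrow> bool" where
  "invariant_measure f \<mu> \<longleftrightarrow> f \<in> measurable \<mu> \<mu> \<and> distr \<mu> \<mu> f = \<mu>"

definition ergodic_measure :: "('a \<Rightarrow> 'a) \<Rightarrow> 'a measure \<Rightarrow> bool" where
  "ergodic_measure f \<mu> \<longleftrightarrow>
     (\<forall>A\<in>sets \<mu>. f -` A \<inter> space \<mu> = A \<longrightarrow> emeasure \<mu> A = 0 \<or> emeasure \<mu> A = 1)"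

text \<open>
  The horizontal interval \<open>(i, i + 1) \<times> {\<theta>}\<close> is indexed by the pair \<open>(i, \<theta>)\<close>, and
  \<open>hor_index\<close> sends a point of \<^const>\<open>M_tilde\<close> to the index of the interval containing it.
\<close>

definition hor_interval :: "int \<times> real \<Rightarrow> (real \<times> real) set" where
  "hor_interval = (\<lambda>(i, \<theta>). {of_int i<..<of_int i + 1} \<times> {\<theta>})"

definition hor_index :: "real \<times> real \<Rightarrow> int \<times> real" where
  "hor_index = (\<lambda>(s, \<theta>). (\<lfloor>s\<rfloor>, \<theta>))"

abbreviation index_algebra :: "(int \<times> real) measure" where
  "index_algebra \<equiv> count_space UNIV \<Otimes>\<^sub>M borel"

definition hor_disintegration ::
    "(real \<times> real) measure \<Rightarrow> (int \<times> real \<Rightarrow> (real \<times> real) measure) \<Rightarrow> bool" where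
  "hor_disintegration \<mu> \<kappa> \<longleftrightarrow>
     \<kappa> \<in> measurable index_algebra (prob_algebra \<mu>) \<and>
     (AE h in distr \<mu> index_algebra hor_index. AE p in \<kappa> h. p \<in> hor_interval h) \<and>
     (\<forall>A\<in>sets \<mu>. emeasure \<mu> A =
        (\<integral>\<^sup>+ h. emeasure (\<kappa> h) A \<partial>distr \<mu> index_algebra hor_index))"

text \<open>
  A disintegration is unique up to a null set of indices, so it does not matter which one is taken.
  The projection \<open>fst\<close> identifies \<open>(i, i + 1) \<times> {\<theta>}\<close> with an interval of the real line.
\<close>

definition abs_cont_on_horizontals :: "(real \<times> real) measure \<Rightarrow> bool" where
  "abs_cont_on_horizontals \<mu> \<longleftrightarrow>
     (\<exists>\<kappa>. hor_disintegration \<mu> \<kappa> \<and>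
        (AE h in distr \<mu> index_algebra hor_index.
           absolutely_continuous lborel (distr (\<kappa> h) borel fst)))"

end

theory Submission
  imports Defs
begin

text \<open>
  After one bounce every angle lies in a fixed interval \<open>J\<close> inside \<open>(- \<pi>/6, \<pi>/6)\<close>. At such an angle a
  horizontal side \<open>(i, i + 1) \<times> {\<theta>}\<close> splits into two pieces, of lengths \<open>pL \<theta>\<close> and \<open>pR \<theta>\<close>, and the map sends
  the left one affinely onto a whole side \<open>i - 1\<close> and the right one affinely onto a whole side \<open>i + 1\<close>, while
  the angle changes by one of the two contractions \<open>angL\<close>, \<open>angR\<close>. So the dynamics is a kind of baker map.
  The two contractions have disjoint images, hence the angles with an infinite past form a Cantor set
  \<open>angle_set\<close>; since the branches are onto, every point above this set has an infinite past, unless it is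
  singular. This identifies the attractor with \<open>({0..3} \<times> angle_set) - Sing lam\<close>, literally
  (\<open>attractor_eq\<close>, \<open>regular_set_eq\<close>), and shows that the map is invertible on it.

  As \<open>pL \<theta> + pR \<theta> = 1\<close>, a uniformly distributed position stays uniformly distributed, while the angle
  performs a Markov chain that applies \<open>angL\<close>, \<open>angR\<close> with probabilities \<open>pL \<theta>\<close>, \<open>pR \<theta>\<close>. If \<open>\<nu>\<close> is a
  stationary distribution of this chain, then the product of the uniform distribution on \<open>(0, 3)\<close> and
  \<open>\<nu>\<close> is an invariant measure whose conditional measures on the horizontal intervals are uniform. To find
  \<open>\<nu>\<close> and to prove ergodicity, one studies the Markov operator \<open>transfer\<close> of the pair of side and angle:
  the contraction of the angles and the positive lower bound \<open>pmin\<close> of the probabilities make its iterates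
  on a Lipschitz function converge uniformly to a constant (\<open>transfer_convergence\<close>). A weak limit of the
  distributions of the angle is therefore stationary (\<open>ex_stationary\<close>).

  For ergodicity (\<open>invariant_approx_const\<close>), approximate the indicator of an invariant set by a Lipschitz
  function \<open>g\<close>. Composing \<open>g\<close> with a large power of the inverse map, which contracts horizontally, gives an
  approximation that is almost constant on each side. Composing \<open>g\<close> with a large power of the map gives an
  approximation whose averages over the sides are almost independent of the side and the angle. Together they
  force the indicator to be constant almost everywhere. Transitivity follows, because the invariant measure
  is positive on every nonempty relatively open subset of the attractor.
\<close>

section \<open>The angle dynamics\<close>

locale contracting_pinball =
  fixes lam :: real
  assumes lam_pos: "0 < lam" and lam_less: "lam < 1/3"
begin

definition angR :: "real \<Rightarrow> real" where
  "angR \<theta> = lam * (pi/3 - \<theta>)"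

definition angL :: "real \<Rightarrow> real" where
  "angL \<theta> = lam * (- pi/3 - \<theta>)"

definition amax :: real where
  "amax = lam * pi / 2"

text \<open>
  At the angles \<open>\<plusminus> \<pi>/6\<close> one of the two bounces disappears. On the smaller interval \<open>J\<close>, which is invariant
  under both turns, each bounce occurs from a part of every side whose length is bounded below.
\<close>

definition J :: "real set" where
  "J = {- amax .. amax}"

lemma amax_pos: "0 < amax"
  using lam_pos by (simp add: amax_def)

lemma amax_less: "amax < pi / 6"
proof -
  have "lam * pi < 1/3 * pi" using lam_less by (intro mult_strict_right_mono) auto
  then show ?thesis by (simp add: amax_def)
qed

lemma zero_in_J: "0 \<in> J"
  using amax_pos by (simp add: J_def)

text \<open>
  The argument will be \<open>\<pi>/3 - \<theta>\<close> for the angle \<open>\<theta>\<close> of a right bounce, or \<open>- \<pi>/3 - \<theta>\<close> for a left one.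
\<close>

lemma lam_scale_le_amax:
  assumes "\<bar>x\<bar> \<le> pi / 2"
  shows "lam * x \<in> J"
proof -
  have "\<bar>lam * x\<bar> \<le> lam * (pi / 2)"
    using assms lam_pos by (simp add: abs_mult)
  then show ?thesis by (auto simp: J_def amax_def abs_le_iff)
qed

lemma angR_J: "\<theta> \<in> J \<Longrightarrow> angR \<theta> \<in> J"
  unfolding angR_def using amax_less by (intro lam_scale_le_amax) (auto simp: J_def)

lemma angL_J: "\<theta> \<in> J \<Longrightarrow> angL \<theta> \<in> J"
  unfolding angL_def using amax_less by (intro lam_scale_le_amax) (auto simp: J_def)

lemma angR_pos: "\<theta> \<in> J \<Longrightarrow> 0 < angR \<theta>"
  unfolding angR_def using amax_less lam_pos by (auto simp: J_def intro!: mult_pos_pos)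

lemma angL_neg: "\<theta> \<in> J \<Longrightarrow> angL \<theta> < 0"
  unfolding angL_def using amax_less lam_pos by (auto simp: J_def intro!: mult_pos_neg)

lemma angR_dist: "\<bar>angR x - angR y\<bar> = lam * \<bar>x - y\<bar>"
proof -
  have "angR x - angR y = lam * (y - x)" by (simp add: angR_def algebra_simps)
  then show ?thesis using lam_pos by (simp add: abs_mult abs_minus_commute)
qed

lemma angL_dist: "\<bar>angL x - angL y\<bar> = lam * \<bar>x - y\<bar>"
proof -
  have "angL x - angL y = lam * (y - x)" by (simp add: angL_def algebra_simps)
  then show ?thesis using lam_pos by (simp add: abs_mult abs_minus_commute)
qed

lemma angR_eq_iff [simp]: "angR x = angR y \<longleftrightarrow> x = y"
  using lam_pos by (simp add: angR_def)

lemma angL_eq_iff [simp]: "angL x = angL y \<longleftrightarrow> x = y"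
  using lam_pos by (simp add: angL_def)

lemma continuous_angR [continuous_intros]: "continuous_on A angR"
  unfolding angR_def by (intro continuous_intros)

lemma continuous_angL [continuous_intros]: "continuous_on A angL"
  unfolding angL_def by (intro continuous_intros)

lemma angR_measurable [measurable]: "angR \<in> borel_measurable borel"
  by (intro borel_measurable_continuous_onI continuous_angR)

lemma angL_measurable [measurable]: "angL \<in> borel_measurable borel"
  by (intro borel_measurable_continuous_onI continuous_angL)

definition turns :: "real set \<Rightarrow> real set" where
  "turns X = angR ` X \<union> angL ` X"

definition angle_set :: "real set" where
  "angle_set = (\<Inter>n. (turns ^^ n) J)"

lemma turns_mono: "X \<subseteq> Y \<Longrightarrow> turns X \<subseteq> turns Y"
  by (auto simp: turns_def)

lemma turns_J: "turns J \<subseteq> J"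
  using angR_J angL_J by (auto simp: turns_def)

lemma turns_funpow_decreasing: "(turns ^^ Suc n) J \<subseteq> (turns ^^ n) J"
proof (induction n)
  case 0
  then show ?case using turns_J by simp
next
  case (Suc n)
  then show ?case using turns_mono by simp
qed

lemma turns_funpow_J: "(turns ^^ n) J \<subseteq> J"
proof (induction n)
  case (Suc n)
  then show ?case using turns_funpow_decreasing[of n] by blast
qed simp

lemma angle_set_J: "angle_set \<subseteq> J"
  unfolding angle_set_def using turns_funpow_J by blast

lemma compact_turns_funpow: "compact ((turns ^^ n) J)"
proof (induction n)
  case 0
  then show ?case by (simp add: J_def)
next
  case (Suc n)
  then show ?case
    by (auto simp: turns_def intro!: compact_Un compact_continuous_image continuous_intros)
qed

lemma compact_angle_set: "compact angle_set"
  unfolding angle_set_def using compact_turns_funpow by (intro compact_Inter) auto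

lemma angle_set_angR: "\<theta> \<in> angle_set \<Longrightarrow> angR \<theta> \<in> angle_set"
  unfolding angle_set_def
proof clarify
  fix n assume *: "\<theta> \<in> (\<Inter>n. (turns ^^ n) J)"
  then have "angR \<theta> \<in> (turns ^^ Suc n) J" by (auto simp: turns_def)
  then show "angR \<theta> \<in> (turns ^^ n) J" using turns_funpow_decreasing by blast
qed

lemma angle_set_angL: "\<theta> \<in> angle_set \<Longrightarrow> angL \<theta> \<in> angle_set"
  unfolding angle_set_def
proof clarify
  fix n assume *: "\<theta> \<in> (\<Inter>n. (turns ^^ n) J)"
  then have "angL \<theta> \<in> (turns ^^ Suc n) J" by (auto simp: turns_def)
  then show "angL \<theta> \<in> (turns ^^ n) J" using turns_funpow_decreasing by blast
qed

text \<open>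
  The images of the two turns lie on opposite sides of \<open>0\<close>, so the sign of an angle reveals which
  turn produced it.
\<close>

lemma angle_set_pos_cases:
  assumes "\<theta> \<in> angle_set" "0 < \<theta>"
  obtains \<theta>' where "\<theta>' \<in> angle_set" "\<theta> = angR \<theta>'"
proof -
  have ex: "\<exists>t\<in>(turns ^^ n) J. \<theta> = angR t" for n
  proof -
    have "\<theta> \<in> (turns ^^ Suc n) J" using assms by (auto simp: angle_set_def simp del: funpow.simps)
    then consider t where "t \<in> (turns ^^ n) J" "\<theta> = angR t" | t where "t \<in> (turns ^^ n) J" "\<theta> = angL t"
      by (auto simp: turns_def)
    then show ?thesis
    proof cases
      case 2
      then have "t \<in> J" using turns_funpow_J by blast
      with angL_neg[of t] 2 assms show ?thesis by simp
    qed blast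
  qed
  from ex[of 0] obtain t where t: "\<theta> = angR t" by auto
  have "t \<in> (turns ^^ n) J" for n using ex[of n] t by auto
  then show ?thesis using t that by (auto simp: angle_set_def)
qed

lemma angle_set_nonpos_cases:
  assumes "\<theta> \<in> angle_set" "\<not> 0 < \<theta>"
  obtains \<theta>' where "\<theta>' \<in> angle_set" "\<theta> = angL \<theta>'"
proof -
  have ex: "\<exists>t\<in>(turns ^^ n) J. \<theta> = angL t" for n
  proof -
    have "\<theta> \<in> (turns ^^ Suc n) J" using assms by (auto simp: angle_set_def simp del: funpow.simps)
    then consider t where "t \<in> (turns ^^ n) J" "\<theta> = angR t" | t where "t \<in> (turns ^^ n) J" "\<theta> = angL t"
      by (auto simp: turns_def)
    then show ?thesis
    proof cases
      case 1
      then have "t \<in> J" using turns_funpow_J by blast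
      with angR_pos[of t] 1 assms show ?thesis by simp
    qed blast
  qed
  from ex[of 0] obtain t where t: "\<theta> = angL t" by auto
  have "t \<in> (turns ^^ n) J" for n using ex[of n] t by auto
  then show ?thesis using t that by (auto simp: angle_set_def)
qed

definition angR_fixed :: real where
  "angR_fixed = lam * pi / (3 * (1 + lam))"

lemma angR_fixed: "angR angR_fixed = angR_fixed"
  using lam_pos by (simp add: angR_def angR_fixed_def field_simps)

lemma angR_fixed_J: "angR_fixed \<in> J"
proof -
  have "lam * pi / (3 * (1 + lam)) \<le> lam * pi / 2"
    using lam_pos by (intro divide_left_mono) auto
  moreover have "0 \<le> lam * pi / (3 * (1 + lam))" using lam_pos by simp
  ultimately show ?thesis using amax_pos unfolding J_def angR_fixed_def atLeastAtMost_iff amax_def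
    by linarith
qed

lemma angR_fixed_angle_set: "angR_fixed \<in> angle_set"
proof -
  have "angR_fixed \<in> (turns ^^ n) J" for n
  proof (induction n)
    case (Suc n)
    then show ?case using angR_fixed by (force simp: turns_def)
  qed (simp add: angR_fixed_J)
  then show ?thesis by (auto simp: angle_set_def)
qed

lemma J_dist: "x \<in> J \<Longrightarrow> y \<in> J \<Longrightarrow> \<bar>x - y\<bar> \<le> pi"
  using amax_less by (auto simp: J_def)

text \<open>
  Every point of the angle set is the image of another one under some \<open>n\<close> turns; the same turns carry a
  different point of the angle set to a nearby one.
\<close>

lemma angle_set_close_point:
  "x \<in> angle_set \<Longrightarrow> \<exists>y\<in>angle_set. y \<noteq> x \<and> \<bar>x - y\<bar> \<le> lam ^ n * pi"
proof (induction n arbitrary: x)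
  case 0
  have "angL angR_fixed < 0" "0 < angR angR_fixed"
    using angL_neg angR_pos angR_fixed_J by auto
  then obtain y where "y \<in> angle_set" "y \<noteq> x"
    using angle_set_angR angle_set_angL angR_fixed_angle_set by (metis less_irrefl less_trans)
  moreover have "\<bar>x - y\<bar> \<le> pi" using J_dist angle_set_J 0 \<open>y \<in> angle_set\<close> by blast
  ultimately show ?case by auto
next
  case (Suc n)
  show ?case
  proof (cases "0 < x")
    case True
    with Suc.prems obtain x' where x': "x' \<in> angle_set" "x = angR x'" by (rule angle_set_pos_cases)
    from Suc.IH[OF x'(1)] obtain y' where y': "y' \<in> angle_set" "y' \<noteq> x'" "\<bar>x' - y'\<bar> \<le> lam ^ n * pi"
      by auto
    have "\<bar>x - angR y'\<bar> \<le> lam * (lam ^ n * pi)"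
      using y'(3) lam_pos by (simp add: x' angR_dist)
    then show ?thesis using y' x' angle_set_angR by (intro bexI[of _ "angR y'"]) auto
  next
    case False
    with Suc.prems obtain x' where x': "x' \<in> angle_set" "x = angL x'" by (rule angle_set_nonpos_cases)
    from Suc.IH[OF x'(1)] obtain y' where y': "y' \<in> angle_set" "y' \<noteq> x'" "\<bar>x' - y'\<bar> \<le> lam ^ n * pi"
      by auto
    have "\<bar>x - angL y'\<bar> \<le> lam * (lam ^ n * pi)"
      using y'(3) lam_pos by (simp add: x' angL_dist)
    then show ?thesis using y' x' angle_set_angL by (intro bexI[of _ "angL y'"]) auto
  qed
qed

lemma lam_power_tendsto_0: "(\<lambda>n. lam ^ n * c) \<longlonglongrightarrow> 0"
  using lam_pos lam_less by (intro tendsto_mult_left_zero LIMSEQ_realpow_zero) auto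

lemma ex_lam_power_less:
  assumes "0 < e"
  shows "\<exists>n. lam ^ n * c < e"
proof -
  have "eventually (\<lambda>n. lam ^ n * c < e) sequentially"
    using lam_power_tendsto_0[of c] assms by (rule order_tendstoD(2))
  then show ?thesis by (auto simp: eventually_sequentially)
qed

text \<open>
  A connected subset of the angle set cannot cross \<open>0\<close>, hence is the image of a connected subset
  under one of the two turns; iterating this, its diameter is at most \<open>lam ^ n * pi\<close> for all \<open>n\<close>.
\<close>

lemma connected_angle_set_dist:
  "connected S \<Longrightarrow> S \<subseteq> angle_set \<Longrightarrow> x \<in> S \<Longrightarrow> y \<in> S \<Longrightarrow> \<bar>x - y\<bar> \<le> lam ^ n * pi"
proof (induction n arbitrary: S x y)
  case 0
  then have "x \<in> J" "y \<in> J" using angle_set_J by auto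
  then show ?case using J_dist by simp
next
  case (Suc n)
  have nz: "0 \<notin> S"
  proof
    assume "0 \<in> S"
    then have "0 \<in> angle_set" using Suc.prems by auto
    then obtain t where "t \<in> angle_set" "0 = angL t" using angle_set_nonpos_cases[of 0] by auto
    then show False using angL_neg[of t] angle_set_J by auto
  qed
  have int: "{a..b} \<subseteq> S" if "a \<in> S" "b \<in> S" for a b
    using connected_contains_Icc[OF Suc.prems(1)] that by blast
  define inv where "inv c z = (c - z / lam)" for c z
  have conn: "connected (inv c ` S)" for c
    unfolding inv_def using Suc.prems(1) by (intro connected_continuous_image continuous_intros) (use lam_pos in auto)
  have "(\<forall>z\<in>S. 0 < z) \<or> (\<forall>z\<in>S. \<not> 0 < z)"
  proof (rule ccontr)
    assume "\<not> ?thesis"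
    then obtain a b where "a \<in> S" "b \<in> S" "0 < b" "\<not> 0 < a" by blast
    then have "0 \<in> {a..b}" by auto
    then show False using int \<open>a \<in> S\<close> \<open>b \<in> S\<close> nz by blast
  qed
  then consider "\<forall>z\<in>S. 0 < z" | "\<forall>z\<in>S. \<not> 0 < z" by blast
  then show ?case
  proof cases
    case 1
    have i: "inv (pi/3) (angR t) = t" for t using lam_pos by (simp add: inv_def angR_def)
    have sub: "inv (pi/3) ` S \<subseteq> angle_set"
    proof clarify
      fix z assume "z \<in> S"
      then obtain t where "t \<in> angle_set" "z = angR t" using 1 Suc.prems(2) angle_set_pos_cases by blast
      then show "inv (pi/3) z \<in> angle_set" by (simp add: i)
    qed
    have "\<bar>inv (pi/3) x - inv (pi/3) y\<bar> \<le> lam ^ n * pi"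
      using Suc.prems by (intro Suc.IH[OF conn sub]) auto
    moreover have "\<bar>inv (pi/3) x - inv (pi/3) y\<bar> = \<bar>x - y\<bar> / lam"
      using lam_pos by (simp add: inv_def flip: diff_divide_distrib abs_divide) (simp add: abs_minus_commute)
    ultimately show ?thesis using lam_pos by (simp add: field_simps)
  next
    case 2
    have i: "inv (- (pi/3)) (angL t) = t" for t using lam_pos by (simp add: inv_def angL_def)
    have sub: "inv (- (pi/3)) ` S \<subseteq> angle_set"
    proof clarify
      fix z assume "z \<in> S"
      then obtain t where "t \<in> angle_set" "z = angL t" using 2 Suc.prems(2) angle_set_nonpos_cases by blast
      then show "inv (- (pi/3)) z \<in> angle_set" by (simp add: i)
    qed
    have "\<bar>inv (- (pi/3)) x - inv (- (pi/3)) y\<bar> \<le> lam ^ n * pi"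
      using Suc.prems by (intro Suc.IH[OF conn sub]) auto
    moreover have "\<bar>inv (- (pi/3)) x - inv (- (pi/3)) y\<bar> = \<bar>x - y\<bar> / lam"
      using lam_pos by (simp add: inv_def flip: diff_divide_distrib abs_divide) (simp add: abs_minus_commute)
    ultimately show ?thesis using lam_pos by (simp add: field_simps)
  qed
qed

lemma cantor_set_angle_set: "cantor_set angle_set"
  unfolding cantor_set_def
proof (intro conjI allI impI ballI)
  show "angle_set \<noteq> {}" using angR_fixed_angle_set by auto
  show "compact angle_set" by (rule compact_angle_set)
next
  fix x assume x: "x \<in> angle_set"
  show "x islimpt angle_set" unfolding islimpt_approachable
  proof (intro allI impI)
    fix e :: real assume "0 < e"
    then obtain n where n: "lam ^ n * pi < e" using ex_lam_power_less by blast
    obtain y where "y \<in> angle_set" "y \<noteq> x" "\<bar>x - y\<bar> \<le> lam ^ n * pi"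
      using angle_set_close_point[OF x] by blast
    then show "\<exists>x'\<in>angle_set. x' \<noteq> x \<and> dist x' x < e"
      using n by (intro bexI[of _ y]) (auto simp: dist_real_def)
  qed
next
  fix S assume S: "S \<subseteq> angle_set \<and> connected S"
  have eq: "x = y" if "x \<in> S" "y \<in> S" for x y
  proof (rule ccontr)
    assume "x \<noteq> y"
    then obtain n where "lam ^ n * pi < \<bar>x - y\<bar>" using ex_lam_power_less[of "\<bar>x - y\<bar>"] by auto
    then show False using connected_angle_set_dist[of S x y n] S that by auto
  qed
  show "\<exists>x. S \<subseteq> {x}"
  proof (cases "S = {}")
    case False
    then show ?thesis using eq by blast
  qed auto
qed

section \<open>The bounce probabilities\<close>

text \<open>
  The length of the part of a side from which the particle bounces to the right. Restricting the argument
  to \<open>J\<close> makes the function continuous on the whole line, with values bounded away from \<open>0\<close> and \<open>1\<close>.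
\<close>

definition pR :: "real \<Rightarrow> real" where
  "pR \<theta> = 1/2 + sqrt 3 / 2 * tan (max (- amax) (min amax \<theta>))"

definition pL :: "real \<Rightarrow> real" where
  "pL \<theta> = 1 - pR \<theta>"

definition pmin :: real where
  "pmin = 1/2 - sqrt 3 / 2 * tan amax"

lemma pR_J: "\<theta> \<in> J \<Longrightarrow> pR \<theta> = 1/2 + sqrt 3 / 2 * tan \<theta>"
  by (simp add: pR_def J_def)

lemma J_tan_bounds: "x \<in> J \<Longrightarrow> - (pi/2) < x \<and> x < pi/2 \<and> cos x \<ge> sqrt 3 / 2"
proof (intro conjI)
  assume x: "x \<in> J"
  show "- (pi/2) < x" "x < pi/2" using x amax_less pi_gt_zero by (auto simp: J_def)
  have "\<bar>x\<bar> \<le> pi / 6" using x amax_less by (auto simp: J_def)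
  then have "cos (pi/6) \<le> cos \<bar>x\<bar>" by (intro cos_monotone_0_pi_le) auto
  then show "sqrt 3 / 2 \<le> cos x" by (simp add: cos_30)
qed

lemma clamp_J: "max (- amax) (min amax \<theta>) \<in> J"
  using amax_pos by (auto simp: J_def)

lemma tan_mono_J: "x \<in> J \<Longrightarrow> y \<in> J \<Longrightarrow> x \<le> y \<Longrightarrow> tan x \<le> tan y"
  using J_tan_bounds tan_mono_le[of x y] by blast

lemma pmin_pos: "0 < pmin"
proof -
  have "tan amax < tan (pi/6)" using amax_pos amax_less by (intro tan_monotone) auto
  then have "tan amax < 1 / sqrt 3" by (simp add: tan_30)
  then have "sqrt 3 * tan amax < 1" by (simp add: field_simps)
  then show ?thesis by (simp add: pmin_def)
qed

lemma pR_bounds: "pmin \<le> pR \<theta>" "pR \<theta> \<le> 1 - pmin"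
proof -
  let ?c = "max (- amax) (min amax \<theta>)"
  have "tan (- amax) \<le> tan ?c" "tan ?c \<le> tan amax"
    using amax_pos by (intro tan_mono_J clamp_J; auto simp: J_def)+
  then have "- tan amax \<le> tan ?c" by simp
  have "sqrt 3 / 2 * (- tan amax) \<le> sqrt 3 / 2 * tan ?c" "sqrt 3 / 2 * tan ?c \<le> sqrt 3 / 2 * tan amax"
    using \<open>- tan amax \<le> tan ?c\<close> \<open>tan ?c \<le> tan amax\<close> by (intro mult_left_mono; simp)+
  then show "pmin \<le> pR \<theta>" "pR \<theta> \<le> 1 - pmin" by (simp_all add: pR_def pmin_def)
qed

lemma pL_bounds: "pmin \<le> pL \<theta>" "pL \<theta> \<le> 1 - pmin"
  using pR_bounds[of \<theta>] by (simp_all add: pL_def)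

lemma pR_pos: "0 < pR \<theta>" and pL_pos: "0 < pL \<theta>" and pR_less_1: "pR \<theta> < 1" and pL_less_1: "pL \<theta> < 1"
  using pR_bounds[of \<theta>] pL_bounds[of \<theta>] pmin_pos by linarith+

lemma pmin_less_1: "pmin < 1"
  using pR_bounds[of 0] pmin_pos by linarith

lemma isCont_pR: "isCont pR x"
proof -
  have c: "cos (max (- amax) (min amax x)) \<noteq> 0"
  proof -
    have "0 < sqrt 3 / 2" by simp
    then show ?thesis using J_tan_bounds[OF clamp_J[of x]] by linarith
  qed
  show ?thesis unfolding pR_def using c by (intro continuous_intros) auto
qed

lemma isCont_pL: "isCont pL x"
  unfolding pL_def by (intro continuous_intros isCont_pR)

lemma pR_measurable [measurable]: "pR \<in> borel_measurable borel"
  using isCont_pR by (intro borel_measurable_continuous_onI) (simp add: continuous_at_imp_continuous_on)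

lemma pL_measurable [measurable]: "pL \<in> borel_measurable borel"
  unfolding pL_def by measurable

lemma pR_Lipschitz:
  assumes "x \<in> J" "y \<in> J"
  shows "\<bar>pR x - pR y\<bar> \<le> 2 * \<bar>x - y\<bar>"
proof -
  have "norm (tan x - tan y) \<le> 4/3 * norm (x - y)"
  proof (rule field_differentiable_bound[of J])
    show "convex J" by (simp add: J_def)
    fix z assume z: "z \<in> J"
    have cz: "cos z \<ge> sqrt 3 / 2" using J_tan_bounds[OF z] by auto
    moreover have s: "0 < sqrt 3 / 2" by simp
    ultimately have "cos z \<noteq> 0" by linarith
    then show "(tan has_field_derivative inverse ((cos z)\<^sup>2)) (at z within J)"
      using DERIV_tan has_field_derivative_at_within by blast
    have "(sqrt 3 / 2)\<^sup>2 \<le> (cos z)\<^sup>2" using cz s by (intro power_mono) auto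
    then have "3/4 \<le> (cos z)\<^sup>2" by (simp add: power_divide)
    then have "inverse ((cos z)\<^sup>2) \<le> inverse (3/4)" by (intro le_imp_inverse_le) auto
    then show "norm (inverse ((cos z)\<^sup>2)) \<le> 4/3" by simp
  qed (use assms in auto)
  then have t: "\<bar>tan x - tan y\<bar> \<le> 4/3 * \<bar>x - y\<bar>" by simp
  have "pR x - pR y = sqrt 3 / 2 * (tan x - tan y)"
    using assms by (simp add: pR_J algebra_simps)
  then have "\<bar>pR x - pR y\<bar> = sqrt 3 / 2 * \<bar>tan x - tan y\<bar>"
    by (simp only: abs_mult) simp
  also have "\<dots> \<le> 1 * \<bar>tan x - tan y\<bar>"
    by (intro mult_right_mono) (auto simp: real_le_lsqrt real_sqrt_le_iff intro: real_le_lsqrt)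
  also have "\<dots> \<le> 4/3 * \<bar>x - y\<bar>" using t by simp
  also have "\<dots> \<le> 2 * \<bar>x - y\<bar>" by simp
  finally show ?thesis .
qed

end

section \<open>The billiard map in fibre coordinates\<close>

context contracting_pinball
begin

text \<open>
  The side is reduced modulo \<open>3\<close>, so that the neighbours of side \<open>i\<close> are always \<open>i + 1\<close> and \<open>i - 1\<close>.
\<close>

definition pt :: "int \<Rightarrow> real \<Rightarrow> real \<Rightarrow> real \<times> real" where
  "pt i u \<theta> = (of_int (i mod 3) + u, \<theta>)"

lemma snd_pt [simp]: "snd (pt i u \<theta>) = \<theta>"
  by (simp add: pt_def)

lemma pt_cong: "i mod 3 = j mod 3 \<Longrightarrow> pt i u \<theta> = pt j u \<theta>"
  by (simp add: pt_def)

lemma floor_pt: "0 < u \<Longrightarrow> u < 1 \<Longrightarrow> \<lfloor>fst (pt i u \<theta>)\<rfloor> = i mod 3"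
  by (simp add: pt_def floor_eq_iff)

lemma frac_pt: "0 < u \<Longrightarrow> u < 1 \<Longrightarrow> frac (fst (pt i u \<theta>)) = u"
  by (simp add: frac_def floor_pt) (simp add: pt_def)

lemma mod_3_cases: "i mod 3 = 0 \<or> i mod 3 = 1 \<or> i mod 3 = 2" for i :: int
proof -
  have three: "k = 0 \<or> k = 1 \<or> k = 2" if "0 \<le> k" "k < 3" for k :: int
    using that by linarith
  have "(0::int) < 3" by simp
  from three[OF pos_mod_sign[OF this] pos_mod_bound[OF this]] show ?thesis .
qed

lemma pt_M_tilde:
  assumes "0 < u" "u < 1" "\<theta> \<in> J"
  shows "pt i u \<theta> \<in> M_tilde"
proof -
  obtain k where k: "i mod 3 = k" "k = 0 \<or> k = 1 \<or> k = 2" using mod_3_cases by blast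
  have "- (pi/2) < \<theta>" "\<theta> < pi/2" using J_tan_bounds assms(3) by auto
  then show ?thesis unfolding pt_def k(1) using k(2) assms by (auto simp: M_tilde_def)
qed

lemma M_tilde_eq_pt:
  assumes "s \<in> {0<..<1} \<union> {1<..<2} \<union> {2<..<3}"
  shows "(s, \<theta>) = pt \<lfloor>s\<rfloor> (frac s) \<theta>" "0 < frac s" "frac s < 1"
proof -
  consider "\<lfloor>s\<rfloor> = 0" "0 < s" | "\<lfloor>s\<rfloor> = 1" "1 < s" | "\<lfloor>s\<rfloor> = 2" "2 < s"
    using assms by (auto simp: floor_eq_iff)
  then show "(s, \<theta>) = pt \<lfloor>s\<rfloor> (frac s) \<theta>" "0 < frac s"
    by (cases; simp add: pt_def frac_def)+
  show "frac s < 1" by (rule frac_lt_1)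
qed

lemma vertex_angle_less_iff:
  assumes "\<theta> \<in> J" "0 < u" "u < 1"
  shows "vertex_angle (fst (pt i u \<theta>)) < \<theta> \<longleftrightarrow> pL \<theta> < u"
    and "\<theta> < vertex_angle (fst (pt i u \<theta>)) \<longleftrightarrow> u < pL \<theta>"
proof -
  have at: "\<theta> = arctan (tan \<theta>)" using J_tan_bounds[OF assms(1)] by (simp add: arctan_tan)
  have "arctan ((1 - 2 * u) / sqrt 3) < arctan (tan \<theta>) \<longleftrightarrow> pL \<theta> < u"
    "arctan (tan \<theta>) < arctan ((1 - 2 * u) / sqrt 3) \<longleftrightarrow> u < pL \<theta>"
    using assms(1) by (auto simp: arctan_less_iff pL_def pR_J field_simps)
  then show "vertex_angle (fst (pt i u \<theta>)) < \<theta> \<longleftrightarrow> pL \<theta> < u"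
    "\<theta> < vertex_angle (fst (pt i u \<theta>)) \<longleftrightarrow> u < pL \<theta>"
    using assms at by (simp_all add: vertex_angle_def frac_pt)
qed

lemma hits_vertex_pt:
  assumes "\<theta> \<in> J" "0 < u" "u < 1"
  shows "hits_vertex (pt i u \<theta>) \<longleftrightarrow> u = pL \<theta>"
  using vertex_angle_less_iff[OF assms, of i] unfolding hits_vertex_def snd_pt
  by (metis linorder_neq_iff)

lemma cos_ratio:
  assumes "\<theta> \<in> J"
  shows "cos \<theta> / cos (pi/3 - \<theta>) = 1 / pR \<theta>" "cos \<theta> / cos (pi/3 + \<theta>) = 1 / pL \<theta>"
proof -
  have s: "0 < sqrt 3 / 2" by simp
  have c: "cos \<theta> \<noteq> 0" using J_tan_bounds[OF assms] s by linarith
  have "cos (pi/3 - \<theta>) = cos \<theta> * pR \<theta>" "cos (pi/3 + \<theta>) = cos \<theta> * pL \<theta>"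
    unfolding cos_diff cos_add cos_60 sin_60 using c assms
    by (simp_all add: pR_J pL_def tan_def field_simps)
  then show "cos \<theta> / cos (pi/3 - \<theta>) = 1 / pR \<theta>" "cos \<theta> / cos (pi/3 + \<theta>) = 1 / pL \<theta>"
    using c by simp_all
qed

lemma rmod_3_of_int_add:
  assumes "0 \<le> x" "x < 1"
  shows "(of_int k + x) rmod 3 = of_int (k mod 3) + x"
proof -
  have "(of_int k + x) rmod 3 = (of_int (k mod 3) + x) rmod 3"
  proof -
    have "[of_int (k mod 3) + x = of_int k + x] (rmod 3)"
      unfolding rcong_altdef
    proof
      have "k = k mod 3 + 3 * (k div 3)" by simp
      then have "real_of_int k = of_int (k mod 3) + 3 * of_int (k div 3)"
        by (metis of_int_add of_int_mult of_int_numeral)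
      then show "of_int k + x = of_int (k mod 3) + x + of_int (k div 3) * 3" by simp
    qed
    then show ?thesis by (simp add: rcong_def)
  qed
  also have "\<dots> = of_int (k mod 3) + x"
  proof (rule rmod_idem)
    have "0 \<le> k mod 3" "k mod 3 \<le> 2" by auto
    then have "0 \<le> real_of_int (k mod 3)" "real_of_int (k mod 3) \<le> 2" by linarith+
    then show "of_int (k mod 3) + x \<in> {0..<\<bar>3\<bar>}" using assms by auto
  qed
  finally show ?thesis .
qed

lemma right_coord_bounds:
  assumes "pL \<theta> < u" "u < 1"
  shows "0 < (1 - u) / pR \<theta>" "(1 - u) / pR \<theta> < 1"
  using assms pR_pos[of \<theta>] by (auto simp: field_simps pL_def)

lemma left_coord_bounds:
  assumes "0 < u" "u < pL \<theta>"
  shows "0 < 1 - u / pL \<theta>" "1 - u / pL \<theta> < 1"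
  using assms pL_pos[of \<theta>] by (auto simp: field_simps)

text \<open>
  For an angle in \<open>J\<close>, the part of a side to the right of \<open>pL \<theta>\<close> is mapped affinely onto the whole
  next side and the part to its left onto the whole previous one. The two contraction factors add up
  to \<open>1\<close>, so Lebesgue measure is preserved, with the angle chosen at random between its two images.
\<close>

lemma pinball_right:
  assumes "\<theta> \<in> J" "0 < u" "u < 1" "pL \<theta> < u"
  shows "pinball lam (pt i u \<theta>) = pt (i + 1) ((1 - u) / pR \<theta>) (angR \<theta>)"
proof -
  have v: "vertex_angle (fst (pt i u \<theta>)) < \<theta>" using assms vertex_angle_less_iff by blast
  have "pinball lam (pt i u \<theta>) =
      ((of_int (i mod 3) + 1 + (1 - u) * (cos \<theta> / cos (pi/3 - \<theta>))) rmod 3, lam * (pi/3 - \<theta>))"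
    using v floor_pt[OF assms(2,3), of i \<theta>] frac_pt[OF assms(2,3), of i \<theta>]
    by (simp add: pinball_def pt_def Let_def)
  also have "(of_int (i mod 3) + 1 + (1 - u) * (cos \<theta> / cos (pi/3 - \<theta>))) rmod 3
      = (of_int (i mod 3 + 1) + (1 - u) / pR \<theta>) rmod 3"
    using cos_ratio[OF assms(1)] by simp
  also have "\<dots> = of_int ((i mod 3 + 1) mod 3) + (1 - u) / pR \<theta>"
    using right_coord_bounds[OF assms(4,3)] by (intro rmod_3_of_int_add) auto
  also have "(i mod 3 + 1) mod 3 = (i + 1) mod 3" by (simp add: mod_add_left_eq)
  finally show ?thesis by (simp add: pt_def angR_def)
qed

lemma pinball_left:
  assumes "\<theta> \<in> J" "0 < u" "u < 1" "u < pL \<theta>"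
  shows "pinball lam (pt i u \<theta>) = pt (i - 1) (1 - u / pL \<theta>) (angL \<theta>)"
proof -
  have v: "\<theta> < vertex_angle (fst (pt i u \<theta>))" using assms vertex_angle_less_iff by blast
  have "pinball lam (pt i u \<theta>) =
      ((of_int (i mod 3) - u * (cos \<theta> / cos (pi/3 + \<theta>))) rmod 3, lam * (- pi/3 - \<theta>))"
    using v floor_pt[OF assms(2,3), of i \<theta>] frac_pt[OF assms(2,3), of i \<theta>]
    by (simp add: pinball_def pt_def Let_def)
  also have "(of_int (i mod 3) - u * (cos \<theta> / cos (pi/3 + \<theta>))) rmod 3
      = (of_int (i mod 3 - 1) + (1 - u / pL \<theta>)) rmod 3"
    using cos_ratio[OF assms(1)] by simp
  also have "\<dots> = of_int ((i mod 3 - 1) mod 3) + (1 - u / pL \<theta>)"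
    using left_coord_bounds[OF assms(2,4)] by (intro rmod_3_of_int_add) auto
  also have "(i mod 3 - 1) mod 3 = (i - 1) mod 3" by (simp add: mod_diff_left_eq)
  finally show ?thesis by (simp add: pt_def angL_def)
qed

section \<open>The attractor\<close>

text \<open>
  The inverse of the billiard map on the attractor: the sign of the angle tells which turn was taken
  last, and the rest of the formula solves for the starting point of that bounce.
\<close>

definition unbounce :: "real \<times> real \<Rightarrow> real \<times> real" where
  "unbounce = (\<lambda>(s, \<theta>).
     if 0 < \<theta> then pt (\<lfloor>s\<rfloor> - 1) (1 - frac s * pR (pi/3 - \<theta> / lam)) (pi/3 - \<theta> / lam)
     else pt (\<lfloor>s\<rfloor> + 1) ((1 - frac s) * pL (- pi/3 - \<theta> / lam)) (- pi/3 - \<theta> / lam))"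

lemma unbounce_pos:
  assumes "0 < u" "u < 1" "0 < \<theta>"
  shows "unbounce (pt i u \<theta>) = pt (i - 1) (1 - u * pR (pi/3 - \<theta> / lam)) (pi/3 - \<theta> / lam)"
proof -
  have "unbounce (pt i u \<theta>) = pt (i mod 3 - 1) (1 - u * pR (pi/3 - \<theta> / lam)) (pi/3 - \<theta> / lam)"
    using floor_pt[OF assms(1,2), of i \<theta>] frac_pt[OF assms(1,2), of i \<theta>] assms(3)
    by (simp add: unbounce_def case_prod_beta)
  also have "\<dots> = pt (i - 1) (1 - u * pR (pi/3 - \<theta> / lam)) (pi/3 - \<theta> / lam)"
    by (intro pt_cong) (simp add: mod_diff_left_eq)
  finally show ?thesis .
qed

lemma unbounce_nonpos:
  assumes "0 < u" "u < 1" "\<not> 0 < \<theta>"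
  shows "unbounce (pt i u \<theta>) = pt (i + 1) ((1 - u) * pL (- pi/3 - \<theta> / lam)) (- pi/3 - \<theta> / lam)"
proof -
  have "unbounce (pt i u \<theta>) = pt (i mod 3 + 1) ((1 - u) * pL (- pi/3 - \<theta> / lam)) (- pi/3 - \<theta> / lam)"
    using floor_pt[OF assms(1,2), of i \<theta>] frac_pt[OF assms(1,2), of i \<theta>] assms(3)
    by (simp add: unbounce_def case_prod_beta)
  also have "\<dots> = pt (i + 1) ((1 - u) * pL (- pi/3 - \<theta> / lam)) (- pi/3 - \<theta> / lam)"
    by (intro pt_cong) (simp add: mod_add_left_eq)
  finally show ?thesis .
qed

lemma unbounce_angR:
  assumes "0 < u" "u < 1" "\<theta> \<in> J"
  shows "unbounce (pt i u (angR \<theta>)) = pt (i - 1) (1 - u * pR \<theta>) \<theta>"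
proof -
  have "pi/3 - angR \<theta> / lam = \<theta>" using lam_pos by (simp add: angR_def)
  then show ?thesis using unbounce_pos[OF assms(1,2) angR_pos[OF assms(3)]] by simp
qed

lemma unbounce_angL:
  assumes "0 < u" "u < 1" "\<theta> \<in> J"
  shows "unbounce (pt i u (angL \<theta>)) = pt (i + 1) ((1 - u) * pL \<theta>) \<theta>"
proof -
  have "- pi/3 - angL \<theta> / lam = \<theta>" "\<not> 0 < angL \<theta>"
    using lam_pos angL_neg[OF assms(3)] by (simp_all add: angL_def)
  then show ?thesis using unbounce_nonpos[OF assms(1,2)] by simp
qed

lemma unbounce_pinball_pt:
  assumes "\<theta> \<in> J" "0 < u" "u < 1" "u \<noteq> pL \<theta>"
  shows "unbounce (pinball lam (pt i u \<theta>)) = pt i u \<theta>"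
proof (cases "pL \<theta> < u")
  case True
  then show ?thesis
    using assms right_coord_bounds[OF True] pR_pos[of \<theta>]
    by (simp add: pinball_right unbounce_angR)
next
  case False
  then have l: "u < pL \<theta>" using assms by simp
  then show ?thesis
    using assms left_coord_bounds[OF _ l] pL_pos[of \<theta>]
    by (simp add: pinball_left unbounce_angL)
qed

lemma pinball_unbounce_pt:
  assumes "\<theta> \<in> angle_set" "0 < u" "u < 1"
  obtains j v t where "unbounce (pt i u \<theta>) = pt j v t" "0 < v" "v < 1" "t \<in> angle_set"
    "v \<noteq> pL t" "pinball lam (pt j v t) = pt i u \<theta>"
proof (cases "0 < \<theta>")
  case True
  then obtain t where t: "t \<in> angle_set" "\<theta> = angR t"
    using assms(1) angle_set_pos_cases by blast
  have tJ: "t \<in> J" using t angle_set_J by blast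
  let ?v = "1 - u * pR t"
  have "0 < u * pR t" "u * pR t < pR t" using assms pR_pos[of t] by auto
  then have v: "0 < ?v" "?v < 1" "pL t < ?v"
    using pR_less_1[of t] by (simp_all add: pL_def)
  have "pinball lam (pt (i - 1) ?v t) = pt i u \<theta>"
    using pinball_right[OF tJ v, of "i - 1"] pR_pos[of t] by (simp add: t)
  then show ?thesis
    using that[of "i - 1" ?v t] v t unbounce_angR[OF assms(2,3) tJ] by simp
next
  case False
  then obtain t where t: "t \<in> angle_set" "\<theta> = angL t"
    using assms(1) angle_set_nonpos_cases by blast
  have tJ: "t \<in> J" using t angle_set_J by blast
  let ?v = "(1 - u) * pL t"
  have "0 < (1 - u) * pL t" "(1 - u) * pL t < 1 * pL t" 
    using assms pL_pos[of t] by (auto intro!: mult_strict_right_mono mult_pos_pos)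
  then have v: "0 < ?v" "?v < 1" "?v < pL t"
    using pL_less_1[of t] by linarith+
  have "pinball lam (pt (i + 1) ?v t) = pt i u \<theta>"
    using pinball_left[OF tJ v, of "i + 1"] pL_pos[of t] by (simp add: t)
  moreover have "unbounce (pt i u \<theta>) = pt (i + 1) ?v t"
    unfolding t(2) by (rule unbounce_angL[OF assms(2,3) tJ])
  moreover have "?v \<noteq> pL t" using v(3) by (rule less_imp_neq)
  ultimately show ?thesis using that v(1,2) t(1) by blast
qed

definition never_hits :: "real \<times> real \<Rightarrow> bool" where
  "never_hits x \<longleftrightarrow> (\<forall>n. \<not> hits_vertex ((pinball lam ^^ n) x))"

lemma never_hits_iff: "never_hits x \<longleftrightarrow> \<not> hits_vertex x \<and> never_hits (pinball lam x)"
proof -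
  have "(\<forall>n. \<not> hits_vertex ((pinball lam ^^ n) x)) \<longleftrightarrow>
    \<not> hits_vertex x \<and> (\<forall>n. \<not> hits_vertex ((pinball lam ^^ Suc n) x))"
  proof (intro iffI conjI allI)
    fix n assume *: "\<not> hits_vertex x \<and> (\<forall>n. \<not> hits_vertex ((pinball lam ^^ Suc n) x))"
    then show "\<not> hits_vertex ((pinball lam ^^ n) x)" by (cases n) auto
  next
    assume *: "\<forall>n. \<not> hits_vertex ((pinball lam ^^ n) x)"
    show "\<not> hits_vertex x" using *[rule_format, of 0] by simp
    show "\<not> hits_vertex ((pinball lam ^^ Suc n) x)" for n using * by blast
  qed
  then show ?thesis by (simp add: never_hits_def funpow_swap1)
qed

lemma snd_pinball:
  "\<not> hits_vertex y \<Longrightarrow> snd (pinball lam y) \<in> {angR (snd y), angL (snd y)}"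
  by (auto simp: pinball_def Let_def case_prod_beta hits_vertex_def angR_def angL_def)

text \<open>
  The first bounce brings every angle into \<open>J\<close>, because only angles above \<open>- \<pi>/6\<close> bounce to the right and
  only angles below \<open>\<pi>/6\<close> to the left. Every further bounce applies one of the two turns.
\<close>

lemma attractor_angle:
  assumes "never_hits q" "snd q \<in> {- pi/2<..<pi/2}"
  shows "snd ((pinball lam ^^ Suc n) q) \<in> (turns ^^ n) J"
proof (induction n)
  case 0
  obtain s \<theta> where q: "q = (s, \<theta>)" by fastforce
  have fr: "0 \<le> frac s" "frac s < 1" by (simp_all add: frac_lt_1)
  have b: "arctan (- 1 / sqrt 3) \<le> vertex_angle s" "vertex_angle s \<le> arctan (1 / sqrt 3)"
    unfolding vertex_angle_def using fr
    by (intro arctan_monotone' divide_right_mono; simp)+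
  have "arctan (1 / sqrt 3) = pi / 6"
    using arctan_tan[of "pi/6"] by (simp add: tan_30)
  with b have b: "- (pi / 6) \<le> vertex_angle s" "vertex_angle s \<le> pi / 6"
    by (simp_all add: arctan_minus)
  have "\<theta> \<noteq> vertex_angle s" using assms(1) never_hits_iff[of q] by (simp add: hits_vertex_def q)
  moreover have "snd (pinball lam q) \<in> J" if "vertex_angle s < \<theta>"
  proof -
    have "\<bar>pi/3 - \<theta>\<bar> \<le> pi/2" unfolding abs_le_iff using that b assms(2) by (simp add: q)
    then show ?thesis using that lam_scale_le_amax by (simp add: q pinball_def Let_def)
  qed
  moreover have "snd (pinball lam q) \<in> J" if "\<theta> < vertex_angle s"
  proof -
    have "\<bar>- pi/3 - \<theta>\<bar> \<le> pi/2" unfolding abs_le_iff using that b assms(2) by (simp add: q)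
    then show ?thesis using that lam_scale_le_amax[of "- pi/3 - \<theta>"] by (simp add: q pinball_def Let_def)
  qed
  ultimately show ?case by force
next
  case (Suc n)
  let ?y = "(pinball lam ^^ Suc n) q"
  have "\<not> hits_vertex ?y" using assms(1) unfolding never_hits_def by blast
  then have "snd (pinball lam ?y) \<in> {angR (snd ?y), angL (snd ?y)}"
    by (rule snd_pinball)
  then have "snd (pinball lam ?y) \<in> turns ((turns ^^ n) J)"
    using Suc unfolding turns_def[of "(turns ^^ n) J"] by blast
  then show ?case by simp
qed

definition regular_set :: "(real \<times> real) set" where
  "regular_set = {x. never_hits x \<and> (\<exists>i u \<theta>. x = pt i u \<theta> \<and> 0 < u \<and> u < 1 \<and> \<theta> \<in> angle_set)}"

lemma regular_setE:
  assumes "x \<in> regular_set"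
  obtains i u \<theta> where "x = pt i u \<theta>" "0 < u" "u < 1" "\<theta> \<in> angle_set" "\<theta> \<in> J" "u \<noteq> pL \<theta>"
    "never_hits x"
proof -
  from assms obtain i u \<theta> where x: "x = pt i u \<theta>" "0 < u" "u < 1" "\<theta> \<in> angle_set" "never_hits x"
    by (auto simp: regular_set_def)
  moreover have "\<theta> \<in> J" using x angle_set_J by auto
  moreover have "u \<noteq> pL \<theta>"
    using x(5) never_hits_iff[of x] hits_vertex_pt[OF \<open>\<theta> \<in> J\<close> x(2,3)] x(1) by simp
  ultimately show ?thesis using that by blast
qed

lemma unbounce_pinball: "x \<in> regular_set \<Longrightarrow> unbounce (pinball lam x) = x"
  by (elim regular_setE) (simp add: unbounce_pinball_pt)

lemma pinball_regular_set:
  assumes "x \<in> regular_set"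
  shows "pinball lam x \<in> regular_set"
  using assms
proof (rule regular_setE)
  fix i u \<theta> assume *: "x = pt i u \<theta>" "0 < u" "u < 1" "\<theta> \<in> angle_set" "\<theta> \<in> J" "u \<noteq> pL \<theta>" "never_hits x"
  have nh: "never_hits (pinball lam x)" using * never_hits_iff by blast
  show ?thesis
  proof (cases "pL \<theta> < u")
    case True
    then have "pinball lam x = pt (i + 1) ((1 - u) / pR \<theta>) (angR \<theta>)" using * by (simp add: pinball_right)
    then show ?thesis
      using nh right_coord_bounds[OF True] * angle_set_angR unfolding regular_set_def by blast
  next
    case False
    then have l: "u < pL \<theta>" using * by simp
    then have "pinball lam x = pt (i - 1) (1 - u / pL \<theta>) (angL \<theta>)" using * by (simp add: pinball_left)
    then show ?thesis
      using nh left_coord_bounds[OF _ l] * angle_set_angL unfolding regular_set_def by blast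
  qed
qed

lemma unbounce_regular_set:
  assumes "x \<in> regular_set"
  shows "unbounce x \<in> regular_set" "pinball lam (unbounce x) = x"
proof -
  from assms obtain i u \<theta> where x: "x = pt i u \<theta>" "0 < u" "u < 1" "\<theta> \<in> angle_set" "never_hits x"
    by (elim regular_setE)
  from pinball_unbounce_pt[OF x(4,2,3), of i]
  obtain j v t where y: "unbounce x = pt j v t" "0 < v" "v < 1" "t \<in> angle_set" "v \<noteq> pL t"
    "pinball lam (unbounce x) = x"
    using x(1) by metis
  then have "\<not> hits_vertex (unbounce x)" using hits_vertex_pt[of t v j] angle_set_J by auto
  then have "never_hits (unbounce x)" using never_hits_iff[of "unbounce x"] x y by simp
  then show "unbounce x \<in> regular_set" "pinball lam (unbounce x) = x"
    using y unfolding regular_set_def by blast+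
qed

lemma pinball_image_regular_set: "pinball lam ` regular_set = regular_set"
  using pinball_regular_set unbounce_regular_set by (metis image_subset_iff subsetI subset_antisym image_eqI)

lemma pinball_funpow_image_regular_set: "(pinball lam ^^ n) ` regular_set = regular_set"
proof (induction n)
  case (Suc n)
  have "(pinball lam ^^ Suc n) ` regular_set = pinball lam ` ((pinball lam ^^ n) ` regular_set)"
    by (simp add: image_image)
  then show ?case by (simp only: Suc pinball_image_regular_set)
qed simp

lemma Sing_iff_M_tilde:
  assumes "x \<in> M_tilde"
  shows "x \<in> Sing lam \<longleftrightarrow> \<not> never_hits x"
  using assms by (auto simp: Sing_def M_tilde_def never_hits_def)

lemma regular_set_eq: "regular_set = ({0..3} \<times> angle_set) - Sing lam"
proof (intro set_eqI iffI)
  fix x assume "x \<in> regular_set"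
  then obtain i u \<theta> where x: "x = pt i u \<theta>" "0 < u" "u < 1" "\<theta> \<in> angle_set" "\<theta> \<in> J" "never_hits x"
    by (elim regular_setE)
  then have M: "x \<in> M_tilde" by (simp add: pt_M_tilde)
  moreover have "fst x \<in> {0..3}" using M unfolding M_tilde_def by force
  then have "x \<in> {0..3} \<times> angle_set" using x(1,4) by (simp add: mem_Times_iff)
  ultimately show "x \<in> ({0..3} \<times> angle_set) - Sing lam" using x Sing_iff_M_tilde by blast
next
  fix x assume x: "x \<in> ({0..3} \<times> angle_set) - Sing lam"
  then obtain s \<theta> where s: "x = (s, \<theta>)" "s \<in> {0..3}" "\<theta> \<in> angle_set" "x \<notin> Sing lam" by auto
  then have s': "s \<in> {0<..<1} \<union> {1<..<2} \<union> {2<..<3}" by (auto simp: Sing_def)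
  note p = M_tilde_eq_pt[OF s']
  have "\<theta> \<in> J" using s angle_set_J by auto
  then have "x \<in> M_tilde" using pt_M_tilde p s(1) by metis
  then have "never_hits x" using s(4) Sing_iff_M_tilde by blast
  then show "x \<in> regular_set"
    unfolding regular_set_def mem_Collect_eq using p s(1,3) by (intro conjI exI[of _ "\<lfloor>s\<rfloor>"] exI[of _ "frac s"] exI[of _ \<theta>]) auto
qed

text \<open>
  Every point of \<open>regular_set\<close> has an infinite past, because each side at each angle is
  covered by the image of another side, as \<open>unbounce\<close> shows. Conversely, the angle of a point with a long past lies deep
  in the nested sets that define the Cantor set of angles.
\<close>

lemma attractor_eq: "attractor lam = regular_set"
proof
  have sub: "regular_set \<subseteq> phase_space lam"
  proof
    fix x assume "x \<in> regular_set"
    then obtain i u \<theta> where x: "x = pt i u \<theta>" "0 < u" "u < 1" "\<theta> \<in> J" "never_hits x"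
      by (elim regular_setE)
    then show "x \<in> phase_space lam"
      using pt_M_tilde[of u \<theta> i] Sing_iff_M_tilde by (auto simp: phase_space_def)
  qed
  show "regular_set \<subseteq> attractor lam"
    unfolding attractor_def
  proof (rule INT_greatest)
    fix n
    show "regular_set \<subseteq> (pinball lam ^^ n) ` phase_space lam"
      using image_mono[OF sub, of "pinball lam ^^ n"] by (simp add: pinball_funpow_image_regular_set)
  qed
  show "attractor lam \<subseteq> regular_set"
  proof
    fix x assume x: "x \<in> attractor lam"
    then have "x \<in> (pinball lam ^^ 0) ` phase_space lam"
      unfolding attractor_def by (rule INT_D) simp
    then have x0: "x \<in> phase_space lam" by simp
    have "snd x \<in> (turns ^^ n) J" for n
    proof -
      from x have "x \<in> (pinball lam ^^ Suc n) ` phase_space lam"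
        unfolding attractor_def by (rule INT_D) simp
      then obtain q where q: "q \<in> phase_space lam" "x = (pinball lam ^^ Suc n) q" ..
      then have "never_hits q" "snd q \<in> {- pi/2<..<pi/2}"
        using Sing_iff_M_tilde by (auto simp: phase_space_def M_tilde_def)
      then show ?thesis unfolding q(2) by (rule attractor_angle)
    qed
    then have "snd x \<in> angle_set" by (auto simp: angle_set_def)
    then show "x \<in> regular_set"
      using x0 by (cases x) (auto simp: regular_set_eq phase_space_def M_tilde_def)
  qed
qed

end

section \<open>The transfer operator on angles\<close>

context contracting_pinball
begin

text \<open>
  The Markov operator of the pair of side and angle for a particle whose position on its side is
  uniformly distributed before every bounce.
\<close>

definition transfer :: "(int \<Rightarrow> real \<Rightarrow> real) \<Rightarrow> int \<Rightarrow> real \<Rightarrow> real" where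
  "transfer h i \<theta> = pR \<theta> * h (i + 1) (angR \<theta>) + pL \<theta> * h (i - 1) (angL \<theta>)"

definition values_in :: "real \<Rightarrow> real \<Rightarrow> (int \<Rightarrow> real \<Rightarrow> real) \<Rightarrow> bool" where
  "values_in a b h \<longleftrightarrow> (\<forall>i. \<forall>\<theta>\<in>J. a \<le> h i \<theta> \<and> h i \<theta> \<le> b)"

lemma values_inD:
  "values_in a b h \<Longrightarrow> \<theta> \<in> J \<Longrightarrow> a \<le> h i \<theta>" "values_in a b h \<Longrightarrow> \<theta> \<in> J \<Longrightarrow> h i \<theta> \<le> b"
  by (simp_all add: values_in_def)

definition Lipschitz_J :: "real \<Rightarrow> (int \<Rightarrow> real \<Rightarrow> real) \<Rightarrow> bool" where
  "Lipschitz_J L h \<longleftrightarrow> (\<forall>i. \<forall>x\<in>J. \<forall>y\<in>J. \<bar>h i x - h i y\<bar> \<le> L * \<bar>x - y\<bar>)"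

definition side_periodic :: "(int \<Rightarrow> real \<Rightarrow> real) \<Rightarrow> bool" where
  "side_periodic h \<longleftrightarrow> (\<forall>i j. i mod 3 = j mod 3 \<longrightarrow> h i = h j)"

lemma convex_combination_bounds:
  assumes "a \<le> x" "x \<le> b" "a \<le> y" "y \<le> b"
  shows "a \<le> pR \<theta> * x + pL \<theta> * y" "pR \<theta> * x + pL \<theta> * y \<le> b"
proof -
  have "pR \<theta> * a + pL \<theta> * a \<le> pR \<theta> * x + pL \<theta> * y" "pR \<theta> * x + pL \<theta> * y \<le> pR \<theta> * b + pL \<theta> * b"
    using assms pR_pos[of \<theta>] pL_pos[of \<theta>] by (intro add_mono mult_left_mono; simp)+
  then show "a \<le> pR \<theta> * x + pL \<theta> * y" "pR \<theta> * x + pL \<theta> * y \<le> b"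
    by (simp_all add: pL_def algebra_simps)
qed

lemma values_in_transfer:
  assumes "values_in a b h"
  shows "values_in a b (transfer h)"
  unfolding values_in_def
proof (intro allI ballI)
  fix i \<theta> assume "\<theta> \<in> J"
  with assms angR_J angL_J
  have "a \<le> h (i + 1) (angR \<theta>)" "h (i + 1) (angR \<theta>) \<le> b" "a \<le> h (i - 1) (angL \<theta>)" "h (i - 1) (angL \<theta>) \<le> b"
    unfolding values_in_def by blast+
  then show "a \<le> transfer h i \<theta> \<and> transfer h i \<theta> \<le> b"
    unfolding transfer_def using convex_combination_bounds by simp
qed

lemma values_in_transfer_funpow: "values_in a b h \<Longrightarrow> values_in a b ((transfer ^^ n) h)"
  by (induction n) (auto simp: values_in_transfer)

lemma side_periodic_transfer:
  assumes "side_periodic h"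
  shows "side_periodic (transfer h)"
  unfolding side_periodic_def
proof (intro allI impI ext)
  fix i j :: int and \<theta> assume ij: "i mod 3 = j mod 3"
  have "(i + 1) mod 3 = (j + 1) mod 3" "(i - 1) mod 3 = (j - 1) mod 3"
    using ij by (auto intro: mod_add_cong mod_diff_cong)
  then have "h (i + 1) = h (j + 1)" "h (i - 1) = h (j - 1)" using assms unfolding side_periodic_def by blast+
  then show "transfer h i \<theta> = transfer h j \<theta>" by (simp add: transfer_def)
qed

lemma side_periodic_transfer_funpow: "side_periodic h \<Longrightarrow> side_periodic ((transfer ^^ n) h)"
  by (induction n) (auto simp: side_periodic_transfer)

text \<open>
  The contraction of the turns by \<open>lam < 1/3\<close> leaves room to absorb the Lipschitz constant of the
  bounce probabilities, which enters multiplied by the oscillation only.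
\<close>

lemma Lipschitz_transfer:
  assumes h: "Lipschitz_J L h" "values_in a b h" and L: "3 * (b - a) \<le> L"
  shows "Lipschitz_J L (transfer h)"
  unfolding Lipschitz_J_def
proof (intro allI ballI)
  fix i x y assume xy: "x \<in> J" "y \<in> J"
  have ab: "a \<le> b" using h(2) zero_in_J unfolding values_in_def by force
  define d where "d = \<bar>x - y\<bar>"
  have d: "0 \<le> d" by (simp add: d_def)
  let ?R = "h (i + 1)" and ?L = "h (i - 1)"
  have LR: "\<bar>?R (angR x) - ?R (angR y)\<bar> \<le> L * (lam * d)"
    using h(1) xy angR_J unfolding Lipschitz_J_def d_def by (metis angR_dist)
  have LL: "\<bar>?L (angL x) - ?L (angL y)\<bar> \<le> L * (lam * d)"
    using h(1) xy angL_J unfolding Lipschitz_J_def d_def by (metis angL_dist)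
  have osc: "\<bar>?R (angR y) - ?L (angL y)\<bar> \<le> b - a"
  proof -
    have "a \<le> ?R (angR y)" "?R (angR y) \<le> b" "a \<le> ?L (angL y)" "?L (angL y) \<le> b"
      using h(2) angR_J[OF xy(2)] angL_J[OF xy(2)] unfolding values_in_def by blast+
    then show ?thesis by linarith
  qed
  have "transfer h i x - transfer h i y = (pR x * (?R (angR x) - ?R (angR y))
      + pL x * (?L (angL x) - ?L (angL y))) + (pR x - pR y) * (?R (angR y) - ?L (angL y))"
    by (simp add: transfer_def pL_def algebra_simps)
  also have "\<bar>\<dots>\<bar> \<le> L * (lam * d) + (2 * d) * (b - a)"
  proof (rule order_trans[OF abs_triangle_ineq add_mono])
    show "\<bar>pR x * (?R (angR x) - ?R (angR y)) + pL x * (?L (angL x) - ?L (angL y))\<bar> \<le> L * (lam * d)"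
    proof (rule abs_leI)
      have *: "- (L * (lam * d)) \<le> ?R (angR x) - ?R (angR y)" "?R (angR x) - ?R (angR y) \<le> L * (lam * d)"
        "- (L * (lam * d)) \<le> ?L (angL x) - ?L (angL y)" "?L (angL x) - ?L (angL y) \<le> L * (lam * d)"
        using LR LL by linarith+
      note cb = convex_combination_bounds[OF *, of x]
      show "pR x * (?R (angR x) - ?R (angR y)) + pL x * (?L (angL x) - ?L (angL y)) \<le> L * (lam * d)"
        by (rule cb(2))
      show "- (pR x * (?R (angR x) - ?R (angR y)) + pL x * (?L (angL x) - ?L (angL y))) \<le> L * (lam * d)"
        using cb(1) by (simp only: minus_le_iff)
    qed
    show "\<bar>(pR x - pR y) * (?R (angR y) - ?L (angL y))\<bar> \<le> 2 * d * (b - a)"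
      unfolding abs_mult d_def using osc pR_Lipschitz[OF xy] by (intro mult_mono) auto
  qed
  also have "\<dots> = (L * lam + 2 * (b - a)) * d" by (simp add: algebra_simps)
  also have "\<dots> \<le> L * d"
  proof (rule mult_right_mono)
    have "L * lam \<le> L * (1/3)" using L ab lam_less by (intro mult_left_mono) auto
    then show "L * lam + 2 * (b - a) \<le> L" using L by linarith
  qed (rule d)
  finally show "\<bar>transfer h i x - transfer h i y\<bar> \<le> L * \<bar>x - y\<bar>" by (simp add: d_def)
qed

lemma Lipschitz_transfer_funpow:
  assumes "Lipschitz_J L h" "values_in a b h" "3 * (b - a) \<le> L"
  shows "Lipschitz_J L ((transfer ^^ n) h)"
proof (induction n)
  case (Suc n)
  show ?case
    using Lipschitz_transfer[OF Suc values_in_transfer_funpow[OF assms(2)] assms(3)] by simp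
qed (simp add: assms)

lemma transfer_le_right:
  assumes "values_in a b h" "\<theta> \<in> J" "0 \<le> d" "h (i + 1) (angR \<theta>) \<le> b - d"
  shows "transfer h i \<theta> \<le> b - pmin * d"
proof -
  have "h (i - 1) (angL \<theta>) \<le> b" using assms angL_J unfolding values_in_def by blast
  then have "transfer h i \<theta> \<le> pR \<theta> * (b - d) + pL \<theta> * b"
    unfolding transfer_def using assms pR_pos[of \<theta>] pL_pos[of \<theta>] by (intro add_mono mult_left_mono) auto
  also have "\<dots> = b - pR \<theta> * d" by (simp add: pL_def algebra_simps)
  also have "\<dots> \<le> b - pmin * d" using assms(3) pR_bounds[of \<theta>] by (simp add: mult_right_mono)
  finally show ?thesis .
qed

lemma transfer_le_left:
  assumes "values_in a b h" "\<theta> \<in> J" "0 \<le> d" "h (i - 1) (angL \<theta>) \<le> b - d"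
  shows "transfer h i \<theta> \<le> b - pmin * d"
proof -
  have "h (i + 1) (angR \<theta>) \<le> b" using assms angR_J unfolding values_in_def by blast
  then have "transfer h i \<theta> \<le> pR \<theta> * b + pL \<theta> * (b - d)"
    unfolding transfer_def using assms pR_pos[of \<theta>] pL_pos[of \<theta>] by (intro add_mono mult_left_mono) auto
  also have "\<dots> = b - pL \<theta> * d" by (simp add: pL_def algebra_simps)
  also have "\<dots> \<le> b - pmin * d" using assms(3) pL_bounds[of \<theta>] by (simp add: mult_right_mono)
  finally show ?thesis .
qed

text \<open>
  A deficit \<open>d\<close> below the upper bound at the end of a path of \<open>m\<close> right bounces survives at its start,
  reduced by the probability of the path.
\<close>

lemma transfer_funpow_le_right:
  "values_in a b h \<Longrightarrow> \<theta> \<in> J \<Longrightarrow> 0 \<le> d \<Longrightarrow> h (i + int m) ((angR ^^ m) \<theta>) \<le> b - d \<Longrightarrow>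
   (transfer ^^ m) h i \<theta> \<le> b - pmin ^ m * d"
proof (induction m arbitrary: i \<theta>)
  case (Suc m)
  have "(transfer ^^ m) h (i + 1) (angR \<theta>) \<le> b - pmin ^ m * d"
    using Suc.prems by (intro Suc.IH angR_J) (auto simp: funpow_swap1 add_ac)
  then have "transfer ((transfer ^^ m) h) i \<theta> \<le> b - pmin * (pmin ^ m * d)"
    using Suc.prems pmin_pos by (intro transfer_le_right values_in_transfer_funpow) auto
  then show ?case by (simp add: mult.assoc)
qed simp

text \<open>
  Two bounces change the side by \<open>2\<close>, \<open>0\<close> or \<open>- 2\<close>, so some pair of bounces leads to the side \<open>k\<close>.
\<close>

lemma transfer_two_step_le:
  assumes "values_in a b h" "side_periodic h" "0 \<le> d" "\<theta> \<in> J"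
    and k: "\<And>\<theta>. \<theta> \<in> J \<Longrightarrow> h k \<theta> \<le> b - d"
  shows "transfer (transfer h) i \<theta> \<le> b - pmin * (pmin * d)"
proof -
  have k': "h j \<theta> \<le> b - d" if "j mod 3 = k mod 3" "\<theta> \<in> J" for j \<theta>
    
  proof -
    have "h j = h k" using assms(2) that(1) unfolding side_periodic_def by blast
    then show ?thesis using k[OF that(2)] by simp
  qed
  have w: "values_in a b (transfer h)" using assms(1) by (rule values_in_transfer)
  have d: "0 \<le> pmin * d" using assms(3) pmin_pos by simp
  obtain q where q: "(k - i) mod 3 = q" "q = 0 \<or> q = 1 \<or> q = 2" using mod_3_cases by blast
  have "(i + (k - i) mod 3) mod 3 = k mod 3" by (simp add: mod_add_right_eq)
  then have iq: "(i + q) mod 3 = k mod 3" unfolding q(1) .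
  note R = angR_J[OF assms(4)] and L = angL_J[OF assms(4)]
  from q(2) consider "q = 0" | "q = 1" | "q = 2" by blast
  then show ?thesis
  proof cases
    case 1
    have "transfer h (i + 1) (angR \<theta>) \<le> b - pmin * d"
      using iq 1 by (intro transfer_le_left[OF assms(1) R assms(3)] k' angL_J R) simp
    then show ?thesis by (rule transfer_le_right[OF w assms(4) d])
  next
    case 2
    have "(i - 1 - 1) mod 3 = (i + 1 - 3) mod 3" by simp
    also have "\<dots> = k mod 3" using iq 2 by (simp only: minus_mod_self2)
    finally have "transfer h (i - 1) (angL \<theta>) \<le> b - pmin * d"
      by (intro transfer_le_left[OF assms(1) L assms(3)] k' angL_J L)
    then show ?thesis by (rule transfer_le_left[OF w assms(4) d])
  next
    case 3
    have "transfer h (i + 1) (angR \<theta>) \<le> b - pmin * d"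
      using iq 3 by (intro transfer_le_right[OF assms(1) R assms(3)] k' angR_J R) (simp add: add.assoc)
    then show ?thesis by (rule transfer_le_right[OF w assms(4) d])
  qed
qed

lemma angR_funpow_J: "\<theta> \<in> J \<Longrightarrow> (angR ^^ m) \<theta> \<in> J"
  by (induction m) (auto simp: angR_J)

lemma angR_funpow_dist: "\<bar>(angR ^^ m) \<theta> - angR_fixed\<bar> = lam ^ m * \<bar>\<theta> - angR_fixed\<bar>"
proof (induction m)
  case (Suc m)
  have "\<bar>angR ((angR ^^ m) \<theta>) - angR angR_fixed\<bar> = lam * \<bar>(angR ^^ m) \<theta> - angR_fixed\<bar>"
    by (rule angR_dist)
  then show ?case using Suc by (simp add: angR_fixed)
qed simp

text \<open>
  Two bounces lead to a side from which \<open>m\<close> right bounces end on side \<open>0\<close>, with an angle close to the fixed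
  point of \<open>angR\<close>. Hence every value of the iterate contains a fixed proportion of one and the same value
  of \<open>h\<close>, up to the error \<open>e\<close>.
\<close>

lemma transfer_upper_contraction:
  fixes m :: nat
  assumes h: "values_in a b h" "Lipschitz_J L h" "side_periodic h" and "0 \<le> L" "\<theta> \<in> J"
  defines "e \<equiv> L * (lam ^ m * pi)" and "c \<equiv> pmin ^ (m + 2)"
  shows "(transfer ^^ (m + 2)) h i \<theta> \<le> (1 - c) * b + c * (h 0 angR_fixed + e)"
proof (cases "h 0 angR_fixed + e \<le> b")
  case True
  define d where "d = b - h 0 angR_fixed - e"
  have d: "0 \<le> d" using True by (simp add: d_def)
  have near: "h 0 ((angR ^^ m) \<theta>) \<le> b - d" if "\<theta> \<in> J" for \<theta>
  proof -
    have "\<bar>h 0 ((angR ^^ m) \<theta>) - h 0 angR_fixed\<bar> \<le> L * \<bar>(angR ^^ m) \<theta> - angR_fixed\<bar>"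
      using h(2) angR_funpow_J[OF that] angR_fixed_J unfolding Lipschitz_J_def by blast
    also have "\<dots> \<le> e"
      unfolding e_def angR_funpow_dist using that J_dist angR_fixed_J \<open>0 \<le> L\<close> lam_pos
      by (intro mult_left_mono) auto
    finally show ?thesis by (simp add: d_def)
  qed
  have "(transfer ^^ m) h (- int m) \<theta> \<le> b - pmin ^ m * d" if "\<theta> \<in> J" for \<theta>
    using that near by (intro transfer_funpow_le_right[OF h(1) _ d]) auto
  then have "transfer (transfer ((transfer ^^ m) h)) i \<theta> \<le> b - pmin * (pmin * (pmin ^ m * d))"
    using h d pmin_pos \<open>\<theta> \<in> J\<close>
    by (intro transfer_two_step_le values_in_transfer_funpow side_periodic_transfer_funpow) auto
  also have "\<dots> = (1 - c) * b + c * (h 0 angR_fixed + e)"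
    by (simp add: c_def d_def algebra_simps)
  finally show ?thesis by simp
next
  case False
  have c: "0 \<le> c" using pmin_pos by (simp add: c_def)
  have "(transfer ^^ (m + 2)) h i \<theta> \<le> b"
    using values_in_transfer_funpow[OF h(1)] \<open>\<theta> \<in> J\<close> unfolding values_in_def by blast
  also have "b = (1 - c) * b + c * b" by (simp add: algebra_simps)
  also have "\<dots> \<le> (1 - c) * b + c * (h 0 angR_fixed + e)"
    using False c by (intro add_left_mono mult_left_mono) auto
  finally show ?thesis .
qed

lemma transfer_uminus: "(transfer ^^ n) (\<lambda>i \<theta>. - h i \<theta>) = (\<lambda>i \<theta>. - (transfer ^^ n) h i \<theta>)"
  by (induction n) (auto simp: transfer_def fun_eq_iff)

lemma transfer_contraction:
  fixes m :: nat
  assumes h: "values_in a b h" "Lipschitz_J L h" "side_periodic h" and "0 \<le> L"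
  defines "e \<equiv> L * (lam ^ m * pi)" and "c \<equiv> pmin ^ (m + 2)"
  shows "values_in ((1 - c) * a + c * (h 0 angR_fixed - e)) ((1 - c) * b + c * (h 0 angR_fixed + e))
    ((transfer ^^ (m + 2)) h)"
  unfolding values_in_def
proof (intro allI ballI conjI)
  fix i \<theta> assume \<theta>: "\<theta> \<in> J"
  show "(transfer ^^ (m + 2)) h i \<theta> \<le> (1 - c) * b + c * (h 0 angR_fixed + e)"
    unfolding c_def e_def by (rule transfer_upper_contraction) (use assms \<theta> in auto)
  have "values_in (- b) (- a) (\<lambda>i \<theta>. - h i \<theta>)" "Lipschitz_J L (\<lambda>i \<theta>. - h i \<theta>)" "side_periodic (\<lambda>i \<theta>. - h i \<theta>)"
    subgoal using h(1) by (simp add: values_in_def)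
    subgoal using h(2) by (simp add: Lipschitz_J_def abs_minus_commute)
    subgoal using h(3) unfolding side_periodic_def by (intro allI impI arg_cong[of "h _" "h _" "\<lambda>f \<theta>. - f \<theta>"]) blast
    done
  from transfer_upper_contraction[OF this \<open>0 \<le> L\<close> \<theta>, of m i]
  have "- (transfer ^^ (m + 2)) h i \<theta> \<le> (1 - c) * (- a) + c * (- h 0 angR_fixed + e)"
    unfolding c_def e_def transfer_uminus .
  then show "(1 - c) * a + c * (h 0 angR_fixed - e) \<le> (transfer ^^ (m + 2)) h i \<theta>"
    by (simp add: algebra_simps)
qed

text \<open>
  Iterating the contraction, the oscillation becomes arbitrarily small, because the error term can be
  chosen small beforehand: the Lipschitz constant is the same for all iterates.
\<close>

theorem transfer_convergence:
  assumes h: "values_in a b h" "Lipschitz_J L h" "side_periodic h" and eps: "0 < \<epsilon>"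
  shows "\<exists>N z. \<forall>n\<ge>N. values_in (z - \<epsilon>) (z + \<epsilon>) ((transfer ^^ n) h)"
proof -
  define L' where "L' = max L (3 * (b - a))"
  have ab: "a \<le> b" using h(1) zero_in_J unfolding values_in_def by force
  have L': "0 \<le> L'" "3 * (b - a) \<le> L'" using ab by (auto simp: L'_def)
  have "L * \<bar>x - y\<bar> \<le> L' * \<bar>x - y\<bar>" for x y by (intro mult_right_mono) (auto simp: L'_def)
  then have lip: "Lipschitz_J L' h"
    using h(2) order_trans unfolding Lipschitz_J_def by (metis (no_types, lifting))
  obtain m where m: "lam ^ m * (2 * L' * pi) < \<epsilon>" using ex_lam_power_less[OF eps] by blast
  define e where "e = L' * (lam ^ m * pi)"
  have e: "2 * e < \<epsilon>" using m by (simp add: e_def algebra_simps)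
  define c where "c = pmin ^ (m + 2)"
  have c: "0 < c" "c < 1"
    using pmin_pos pmin_less_1 power_Suc_less_one[of pmin "m + 1"] by (simp_all add: c_def)
  have step: "\<exists>a' b'. values_in a' b' ((transfer ^^ (k * (m + 2))) h) \<and> b' - a' \<le> (1 - c) ^ k * (b - a) + 2 * e" for k
  proof (induction k)
    case 0
    have "0 \<le> e" using L' lam_pos by (simp add: e_def)
    then show ?case using h(1) by (intro exI[of _ a] exI[of _ b]) simp
  next
    case (Suc k)
    then obtain a' b' where ab': "values_in a' b' ((transfer ^^ (k * (m + 2))) h)"
      "b' - a' \<le> (1 - c) ^ k * (b - a) + 2 * e" by blast
    let ?h = "(transfer ^^ (k * (m + 2))) h"
    let ?v = "?h 0 angR_fixed"
    have "values_in ((1 - c) * a' + c * (?v - e)) ((1 - c) * b' + c * (?v + e)) ((transfer ^^ (m + 2)) ?h)"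
      unfolding c_def e_def
      by (rule transfer_contraction[OF ab'(1) Lipschitz_transfer_funpow[OF lip h(1) L'(2)]
            side_periodic_transfer_funpow[OF h(3)] L'(1)])
    moreover have "(transfer ^^ (m + 2)) ?h = (transfer ^^ (Suc k * (m + 2))) h"
      by (simp only: mult_Suc funpow_add o_apply)
    moreover have "((1 - c) * b' + c * (?v + e)) - ((1 - c) * a' + c * (?v - e)) = (1 - c) * (b' - a') + 2 * c * e"
      by (simp add: algebra_simps)
    moreover have "(1 - c) * (b' - a') \<le> (1 - c) * ((1 - c) ^ k * (b - a) + 2 * e)"
      using ab'(2) c by (intro mult_left_mono) auto
    moreover have "\<dots> + 2 * c * e = (1 - c) ^ Suc k * (b - a) + 2 * e"
      by (simp add: algebra_simps)
    ultimately show ?case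
      by (intro exI[of _ "(1 - c) * a' + c * (?v - e)"] exI[of _ "(1 - c) * b' + c * (?v + e)"]) simp
  qed
  have "(\<lambda>k. (1 - c) ^ k * (b - a)) \<longlonglongrightarrow> 0"
    using c by (intro tendsto_mult_left_zero LIMSEQ_realpow_zero) auto
  then have "eventually (\<lambda>k. (1 - c) ^ k * (b - a) < \<epsilon>) sequentially"
    using eps by (rule order_tendstoD(2))
  then obtain k where k: "(1 - c) ^ k * (b - a) < \<epsilon>" by (auto simp: eventually_sequentially)
  obtain a' b' where ab': "values_in a' b' ((transfer ^^ (k * (m + 2))) h)"
    "b' - a' \<le> (1 - c) ^ k * (b - a) + 2 * e" using step by blast
  define z where "z = (a' + b') / 2"
  have z: "z - \<epsilon> \<le> a'" "b' \<le> z + \<epsilon>" using ab'(2) k e by (simp_all add: z_def field_simps)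
  have "values_in (z - \<epsilon>) (z + \<epsilon>) ((transfer ^^ n) h)" if "k * (m + 2) \<le> n" for n
  proof -
    have "(transfer ^^ n) h = (transfer ^^ (n - k * (m + 2))) ((transfer ^^ (k * (m + 2))) h)"
      using funpow_add[of "n - k * (m + 2)" "k * (m + 2)" transfer] that by simp
    then have "values_in a' b' ((transfer ^^ n) h)" using values_in_transfer_funpow[OF ab'(1)] by simp
    then show ?thesis using z unfolding values_in_def by (auto intro: order_trans)
  qed
  then show ?thesis by blast
qed

end

section \<open>Averaging along the sides\<close>

definition unit_uniform :: "real measure" where
  "unit_uniform = uniform_measure lborel {0<..<1}"

lemma prob_space_unit_uniform: "prob_space unit_uniform"
  unfolding unit_uniform_def by (rule prob_space_uniform_measure) auto

lemma sets_unit_uniform [measurable_cong, simp]: "sets unit_uniform = sets borel"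
  by (simp add: unit_uniform_def)

lemma space_unit_uniform [simp]: "space unit_uniform = UNIV"
  by (simp add: unit_uniform_def)

interpretation unit_uniform: prob_space unit_uniform
  by (rule prob_space_unit_uniform)

lemma AE_unit_uniform: "AE u in unit_uniform. 0 < u \<and> u < 1"
  unfolding unit_uniform_def by (rule AE_uniform_measureI) auto

lemma integrable_bounded_borel:
  fixes f :: "_ \<Rightarrow> real"
  assumes "finite_measure M" "f \<in> borel_measurable M" "\<And>x. \<bar>f x\<bar> \<le> B"
  shows "integrable M f"
  using assms by (intro finite_measure.integrable_const_bound[of M f B]) auto

lemma integral_bounded_between:
  fixes f :: "_ \<Rightarrow> real"
  assumes "prob_space M" "f \<in> borel_measurable M" "\<And>x. \<bar>f x\<bar> \<le> B"
    and "AE x in M. a \<le> f x" "AE x in M. f x \<le> b"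
  shows "a \<le> integral\<^sup>L M f" "integral\<^sup>L M f \<le> b"
proof -
  interpret prob_space M by fact
  have i: "integrable M f" using integrable_bounded_borel[OF finite_measure_axioms assms(2,3)] .
  show "a \<le> integral\<^sup>L M f" using integral_ge_const[OF i assms(4)] .
  show "integral\<^sup>L M f \<le> b" using integral_le_const[OF i assms(5)] .
qed

lemma integral_unit_uniform:
  fixes f :: "real \<Rightarrow> real"
  assumes [measurable]: "f \<in> borel_measurable borel"
  shows "(\<integral>u. f u \<partial>unit_uniform) = (\<integral>u. indicator {0<..<1} u * f u \<partial>lborel)"
proof -
  have eq: "unit_uniform = density lborel (\<lambda>u. ennreal (indicator {0<..<1} u))"
    unfolding unit_uniform_def uniform_measure_def by (auto intro!: density_cong simp: indicator_def)
  show ?thesis unfolding eq by (subst integral_density) auto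
qed

text \<open>
  A two-branch piecewise affine map whose branches are onto preserves Lebesgue measure on the unit
  interval; here different functions are integrated over the images of the two branches.
\<close>

lemma integral_two_branches:
  fixes f A B :: "real \<Rightarrow> real"
  assumes [measurable]: "f \<in> borel_measurable borel" "A \<in> borel_measurable borel" "B \<in> borel_measurable borel"
    and bound: "\<And>x. \<bar>f x\<bar> \<le> K"
    and p: "0 < p" "p < 1"
    and left: "\<And>u. 0 < u \<Longrightarrow> u < p \<Longrightarrow> f u = A (1 - u / p)"
    and right: "\<And>u. p < u \<Longrightarrow> u < 1 \<Longrightarrow> f u = B ((1 - u) / (1 - p))"
  shows "(\<integral>u. f u \<partial>unit_uniform) = (1 - p) * (\<integral>u. B u \<partial>unit_uniform) + p * (\<integral>u. A u \<partial>unit_uniform)"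
proof -
  have int: "integrable lborel (\<lambda>u. indicator {a<..<b} u * f u)" for a b
    using integrableI_bounded_set_indicator[of "{a<..<b}" lborel f K] bound
    by (cases "a \<le> b") auto
  have "(\<integral>u. f u \<partial>unit_uniform) = (\<integral>u. indicator {0<..<1} u * f u \<partial>lborel)"
    by (rule integral_unit_uniform) measurable
  also have "\<dots> = (\<integral>u. indicator {0<..<p} u * f u + indicator {p<..<1} u * f u \<partial>lborel)"
  proof (rule integral_cong_AE)
    show "AE u in lborel. indicator {0<..<1} u * f u = indicator {0<..<p} u * f u + indicator {p<..<1} u * f u"
      by (rule eventually_mono[OF AE_lborel_singleton[of p]]) (use p in \<open>auto simp: indicator_def\<close>)
  qed measurable
  also have "\<dots> = (\<integral>u. indicator {0<..<p} u * f u \<partial>lborel) + (\<integral>u. indicator {p<..<1} u * f u \<partial>lborel)"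
    by (intro Bochner_Integration.integral_add int)
  also have "(\<integral>u. indicator {0<..<p} u * f u \<partial>lborel)
      = p * (\<integral>u. indicator {0<..<p} (p + (- p) * u) * f (p + (- p) * u) \<partial>lborel)"
    using p by (subst lborel_integral_real_affine[where c = "- p" and t = p]) auto
  also have "(\<lambda>u. indicator {0<..<p} (p + (- p) * u) * f (p + (- p) * u)) = (\<lambda>u. indicator {0<..<1} u * A u)"
  proof
    fix u
    show "indicator {0<..<p} (p + (- p) * u) * f (p + (- p) * u) = indicator {0<..<1} u * A u"
    proof (cases "0 < u \<and> u < 1")
      case True
      then have "0 < p - p * u" "p - p * u < p" using p by auto
      moreover have "1 - (p - p * u) / p = u" using p by (simp add: field_simps)
      ultimately show ?thesis using True left[of "p - p * u"] by simp
    next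
      case False
      then have "\<not> (0 < p - p * u \<and> p - p * u < p)" using p by (auto simp: zero_less_mult_iff)
      then show ?thesis using False by (auto simp: indicator_def)
    qed
  qed
  also have "(\<integral>u. indicator {p<..<1} u * f u \<partial>lborel)
      = (1 - p) * (\<integral>u. indicator {p<..<1} (1 + (- (1 - p)) * u) * f (1 + (- (1 - p)) * u) \<partial>lborel)"
    using p by (subst lborel_integral_real_affine[where c = "- (1 - p)" and t = 1]) auto
  also have "(\<lambda>u. indicator {p<..<1} (1 + (- (1 - p)) * u) * f (1 + (- (1 - p)) * u)) = (\<lambda>u. indicator {0<..<1} u * B u)"
  proof
    fix u
    have *: "p < 1 - (1 - p) * u \<longleftrightarrow> u < 1"
    proof -
      have "p < 1 - (1 - p) * u \<longleftrightarrow> (1 - p) * u < (1 - p) * 1" by (simp add: algebra_simps)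
      then show ?thesis using p by simp
    qed
    have eq: "1 + (- (1 - p)) * u = 1 - (1 - p) * u" by (simp add: algebra_simps)
    have **: "1 - (1 - p) * u < 1 \<longleftrightarrow> 0 < u" using p by (simp add: zero_less_mult_iff)
    show "indicator {p<..<1} (1 + (- (1 - p)) * u) * f (1 + (- (1 - p)) * u) = indicator {0<..<1} u * B u"
    proof (cases "0 < u \<and> u < 1")
      case True
      moreover have "(1 - (1 - (1 - p) * u)) / (1 - p) = u" using p by simp
      ultimately show ?thesis using * ** right[of "1 - (1 - p) * u"] unfolding eq by simp
    next
      case False
      then show ?thesis using * ** unfolding eq by (auto simp: indicator_def)
    qed
  qed
  finally show ?thesis by (simp add: integral_unit_uniform)
qed

lemma borel_measurable_frac [measurable]: "frac \<in> borel_measurable (borel :: real measure)"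
  unfolding frac_def by measurable

lemma borel_measurable_vertex_angle [measurable]: "vertex_angle \<in> borel_measurable borel"
  unfolding vertex_angle_def by measurable

lemma borel_measurable_rmod [measurable]: "(\<lambda>x. x rmod y) \<in> borel_measurable borel"
  unfolding rmod_def by measurable

lemma borel_measurable_pinball [measurable]: "pinball lam \<in> borel_measurable borel"
proof -
  have [measurable]: "fst \<in> borel_measurable (borel :: (real \<times> real) measure)"
    "snd \<in> borel_measurable (borel :: (real \<times> real) measure)"
    by (intro borel_measurable_continuous_onI continuous_intros)+
  define right where "right = (\<lambda>x. ((of_int \<lfloor>fst x\<rfloor> + 1 + (1 - frac (fst x)) * (cos (snd x) / cos (pi/3 - snd x))) rmod 3, lam * (pi/3 - snd x)))"
  define left where "left = (\<lambda>x. ((of_int \<lfloor>fst x\<rfloor> - frac (fst x) * (cos (snd x) / cos (pi/3 + snd x))) rmod 3, lam * (- pi/3 - snd x)))"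
  have [measurable]: "right \<in> borel_measurable borel" "left \<in> borel_measurable borel"
    unfolding right_def left_def by (intro borel_measurable_Pair; measurable)+
  have "pinball lam = (\<lambda>x. if vertex_angle (fst x) < snd x then right x
     else if snd x < vertex_angle (fst x) then left x else undefined)"
    by (rule ext) (simp only: pinball_def Let_def case_prod_beta right_def left_def)
  also have "\<dots> \<in> borel_measurable borel"
    by measurable
  finally show ?thesis .
qed

lemma borel_measurable_pinball_funpow [measurable]: "(pinball lam ^^ n) \<in> borel_measurable borel"
  by (induction n) (auto intro: measurable_comp borel_measurable_pinball simp: id_def)

context contracting_pinball
begin

lemma pt_eq: "pt i u \<theta> = (fst (pt i 0 0) + u, \<theta>)"
  by (simp add: pt_def)

lemma borel_measurable_pt [measurable]:
  assumes [measurable]: "f \<in> borel_measurable M" "g \<in> borel_measurable M"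
  shows "(\<lambda>x. pt i (f x) (g x)) \<in> borel_measurable M"
proof -
  have "(\<lambda>x. (fst (pt i 0 0) + f x, g x)) \<in> measurable M (borel \<Otimes>\<^sub>M borel)" by measurable
  then show ?thesis by (simp add: borel_prod flip: pt_eq)
qed

definition side_avg :: "(real \<times> real \<Rightarrow> real) \<Rightarrow> int \<Rightarrow> real \<Rightarrow> real" where
  "side_avg F i \<theta> = (\<integral>u. F (pt i u \<theta>) \<partial>unit_uniform)"

lemma side_periodic_side_avg: "side_periodic (side_avg F)"
  unfolding side_periodic_def side_avg_def using pt_cong by (metis (no_types, lifting) ext)

lemma integrable_side:
  fixes F :: "real \<times> real \<Rightarrow> real"
  assumes [measurable]: "F \<in> borel_measurable borel" and "\<And>x. \<bar>F x\<bar> \<le> B"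
  shows "integrable unit_uniform (\<lambda>u. F (pt i u \<theta>))"
  by (rule integrable_bounded_borel[of _ _ B]) (use assms in \<open>auto intro: unit_uniform.finite_measure_axioms\<close>)

lemma side_avg_bounds:
  assumes [measurable]: "F \<in> borel_measurable borel" and B: "\<And>x. \<bar>F x\<bar> \<le> B"
    and "\<And>u. 0 < u \<Longrightarrow> u < 1 \<Longrightarrow> a \<le> F (pt i u \<theta>) \<and> F (pt i u \<theta>) \<le> b"
  shows "a \<le> side_avg F i \<theta>" "side_avg F i \<theta> \<le> b"
proof -
  have "AE u in unit_uniform. a \<le> F (pt i u \<theta>)" "AE u in unit_uniform. F (pt i u \<theta>) \<le> b"
    using AE_unit_uniform assms(3) by (auto elim: eventually_mono)
  then show "a \<le> side_avg F i \<theta>" "side_avg F i \<theta> \<le> b"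
    unfolding side_avg_def using B
    by (intro integral_bounded_between[of _ _ B]; simp add: prob_space_unit_uniform)+
qed

lemma side_avg_diff_le:
  assumes [measurable]: "F \<in> borel_measurable borel" "G \<in> borel_measurable borel"
    and F: "\<And>x. \<bar>F x\<bar> \<le> B" and G: "\<And>x. \<bar>G x\<bar> \<le> B'"
    and d: "\<And>u. \<bar>F (pt i u \<theta>) - G (pt j u \<theta>')\<bar> \<le> d"
  shows "\<bar>side_avg F i \<theta> - side_avg G j \<theta>'\<bar> \<le> d"
proof -
  have "side_avg F i \<theta> - side_avg G j \<theta>' = (\<integral>u. F (pt i u \<theta>) - G (pt j u \<theta>') \<partial>unit_uniform)"
    unfolding side_avg_def
    by (intro Bochner_Integration.integral_diff[symmetric] integrable_side[of _ B] integrable_side[of _ B'] F G; measurable)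
  also have "\<bar>\<dots>\<bar> \<le> d"
  proof -
    have "- d \<le> F (pt i u \<theta>) - G (pt j u \<theta>')" "F (pt i u \<theta>) - G (pt j u \<theta>') \<le> d" for u
      using d[of u] by linarith+
    then show ?thesis
      using integral_bounded_between[OF prob_space_unit_uniform, where B = d and a = "- d" and b = d
          and f = "\<lambda>u. F (pt i u \<theta>) - G (pt j u \<theta>')"] d
      by (simp add: abs_le_iff minus_le_iff)
  qed
  finally show ?thesis .
qed

text \<open>
  Averaging over the sides intertwines the billiard map with the transfer operator.
\<close>

lemma side_avg_pinball:
  assumes [measurable]: "F \<in> borel_measurable borel" and B: "\<And>x. \<bar>F x\<bar> \<le> B" and \<theta>: "\<theta> \<in> J"
  shows "side_avg (F \<circ> pinball lam) i \<theta> = transfer (side_avg F) i \<theta>"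
proof -
  have "(\<integral>u. F (pinball lam (pt i u \<theta>)) \<partial>unit_uniform)
    = (1 - pL \<theta>) * (\<integral>u. F (pt (i + 1) u (angR \<theta>)) \<partial>unit_uniform)
      + pL \<theta> * (\<integral>u. F (pt (i - 1) u (angL \<theta>)) \<partial>unit_uniform)"
  proof (rule integral_two_branches)
    show "\<bar>F (pinball lam (pt i u \<theta>))\<bar> \<le> B" for u by (rule B)
    fix u assume "0 < u" "u < pL \<theta>"
    then show "F (pinball lam (pt i u \<theta>)) = F (pt (i - 1) (1 - u / pL \<theta>) (angL \<theta>))"
      using pinball_left[OF \<theta>, of u i] pL_less_1[of \<theta>] by simp
  next
    fix u assume "pL \<theta> < u" "u < 1"
    then show "F (pinball lam (pt i u \<theta>)) = F (pt (i + 1) ((1 - u) / (1 - pL \<theta>)) (angR \<theta>))"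
      using pinball_right[OF \<theta>, of u i] pL_pos[of \<theta>] by (simp add: pL_def)
  qed (use pL_pos pL_less_1 in \<open>auto\<close>)
  then show ?thesis by (simp add: side_avg_def transfer_def pL_def)
qed

lemma transfer_cong:
  assumes "\<And>i \<theta>. \<theta> \<in> J \<Longrightarrow> h i \<theta> = h' i \<theta>" "\<theta> \<in> J"
  shows "transfer h i \<theta> = transfer h' i \<theta>"
  using assms angR_J angL_J by (simp add: transfer_def)

lemma side_avg_pinball_funpow:
  assumes "F \<in> borel_measurable borel" "\<And>x. \<bar>F x\<bar> \<le> B" "\<theta> \<in> J"
  shows "side_avg (F \<circ> (pinball lam ^^ n)) i \<theta> = (transfer ^^ n) (side_avg F) i \<theta>"
  using assms(3)
proof (induction n arbitrary: i \<theta>)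
  case (Suc n)
  have eq: "F \<circ> (pinball lam ^^ Suc n) = (F \<circ> (pinball lam ^^ n)) \<circ> pinball lam"
    by (simp add: fun_eq_iff funpow_swap1)
  have "side_avg ((F \<circ> (pinball lam ^^ n)) \<circ> pinball lam) i \<theta> = transfer (side_avg (F \<circ> (pinball lam ^^ n))) i \<theta>"
    using assms Suc.prems by (intro side_avg_pinball[of _ B] measurable_comp[OF borel_measurable_pinball_funpow]) auto
  also have "\<dots> = transfer ((transfer ^^ n) (side_avg F)) i \<theta>"
    by (rule transfer_cong[OF Suc.IH Suc.prems])
  finally show ?case unfolding eq unfolding funpow.simps(2) o_apply .
qed (simp add: comp_def)

lemma side_avg_snd: "side_avg (\<lambda>x. h (snd x)) = (\<lambda>i. h)"
  using unit_uniform.prob_space by (simp add: side_avg_def fun_eq_iff)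

end

section \<open>The stationary distribution of the angle\<close>

lemma borel_measurable_snd_plane [measurable]: "snd \<in> borel_measurable (borel :: (real \<times> real) measure)"
  and borel_measurable_fst_plane [measurable]: "fst \<in> borel_measurable (borel :: (real \<times> real) measure)"
  by (intro borel_measurable_continuous_onI continuous_intros)+

lemma real_distribution_eqI_trig:
  assumes M: "real_distribution M" and N: "real_distribution N"
    and cos: "\<And>t. (\<integral>x. cos (t * x) \<partial>M) = (\<integral>x. cos (t * x) \<partial>N)"
    and sin: "\<And>t. (\<integral>x. sin (t * x) \<partial>M) = (\<integral>x. sin (t * x) \<partial>N)"
  shows "M = N"
proof (rule Levy_uniqueness[OF M N])
  have char: "char D t = Complex (\<integral>x. cos (t * x) \<partial>D) (\<integral>x. sin (t * x) \<partial>D)"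
    if "real_distribution D" for D t
  proof -
    interpret D: real_distribution D by fact
    have i: "integrable D (\<lambda>x. iexp (t * x))" by (rule D.integrable_iexp) simp_all
    have "Re (char D t) = (\<integral>x. Re (iexp (t * x)) \<partial>D)" "Im (char D t) = (\<integral>x. Im (iexp (t * x)) \<partial>D)"
      unfolding char_def using i by simp_all
    then show ?thesis by (simp add: complex_eq_iff Re_exp Im_exp)
  qed
  show "char M = char N" by (simp add: fun_eq_iff char[OF M] char[OF N] cos sin)
qed

lemma sin_Lipschitz: "\<bar>sin x - sin y\<bar> \<le> \<bar>x - y\<bar>" for x y :: real
proof -
  have "norm (sin x - sin y) \<le> 1 * norm (x - y)"
    by (rule field_differentiable_bound[of UNIV _ cos]) (auto intro!: derivative_eq_intros)
  then show ?thesis by simp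
qed

lemma cos_Lipschitz: "\<bar>cos x - cos y\<bar> \<le> \<bar>x - y\<bar>" for x y :: real
proof -
  have "norm (cos x - cos y) \<le> 1 * norm (x - y)"
    by (rule field_differentiable_bound[of UNIV _ "\<lambda>x. - sin x"]) (auto intro!: derivative_eq_intros)
  then show ?thesis by simp
qed

context contracting_pinball
begin

definition angle_law :: "nat \<Rightarrow> real measure" where
  "angle_law n = distr unit_uniform borel (\<lambda>u. snd ((pinball lam ^^ n) (pt 0 u 0)))"

lemma angle_law_measurable [measurable]:
  "(\<lambda>u. snd ((pinball lam ^^ n) (pt 0 u 0))) \<in> borel_measurable unit_uniform"
  by measurable

lemma integral_angle_law:
  assumes [measurable]: "h \<in> borel_measurable borel" and "\<And>x. \<bar>h x\<bar> \<le> B"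
  shows "(\<integral>x. h x \<partial>angle_law n) = (transfer ^^ n) (\<lambda>i. h) 0 0"
proof -
  have "(\<integral>x. h x \<partial>angle_law n) = side_avg ((\<lambda>x. h (snd x)) \<circ> (pinball lam ^^ n)) 0 0"
    unfolding angle_law_def by (subst integral_distr) (auto simp: side_avg_def)
  also have "\<dots> = (transfer ^^ n) (side_avg (\<lambda>x. h (snd x))) 0 0"
    by (rule side_avg_pinball_funpow[of _ B]) (use assms zero_in_J in auto)
  finally show ?thesis unfolding side_avg_snd .
qed

lemma real_distribution_angle_law: "real_distribution (angle_law n)"
  unfolding angle_law_def by (intro unit_uniform.real_distribution_distr) simp

lemma angle_law_J: "measure (angle_law n) J = 1"
proof -
  interpret real_distribution "angle_law n" by (rule real_distribution_angle_law)
  have [measurable]: "J \<in> sets borel" by (simp add: J_def)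
  have "measure (angle_law n) (- J) = (\<integral>x. indicator (- J) x \<partial>angle_law n)" by simp
  also have "\<dots> = (transfer ^^ n) (\<lambda>i. indicator (- J)) 0 0"
    by (rule integral_angle_law[of _ 1]) (auto simp: indicator_def)
  also have "\<dots> = 0"
  proof -
    have "values_in 0 0 (\<lambda>i. indicator (- J))" by (simp add: values_in_def)
    from values_inD[OF values_in_transfer_funpow[OF this] zero_in_J] show ?thesis by (intro antisym)
  qed
  finally show ?thesis using prob_compl[of J] by (simp add: Compl_eq_Diff_UNIV)
qed

lemma tight_angle_law: "tight angle_law"
  unfolding tight_def
proof (intro conjI allI impI)
  fix e :: real assume e: "0 < e"
  have "1 - e < measure (angle_law n) {- amax - 1<..amax}" for n
  proof -
    interpret real_distribution "angle_law n" by (rule real_distribution_angle_law)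
    have "measure (angle_law n) J \<le> measure (angle_law n) {- amax - 1<..amax}"
      by (intro finite_measure_mono) (auto simp: J_def)
    then show ?thesis using e by (simp add: angle_law_J)
  qed
  then show "\<exists>a b. a < b \<and> (\<forall>n. 1 - e < measure (angle_law n) {a<..b})"
    using amax_pos by (intro exI[of _ "- amax - 1"] exI[of _ amax]) auto
qed (rule real_distribution_angle_law)

definition transfer_angle :: "(real \<Rightarrow> real) \<Rightarrow> real \<Rightarrow> real" where
  "transfer_angle h \<theta> = pR \<theta> * h (angR \<theta>) + pL \<theta> * h (angL \<theta>)"

lemma transfer_const_side: "transfer (\<lambda>i. h) = (\<lambda>i. transfer_angle h)"
  by (simp add: transfer_def transfer_angle_def fun_eq_iff)

lemma transfer_angle_measurable [measurable]:
  assumes [measurable]: "h \<in> borel_measurable borel"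
  shows "transfer_angle h \<in> borel_measurable borel"
  unfolding transfer_angle_def by measurable

lemma transfer_angle_bounded:
  assumes "\<And>x. \<bar>h x\<bar> \<le> B"
  shows "\<bar>transfer_angle h x\<bar> \<le> B"
proof -
  have "- B \<le> h y" "h y \<le> B" for y using assms[of y] by linarith+
  then have "- B \<le> transfer_angle h x" "transfer_angle h x \<le> B"
    unfolding transfer_angle_def using convex_combination_bounds[of "- B" "h (angR x)" B "h (angL x)" x] by blast+
  then show ?thesis by linarith
qed

text \<open>
  The weak limit of the angle laws along some subsequence. The convergence of the iterates of the
  transfer operator makes the limit invariant under this operator for Lipschitz functions.
\<close>

lemma ex_stationary_Lipschitz:
  "\<exists>\<nu>. real_distribution \<nu> \<and> (AE x in \<nu>. x \<in> J) \<and>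
    (\<forall>h B L. (\<forall>x. \<bar>h x\<bar> \<le> B) \<longrightarrow> (\<forall>x y. \<bar>h x - h y\<bar> \<le> L * \<bar>x - y\<bar>) \<longrightarrow>
      (\<integral>x. transfer_angle h x \<partial>\<nu>) = (\<integral>x. h x \<partial>\<nu>))"
proof -
  obtain r \<nu> where r: "strict_mono (r :: nat \<Rightarrow> nat)" and \<nu>: "real_distribution \<nu>"
    and conv: "weak_conv_m (angle_law \<circ> id \<circ> r) \<nu>"
    using tight_imp_convergent_subsubsequence[OF tight_angle_law strict_mono_id] by blast
  interpret \<nu>: real_distribution \<nu> by (rule \<nu>)
  have lim: "(\<lambda>n. \<integral>x. h x \<partial>angle_law (r n)) \<longlonglongrightarrow> (\<integral>x. h x \<partial>\<nu>)"
    if "\<And>x. isCont h x" "\<And>x. \<bar>h x\<bar> \<le> B" for h :: "real \<Rightarrow> real" and B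
    using weak_conv_imp_integral_bdd_continuous_conv[of "angle_law \<circ> id \<circ> r" \<nu> h B]
      conv \<nu> that real_distribution_angle_law by (simp add: comp_def)
  have J: "AE x in \<nu>. x \<in> J"
  proof -
    define f where "f x = min 1 (max 0 (\<bar>x\<bar> - amax))" for x :: real
    have fcont: "isCont f x" for x unfolding f_def by (intro continuous_intros)
    have fm [measurable]: "f \<in> borel_measurable borel" unfolding f_def by measurable
    have fb: "\<bar>f x\<bar> \<le> 1" and f0: "0 \<le> f x" for x by (auto simp: f_def)
    have "(\<integral>x. f x \<partial>angle_law n) = 0" for n
    proof -
      have "values_in 0 0 (\<lambda>i. f)" by (auto simp: values_in_def J_def f_def)
      from values_inD[OF values_in_transfer_funpow[OF this] zero_in_J]
      show ?thesis unfolding integral_angle_law[OF fm fb] by (intro antisym)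
    qed
    then have "(\<integral>x. f x \<partial>\<nu>) = 0"
      using lim[OF fcont fb] by (simp add: LIMSEQ_const_iff)
    moreover have "integrable \<nu> f"
      by (rule integrable_bounded_borel[OF \<nu>.finite_measure_axioms _ fb]) simp
    ultimately have "AE x in \<nu>. f x = 0"
      using f0 by (simp add: integral_nonneg_eq_0_iff_AE)
    then show ?thesis by eventually_elim (auto simp: f_def J_def min_def max_def split: if_splits)
  qed
  have "(\<integral>x. transfer_angle h x \<partial>\<nu>) = (\<integral>x. h x \<partial>\<nu>)"
    if B: "\<And>x. \<bar>h x\<bar> \<le> B" and L: "\<And>x y. \<bar>h x - h y\<bar> \<le> L * \<bar>x - y\<bar>" for h :: "real \<Rightarrow> real" and B L
  proof -
    have L0: "0 \<le> L" using L[of 0 1] by simp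
    have "L-lipschitz_on UNIV h" using L L0 by (intro lipschitz_onI) (auto simp: dist_real_def)
    then have cont: "continuous_on UNIV h" by (rule lipschitz_on_continuous_on)
    then have hc: "isCont h x" for x by (simp add: continuous_on_eq_continuous_at)
    have hm [measurable]: "h \<in> borel_measurable borel" using cont by (rule borel_measurable_continuous_onI)
    have tc: "isCont (transfer_angle h) x" for x
    proof -
      have "isCont angR x" "isCont angL x" unfolding angR_def angL_def by (intro continuous_intros)+
      then have "isCont (\<lambda>x. h (angR x)) x" "isCont (\<lambda>x. h (angL x)) x"
        using isCont_o2 hc by blast+
      then show ?thesis unfolding transfer_angle_def by (intro continuous_intros isCont_pR isCont_pL)
    qed
    have "values_in (- B) B (\<lambda>i. h)" using B by (simp add: values_in_def abs_le_iff minus_le_iff)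
    moreover have "Lipschitz_J L (\<lambda>i. h)" using L by (simp add: Lipschitz_J_def)
    moreover have "side_periodic (\<lambda>i. h)" by (simp add: side_periodic_def)
    ultimately have conv: "\<exists>N z. \<forall>n\<ge>N. values_in (z - e) (z + e) ((transfer ^^ n) (\<lambda>i. h))" if "0 < e" for e
      using transfer_convergence that by blast
    define d where "d n = (\<integral>x. transfer_angle h x \<partial>angle_law n) - (\<integral>x. h x \<partial>angle_law n)" for n
    have d: "d n = (transfer ^^ Suc n) (\<lambda>i. h) 0 0 - (transfer ^^ n) (\<lambda>i. h) 0 0" for n
    proof -
      have "(transfer ^^ n) (\<lambda>i. transfer_angle h) = (transfer ^^ Suc n) (\<lambda>i. h)"
        by (simp only: funpow_Suc_right o_apply transfer_const_side)
      then show ?thesis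
        unfolding d_def by (simp only: integral_angle_law[OF hm B]
          integral_angle_law[OF transfer_angle_measurable[OF hm] transfer_angle_bounded[OF B]])
    qed
    have "d \<longlonglongrightarrow> 0"
    proof (rule LIMSEQ_I)
      fix e :: real assume "0 < e"
      then obtain N z where N: "\<And>n. N \<le> n \<Longrightarrow> values_in (z - e / 3) (z + e / 3) ((transfer ^^ n) (\<lambda>i. h))"
        using conv[of "e / 3"] by auto
      have "norm (d n - 0) < e" if "N \<le> n" for n
      proof -
        define a b where "a = (transfer ^^ Suc n) (\<lambda>i. h) 0 0" and "b = (transfer ^^ n) (\<lambda>i. h) 0 0"
        have "z - e / 3 \<le> a \<and> a \<le> z + e / 3" "z - e / 3 \<le> b \<and> b \<le> z + e / 3"
          using N[of n] N[of "Suc n"] that zero_in_J unfolding values_in_def a_def b_def by (meson le_SucI)+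
        moreover have "d n = a - b" by (simp only: d a_def b_def)
        ultimately show ?thesis using \<open>0 < e\<close> by (simp add: abs_less_iff)
      qed
      then show "\<exists>no. \<forall>n\<ge>no. norm (d n - 0) < e" by blast
    qed
    then have "(\<lambda>n. d (r n)) \<longlonglongrightarrow> 0" using r LIMSEQ_subseq_LIMSEQ[of d 0 r] by (simp add: comp_def)
    moreover have "(\<lambda>n. d (r n)) \<longlonglongrightarrow> (\<integral>x. transfer_angle h x \<partial>\<nu>) - (\<integral>x. h x \<partial>\<nu>)"
      unfolding d_def by (intro tendsto_diff lim[OF tc transfer_angle_bounded[OF B]] lim[OF hc B])
    ultimately show ?thesis using LIMSEQ_unique by force
  qed
  then have "\<forall>h B L. (\<forall>x. \<bar>h x\<bar> \<le> B) \<longrightarrow> (\<forall>x y. \<bar>h x - h y\<bar> \<le> L * \<bar>x - y\<bar>) \<longrightarrow>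
      (\<integral>x. transfer_angle h x \<partial>\<nu>) = (\<integral>x. h x \<partial>\<nu>)" by blast
  with \<nu> J show ?thesis by blast
qed

text \<open>
  The angle after one bounce from a uniformly chosen point of a side has the same characteristic
  function as the limit, hence the same distribution; so stationarity extends to all bounded
  measurable functions.
\<close>

theorem ex_stationary:
  "\<exists>\<nu>. real_distribution \<nu> \<and> (AE x in \<nu>. x \<in> J) \<and>
    (\<forall>h B. h \<in> borel_measurable borel \<longrightarrow> (\<forall>x. \<bar>h x\<bar> \<le> B) \<longrightarrow>
      (\<integral>x. transfer_angle h x \<partial>\<nu>) = (\<integral>x. h x \<partial>\<nu>))"
proof -
  obtain \<nu> where \<nu>: "real_distribution \<nu>" and J: "AE x in \<nu>. x \<in> J"
    and lip: "\<And>h B L. (\<And>x. \<bar>h x\<bar> \<le> B) \<Longrightarrow> (\<And>x y. \<bar>h x - h y\<bar> \<le> L * \<bar>x - y\<bar>) \<Longrightarrow>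
      (\<integral>x. transfer_angle h x \<partial>\<nu>) = (\<integral>x. h x \<partial>\<nu>)"
    using ex_stationary_Lipschitz by metis
  interpret \<nu>: real_distribution \<nu> by (rule \<nu>)
  interpret P: pair_prob_space \<nu> unit_uniform ..
  define \<nu>' where "\<nu>' = distr (\<nu> \<Otimes>\<^sub>M unit_uniform) borel (\<lambda>x. snd (pinball lam (pt 0 (snd x) (fst x))))"
  have meas [measurable]: "(\<lambda>x. snd (pinball lam (pt 0 (snd x) (fst x)))) \<in> borel_measurable (\<nu> \<Otimes>\<^sub>M unit_uniform)"
    by measurable
  have \<nu>': "real_distribution \<nu>'"
    unfolding \<nu>'_def by (intro P.real_distribution_distr meas)
  have step: "(\<integral>x. h x \<partial>\<nu>') = (\<integral>x. transfer_angle h x \<partial>\<nu>)"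
    if [measurable]: "h \<in> borel_measurable borel" and B: "\<And>x. \<bar>h x\<bar> \<le> B" for h :: "real \<Rightarrow> real" and B
  proof -
    have int: "integrable (\<nu> \<Otimes>\<^sub>M unit_uniform) (\<lambda>x. h (snd (pinball lam (pt 0 (snd x) (fst x)))))"
      by (rule integrable_bounded_borel[OF P.finite_measure_axioms _ B]) measurable
    have "(\<integral>x. h x \<partial>\<nu>') = (\<integral>x. h (snd (pinball lam (pt 0 (snd x) (fst x)))) \<partial>(\<nu> \<Otimes>\<^sub>M unit_uniform))"
      unfolding \<nu>'_def by (rule integral_distr) measurable
    also have "\<dots> = (\<integral>\<theta>. (\<integral>u. h (snd (pinball lam (pt 0 u \<theta>))) \<partial>unit_uniform) \<partial>\<nu>)"
      using P.integral_fst'[OF int] by simp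
    also have "\<dots> = (\<integral>\<theta>. transfer_angle h \<theta> \<partial>\<nu>)"
    proof (rule integral_cong_AE)
      show "AE \<theta> in \<nu>. (\<integral>u. h (snd (pinball lam (pt 0 u \<theta>))) \<partial>unit_uniform) = transfer_angle h \<theta>"
        using J
      proof eventually_elim
        fix \<theta> assume \<theta>: "\<theta> \<in> J"
        have "side_avg ((\<lambda>x. h (snd x)) \<circ> pinball lam) 0 \<theta> = transfer (side_avg (\<lambda>x. h (snd x))) 0 \<theta>"
          by (rule side_avg_pinball[of _ B]) (use B \<theta> in auto)
        then show "(\<integral>u. h (snd (pinball lam (pt 0 u \<theta>))) \<partial>unit_uniform) = transfer_angle h \<theta>"
          unfolding side_avg_snd transfer_const_side by (simp add: side_avg_def)
      qed
      show "(\<lambda>\<theta>. \<integral>u. h (snd (pinball lam (pt 0 u \<theta>))) \<partial>unit_uniform) \<in> borel_measurable \<nu>" by measurable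
      show "transfer_angle h \<in> borel_measurable \<nu>" by measurable
    qed
    finally show ?thesis .
  qed
  have "\<nu>' = \<nu>"
  proof (rule real_distribution_eqI_trig[OF \<nu>' \<nu>])
    fix t :: real
    have c: "\<bar>cos (t * x) - cos (t * y)\<bar> \<le> \<bar>t\<bar> * \<bar>x - y\<bar>" for x y
      using cos_Lipschitz[of "t * x" "t * y"] by (simp add: abs_mult flip: right_diff_distrib)
    have s: "\<bar>sin (t * x) - sin (t * y)\<bar> \<le> \<bar>t\<bar> * \<bar>x - y\<bar>" for x y
      using sin_Lipschitz[of "t * x" "t * y"] by (simp add: abs_mult flip: right_diff_distrib)
    show "(\<integral>x. cos (t * x) \<partial>\<nu>') = (\<integral>x. cos (t * x) \<partial>\<nu>)"
      using step[of "\<lambda>x. cos (t * x)" 1] lip[of "\<lambda>x. cos (t * x)" 1 "\<bar>t\<bar>"] c by simp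
    show "(\<integral>x. sin (t * x) \<partial>\<nu>') = (\<integral>x. sin (t * x) \<partial>\<nu>)"
      using step[of "\<lambda>x. sin (t * x)" 1] lip[of "\<lambda>x. sin (t * x)" 1 "\<bar>t\<bar>"] s by simp
  qed
  with step have "\<forall>h B. h \<in> borel_measurable borel \<longrightarrow> (\<forall>x. \<bar>h x\<bar> \<le> B) \<longrightarrow>
      (\<integral>x. transfer_angle h x \<partial>\<nu>) = (\<integral>x. h x \<partial>\<nu>)"
    by metis
  with \<nu> J show ?thesis by blast
qed

end

section \<open>The invariant measure\<close>

definition three_uniform :: "real measure" where
  "three_uniform = uniform_measure lborel {0<..<3}"

lemma sets_three_uniform [measurable_cong, simp]: "sets three_uniform = sets borel"
  by (simp add: three_uniform_def)

lemma prob_space_three_uniform: "prob_space three_uniform"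
  unfolding three_uniform_def by (rule prob_space_uniform_measure) auto

interpretation three_uniform: prob_space three_uniform
  by (rule prob_space_three_uniform)

lemma integral_three_uniform:
  fixes f :: "real \<Rightarrow> real"
  assumes [measurable]: "f \<in> borel_measurable borel" and "\<And>x. \<bar>f x\<bar> \<le> B"
  shows "(\<integral>s. f s \<partial>three_uniform) =
    ((\<integral>u. f u \<partial>unit_uniform) + (\<integral>u. f (1 + u) \<partial>unit_uniform) + (\<integral>u. f (2 + u) \<partial>unit_uniform)) / 3"
proof -
  have eq: "three_uniform = density lborel (\<lambda>s. ennreal (indicator {0<..<3} s / 3))"
    unfolding three_uniform_def uniform_measure_def
    by (auto intro!: density_cong simp: indicator_def divide_ennreal simp flip: ennreal_numeral ennreal_1)
  have "(\<integral>s. f s \<partial>three_uniform) = (\<integral>s. indicator {0<..<3} s / 3 * f s \<partial>lborel)"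
    unfolding eq by (subst integral_density) auto
  also have "\<dots> = (\<integral>s. (indicator {0<..<1} s * f s + indicator {1<..<2} s * f s + indicator {2<..<3} s * f s) / 3 \<partial>lborel)"
  proof (rule integral_cong_AE)
    have "AE s in lborel. s \<noteq> 1 \<and> s \<noteq> (2 :: real)"
      using AE_lborel_singleton[of "1::real"] AE_lborel_singleton[of "2::real"] by (rule AE_conjI)
    then show "AE s in lborel. indicator {0<..<3} s / 3 * f s =
      (indicator {0<..<1} s * f s + indicator {1<..<2} s * f s + indicator {2<..<3} s * f s) / 3"
      by (rule eventually_mono) (auto simp: indicator_def)
  qed measurable
  also have "\<dots> = ((\<integral>s. indicator {0<..<1} s * f s \<partial>lborel) + (\<integral>s. indicator {1<..<2} s * f s \<partial>lborel)
      + (\<integral>s. indicator {2<..<3} s * f s \<partial>lborel)) / 3"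
  proof -
    have int: "integrable lborel (\<lambda>u. indicator {a<..<b} u * f u)" for a b
      using integrableI_bounded_set_indicator[of "{a<..<b}" lborel f B] assms(2)
      by (cases "a \<le> b") auto
    show ?thesis by (simp add: int)
  qed
  also have "(\<integral>s. indicator {1<..<2} s * f s \<partial>lborel) = (\<integral>u. f (1 + u) \<partial>unit_uniform)"
    by (subst lborel_integral_real_affine[where c = 1 and t = 1], simp, subst integral_unit_uniform, simp)
       (auto intro!: Bochner_Integration.integral_cong simp: indicator_def)
  also have "(\<integral>s. indicator {2<..<3} s * f s \<partial>lborel) = (\<integral>u. f (2 + u) \<partial>unit_uniform)"
    by (subst lborel_integral_real_affine[where c = 1 and t = 2], simp, subst integral_unit_uniform, simp)
       (auto intro!: Bochner_Integration.integral_cong simp: indicator_def)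
  finally show ?thesis by (simp add: integral_unit_uniform)
qed

locale stationary_pinball = contracting_pinball +
  fixes \<nu> :: "real measure"
  assumes real_distribution_nu: "real_distribution \<nu>"
    and nu_J: "AE \<theta> in \<nu>. \<theta> \<in> J"
    and stationary: "\<And>h B. h \<in> borel_measurable borel \<Longrightarrow> (\<And>x. \<bar>h x\<bar> \<le> B) \<Longrightarrow>
      (\<integral>x. transfer_angle h x \<partial>\<nu>) = (\<integral>x. h x \<partial>\<nu>)"
begin

sublocale nu: real_distribution \<nu>
  by (rule real_distribution_nu)

sublocale P: pair_prob_space three_uniform \<nu> ..

definition mu0 :: "(real \<times> real) measure" where
  "mu0 = three_uniform \<Otimes>\<^sub>M \<nu>"

lemma sets_mu0 [measurable_cong, simp]: "sets mu0 = sets borel"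
proof -
  have "sets mu0 = sets (borel \<Otimes>\<^sub>M borel)"
    unfolding mu0_def by (intro sets_pair_measure_cong) auto
  then show ?thesis unfolding borel_prod .
qed

lemma space_mu0 [simp]: "space mu0 = UNIV"
  using sets_eq_imp_space_eq[OF sets_mu0] by simp

sublocale mu0: prob_space mu0
  unfolding mu0_def by (rule P.prob_space_axioms)

definition mean_avg :: "(real \<times> real \<Rightarrow> real) \<Rightarrow> real \<Rightarrow> real" where
  "mean_avg F \<theta> = (side_avg F 0 \<theta> + side_avg F 1 \<theta> + side_avg F 2 \<theta>) / 3"

lemma side_avg_measurable [measurable]:
  assumes [measurable]: "F \<in> borel_measurable borel"
  shows "side_avg F i \<in> borel_measurable borel"
  unfolding side_avg_def by measurable

lemma mean_avg_measurable [measurable]: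
  assumes [measurable]: "F \<in> borel_measurable borel"
  shows "mean_avg F \<in> borel_measurable borel"
  unfolding mean_avg_def by measurable

lemma mean_avg_bounded:
  assumes "F \<in> borel_measurable borel" "\<And>x. \<bar>F x\<bar> \<le> B"
  shows "\<bar>mean_avg F \<theta>\<bar> \<le> B"
proof -
  have "- B \<le> F x" "F x \<le> B" for x using assms(2)[of x] by linarith+
  then have "- B \<le> side_avg F i \<theta>" "side_avg F i \<theta> \<le> B" for i
    by (intro side_avg_bounds[OF assms]; blast)+
  then have "- B + - B + - B \<le> side_avg F 0 \<theta> + side_avg F 1 \<theta> + side_avg F 2 \<theta>"
    "side_avg F 0 \<theta> + side_avg F 1 \<theta> + side_avg F 2 \<theta> \<le> B + B + B"
    by (intro add_mono; blast)+
  then show ?thesis unfolding mean_avg_def abs_le_iff minus_le_iff[of _ B] by (simp add: field_simps)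
qed

lemma integrable_mu0:
  fixes F :: "real \<times> real \<Rightarrow> real"
  assumes "F \<in> borel_measurable borel" "\<And>x. \<bar>F x\<bar> \<le> B"
  shows "integrable mu0 F"
  by (rule integrable_bounded_borel[of _ _ B]) (use assms in \<open>auto intro: mu0.finite_measure_axioms\<close>)

lemma integral_mu0:
  assumes [measurable]: "F \<in> borel_measurable borel" and B: "\<And>x. \<bar>F x\<bar> \<le> B"
  shows "(\<integral>x. F x \<partial>mu0) = (\<integral>\<theta>. mean_avg F \<theta> \<partial>\<nu>)"
proof -
  have int: "integrable (three_uniform \<Otimes>\<^sub>M \<nu>) (case_prod (\<lambda>s \<theta>. F (s, \<theta>)))"
    using integrable_mu0[OF assms] by (simp add: mu0_def)
  have "(\<integral>x. F x \<partial>mu0) = (\<integral>\<theta>. (\<integral>s. F (s, \<theta>) \<partial>three_uniform) \<partial>\<nu>)"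
    using P.integral_snd[OF int] by (simp add: mu0_def)
  also have "(\<lambda>\<theta>. \<integral>s. F (s, \<theta>) \<partial>three_uniform) = mean_avg F"
  proof
    fix \<theta>
    have [measurable]: "(\<lambda>s. F (s, \<theta>)) \<in> borel_measurable borel"
      by (rule measurable_compose[of "\<lambda>s. (s, \<theta>)" _ borel]) (auto intro!: borel_measurable_Pair)
    show "(\<integral>s. F (s, \<theta>) \<partial>three_uniform) = mean_avg F \<theta>"
      by (subst integral_three_uniform[of _ B]) (auto simp: B mean_avg_def side_avg_def pt_def)
  qed
  finally show ?thesis .
qed

lemma mean_avg_pinball:
  assumes "F \<in> borel_measurable borel" "\<And>x. \<bar>F x\<bar> \<le> B" "\<theta> \<in> J"
  shows "mean_avg (F \<circ> pinball lam) \<theta> = transfer_angle (mean_avg F) \<theta>"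
proof -
  have "side_avg F 3 = side_avg F 0" "side_avg F (- 1) = side_avg F 2"
    using side_periodic_side_avg[of F] unfolding side_periodic_def by auto
  then show ?thesis
    unfolding mean_avg_def side_avg_pinball[OF assms] transfer_def transfer_angle_def
    by (simp add: field_simps)
qed

text \<open>
  On each horizontal line the billiard map preserves Lebesgue measure, apart from moving the angle
  according to the bounce probabilities; stationarity of the angle distribution takes care of that.
\<close>

lemma integral_mu0_pinball:
  fixes F :: "real \<times> real \<Rightarrow> real"
  assumes [measurable]: "F \<in> borel_measurable borel" and B: "\<And>x. \<bar>F x\<bar> \<le> B"
  shows "(\<integral>x. F (pinball lam x) \<partial>mu0) = (\<integral>x. F x \<partial>mu0)"
proof -
  have "(\<integral>x. F (pinball lam x) \<partial>mu0) = (\<integral>\<theta>. mean_avg (F \<circ> pinball lam) \<theta> \<partial>\<nu>)"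
    using integral_mu0[of "F \<circ> pinball lam" B] B by (simp add: comp_def)
  also have "\<dots> = (\<integral>\<theta>. transfer_angle (mean_avg F) \<theta> \<partial>\<nu>)"
    using mean_avg_pinball[OF assms] nu_J
    by (intro integral_cong_AE) (auto simp: comp_def elim: eventually_mono)
  also have "\<dots> = (\<integral>\<theta>. mean_avg F \<theta> \<partial>\<nu>)"
    by (rule stationary[OF _ mean_avg_bounded[OF assms]]) measurable
  also have "\<dots> = (\<integral>x. F x \<partial>mu0)" using integral_mu0[OF assms] by simp
  finally show ?thesis .
qed

lemma distr_mu0_pinball: "distr mu0 borel (pinball lam) = mu0"
proof (rule measure_eqI)
  fix A assume "A \<in> sets (distr mu0 borel (pinball lam))"
  then have [measurable]: "A \<in> sets borel" by simp
  have "measure (distr mu0 borel (pinball lam)) A = (\<integral>x. indicator A x \<partial>distr mu0 borel (pinball lam))"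
    by simp
  also have "\<dots> = (\<integral>x. indicator A (pinball lam x) \<partial>mu0)" by (rule integral_distr) measurable
  also have "\<dots> = (\<integral>x. indicator A x \<partial>mu0)" by (rule integral_mu0_pinball[of _ 1]) (auto simp: indicator_def)
  also have "\<dots> = measure mu0 A" by simp
  finally have "measure (distr mu0 borel (pinball lam)) A = measure mu0 A" .
  moreover have "finite_measure (distr mu0 borel (pinball lam))"
    by (rule mu0.finite_measure_distr) simp
  ultimately show "emeasure (distr mu0 borel (pinball lam)) A = emeasure mu0 A"
    by (simp add: finite_measure.emeasure_eq_measure mu0.emeasure_eq_measure)
qed simp

lemma AE_mu0I:
  assumes [measurable]: "Measurable.pred borel P"
    and "AE \<theta> in \<nu>. \<forall>i. AE u in unit_uniform. P (pt i u \<theta>)"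
  shows "AE x in mu0. P x"
proof -
  let ?F = "indicator {x. \<not> P x} :: real \<times> real \<Rightarrow> real"
  have [measurable]: "{x. \<not> P x} \<in> sets borel" by measurable
  have "measure mu0 {x. \<not> P x} = (\<integral>x. ?F x \<partial>mu0)" by simp
  also have "\<dots> = (\<integral>\<theta>. mean_avg ?F \<theta> \<partial>\<nu>)" by (rule integral_mu0[of _ 1]) (auto simp: indicator_def)
  also have "\<dots> = (\<integral>\<theta>. 0 \<partial>\<nu>)"
  proof (rule integral_cong_AE)
    show "AE \<theta> in \<nu>. mean_avg ?F \<theta> = 0"
      using assms(2)
    proof eventually_elim
      fix \<theta> assume *: "\<forall>i. AE u in unit_uniform. P (pt i u \<theta>)"
      have "side_avg ?F i \<theta> = 0" for i
        unfolding side_avg_def using *[rule_format, of i]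
        by (intro integral_eq_zero_AE) (auto elim: eventually_mono)
      then show "mean_avg ?F \<theta> = 0" by (simp add: mean_avg_def)
    qed
  qed auto
  finally have "emeasure mu0 {x. \<not> P x} = 0" by (simp add: mu0.emeasure_eq_measure)
  then show ?thesis by (subst AE_iff_null) (auto simp: null_sets_def)
qed

lemma nu_turns:
  assumes [measurable]: "X \<in> sets borel" "turns X \<in> sets borel" and "AE \<theta> in \<nu>. \<theta> \<in> X"
  shows "AE \<theta> in \<nu>. \<theta> \<in> turns X"
proof -
  let ?h = "indicator (- turns X) :: real \<Rightarrow> real"
  have "measure \<nu> (- turns X) = (\<integral>\<theta>. ?h \<theta> \<partial>\<nu>)" by simp
  also have "\<dots> = (\<integral>\<theta>. transfer_angle ?h \<theta> \<partial>\<nu>)"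
    by (rule stationary[symmetric, of _ 1]) (auto simp: indicator_def)
  also have "\<dots> = 0"
  proof (rule integral_eq_zero_AE)
    show "AE \<theta> in \<nu>. transfer_angle ?h \<theta> = 0"
      using assms(3) by eventually_elim (auto simp: transfer_angle_def turns_def indicator_def)
  qed
  finally have "emeasure \<nu> (- turns X) = 0" by (simp add: nu.emeasure_eq_measure)
  then show ?thesis by (subst AE_iff_null) (auto simp: null_sets_def Compl_eq)
qed

lemma nu_angle_set: "AE \<theta> in \<nu>. \<theta> \<in> angle_set"
proof -
  have borel: "(turns ^^ n) J \<in> sets borel" for n
    using compact_turns_funpow by (rule borel_compact)
  have "AE \<theta> in \<nu>. \<theta> \<in> (turns ^^ n) J" for n
  proof (induction n)
    case (Suc n)
    then show ?case using nu_turns[OF borel[of n]] borel[of "Suc n"] by simp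
  qed (simp add: nu_J)
  then have "AE \<theta> in \<nu>. \<forall>n. \<theta> \<in> (turns ^^ n) J" by (simp add: AE_all_countable)
  then show ?thesis by (simp add: angle_set_def)
qed

lemma pred_hits_vertex [measurable]: "Measurable.pred borel hits_vertex"
  unfolding hits_vertex_def by measurable

lemma AE_never_hits: "AE x in mu0. never_hits x"
proof -
  have base: "AE x in mu0. \<not> hits_vertex x"
  proof (rule AE_mu0I)
    show "AE \<theta> in \<nu>. \<forall>i. AE u in unit_uniform. \<not> hits_vertex (pt i u \<theta>)"
      using nu_J
    proof (eventually_elim, intro allI)
      fix \<theta> i assume \<theta>: "\<theta> \<in> J"
      have "AE u in unit_uniform. u \<noteq> pL \<theta>"
        unfolding unit_uniform_def
        by (intro AE_uniform_measureI) (use AE_lborel_singleton[of "pL \<theta>"] in \<open>auto elim: eventually_mono\<close>)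
      with AE_unit_uniform show "AE u in unit_uniform. \<not> hits_vertex (pt i u \<theta>)"
        by eventually_elim (simp add: hits_vertex_pt[OF \<theta>])
    qed
  qed measurable
  have "AE x in mu0. \<not> hits_vertex ((pinball lam ^^ n) x)" for n
  proof (induction n)
    case (Suc n)
    then have "AE x in distr mu0 borel (pinball lam). \<not> hits_vertex ((pinball lam ^^ n) x)"
      by (simp only: distr_mu0_pinball)
    then have "AE x in mu0. \<not> hits_vertex ((pinball lam ^^ n) (pinball lam x))"
      by (subst (asm) AE_distr_iff) (auto simp: pred_def)
    then show ?case by (simp add: funpow_swap1)
  qed (simp add: base)
  then show ?thesis by (simp add: never_hits_def AE_all_countable)
qed

lemma regular_set_eq_Collect:
  "regular_set = {x. fst x \<in> {0<..<1} \<union> {1<..<2} \<union> {2<..<3} \<and> snd x \<in> angle_set \<and> never_hits x}"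
proof (intro set_eqI iffI)
  fix x assume "x \<in> regular_set"
  then obtain i u \<theta> where x: "x = pt i u \<theta>" "0 < u" "u < 1" "\<theta> \<in> angle_set" "\<theta> \<in> J" "never_hits x"
    by (elim regular_setE)
  have "x \<in> M_tilde" unfolding x(1) using x(2,3,5) by (rule pt_M_tilde)
  then have "fst x \<in> {0<..<1} \<union> {1<..<2} \<union> {2<..<3}" unfolding M_tilde_def by (simp only: mem_Times_iff)
  then show "x \<in> {x. fst x \<in> {0<..<1} \<union> {1<..<2} \<union> {2<..<3} \<and> snd x \<in> angle_set \<and> never_hits x}"
    using x(4,6) unfolding x(1) by (simp only: mem_Collect_eq snd_pt simp_thms)
next
  fix x assume x: "x \<in> {x. fst x \<in> {0<..<1} \<union> {1<..<2} \<union> {2<..<3} \<and> snd x \<in> angle_set \<and> never_hits x}"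
  then have "fst x \<in> {0<..<1} \<union> {1<..<2} \<union> {2<..<3}" by blast
  note p = M_tilde_eq_pt(1)[OF this, of "snd x"] M_tilde_eq_pt(2,3)[OF this]
  show "x \<in> regular_set"
    unfolding regular_set_def mem_Collect_eq
    using x p by (intro conjI exI[of _ "\<lfloor>fst x\<rfloor>"] exI[of _ "frac (fst x)"] exI[of _ "snd x"]) auto
qed

lemma pred_never_hits [measurable]: "Measurable.pred borel never_hits"
proof -
  have "Measurable.pred borel (\<lambda>x. \<not> hits_vertex ((pinball lam ^^ n) x))" for n
    by (intro pred_intros_logic measurable_compose[OF borel_measurable_pinball_funpow pred_hits_vertex])
  then have "Measurable.pred borel (\<lambda>x. \<forall>n. \<not> hits_vertex ((pinball lam ^^ n) x))"
    by (rule pred_intros_countable)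
  then show ?thesis unfolding never_hits_def[abs_def] .
qed

lemma attractor_borel [measurable]: "attractor lam \<in> sets borel"
proof -
  have "fst -` ({0<..<1} \<union> {1<..<2} \<union> {2<..<3}) \<inter> space borel \<inter> (snd -` angle_set \<inter> space borel)
      \<inter> {x \<in> space borel. never_hits x} \<in> sets borel"
    using pred_never_hits borel_compact[OF compact_angle_set] unfolding pred_def
    by (intro sets.Int measurable_sets[OF borel_measurable_fst_plane] measurable_sets[OF borel_measurable_snd_plane]) auto
  also have "fst -` ({0<..<1} \<union> {1<..<2} \<union> {2<..<3}) \<inter> space borel \<inter> (snd -` angle_set \<inter> space borel)
      \<inter> {x \<in> space borel. never_hits x} = attractor lam"
    unfolding attractor_eq regular_set_eq_Collect by (intro set_eqI) (simp only: Int_iff vimage_eq space_borel UNIV_I mem_Collect_eq simp_thms conj_assoc)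
  finally show ?thesis .
qed

lemma AE_attractor: "AE x in mu0. x \<in> attractor lam"
proof -
  have [measurable]: "angle_set \<in> sets borel" using compact_angle_set by (rule borel_compact)
  have "AE x in mu0. fst x \<in> {0<..<1} \<union> {1<..<2} \<union> {2<..<3} \<and> snd x \<in> angle_set"
  proof (rule AE_mu0I)
    show "AE \<theta> in \<nu>. \<forall>i. AE u in unit_uniform.
        fst (pt i u \<theta>) \<in> {0<..<1} \<union> {1<..<2} \<union> {2<..<3} \<and> snd (pt i u \<theta>) \<in> angle_set"
      using nu_angle_set
    proof (eventually_elim, intro allI)
      fix \<theta> i assume \<theta>: "\<theta> \<in> angle_set"
      then have "\<theta> \<in> J" using angle_set_J by blast
      show "AE u in unit_uniform. fst (pt i u \<theta>) \<in> {0<..<1} \<union> {1<..<2} \<union> {2<..<3} \<and> snd (pt i u \<theta>) \<in> angle_set"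
        using AE_unit_uniform
      proof (eventually_elim, elim conjE)
        fix u :: real assume "0 < u" "u < 1"
        then have "pt i u \<theta> \<in> M_tilde" using \<open>\<theta> \<in> J\<close> by (rule pt_M_tilde)
        then show "fst (pt i u \<theta>) \<in> {0<..<1} \<union> {1<..<2} \<union> {2<..<3} \<and> snd (pt i u \<theta>) \<in> angle_set"
          using \<theta> unfolding M_tilde_def by (simp only: mem_Times_iff snd_pt simp_thms)
      qed
    qed
  qed measurable
  with AE_never_hits show ?thesis
    unfolding attractor_eq regular_set_eq_Collect by eventually_elim blast
qed

text \<open>
  Every point of the angle set lies in the support: an interval around it of radius of order
  \<open>lam ^ n\<close> contains the image, under some composition of \<open>n\<close> turns, of an interval containing all
  of the angle set.
\<close>

lemma nu_ball_ge:
  "\<theta> \<in> angle_set \<Longrightarrow> pmin ^ n \<le> measure \<nu> {\<theta> - lam ^ n * 4<..<\<theta> + lam ^ n * 4}"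
proof (induction n arbitrary: \<theta>)
  case 0
  have "measure \<nu> {\<theta> - 4<..<\<theta> + 4} = 1"
  proof (subst nu.prob_eq_1)
    show "AE x in \<nu>. x \<in> {\<theta> - 4<..<\<theta> + 4}"
      using nu_angle_set
    proof eventually_elim
      fix x assume "x \<in> angle_set"
      then have "\<bar>x - \<theta>\<bar> \<le> pi" using 0 angle_set_J by (intro J_dist) auto
      also have "\<dots> < 4" by (rule pi_less_4)
      finally show "x \<in> {\<theta> - 4<..<\<theta> + 4}" by (simp add: abs_less_iff)
    qed
  qed simp
  then show ?case by simp
next
  case (Suc n)
  let ?I = "\<lambda>\<theta> n. {\<theta> - lam ^ n * 4<..<\<theta> + lam ^ n * 4}"
  let ?h = "indicator (?I \<theta> (Suc n)) :: real \<Rightarrow> real"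
  obtain \<theta>' where \<theta>': "\<theta>' \<in> angle_set" "\<theta> = angR \<theta>' \<or> \<theta> = angL \<theta>'"
    using Suc.prems angle_set_pos_cases angle_set_nonpos_cases by blast
  have mem: "angR x \<in> ?I (angR \<theta>') (Suc n) \<longleftrightarrow> x \<in> ?I \<theta>' n" "angL x \<in> ?I (angL \<theta>') (Suc n) \<longleftrightarrow> x \<in> ?I \<theta>' n" for x
  proof -
    have I: "y \<in> ?I z m \<longleftrightarrow> \<bar>y - z\<bar> < lam ^ m * 4" for y z m by auto
    have "lam * \<bar>x - \<theta>'\<bar> < lam ^ Suc n * 4 \<longleftrightarrow> \<bar>x - \<theta>'\<bar> < lam ^ n * 4"
      using lam_pos by simp
    then show "angR x \<in> ?I (angR \<theta>') (Suc n) \<longleftrightarrow> x \<in> ?I \<theta>' n" "angL x \<in> ?I (angL \<theta>') (Suc n) \<longleftrightarrow> x \<in> ?I \<theta>' n"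
      unfolding I angR_dist angL_dist by blast+
  qed
  have le: "pmin * indicator (?I \<theta>' n) x \<le> transfer_angle ?h x" for x
    using \<theta>'(2)
  proof
    assume "\<theta> = angR \<theta>'"
    then have "pR x * indicator (?I \<theta>' n) x \<le> transfer_angle ?h x"
      using mem(1)[of x] pL_pos[of x] by (simp add: transfer_angle_def indicator_def)
    moreover have "pmin * indicator (?I \<theta>' n) x \<le> pR x * indicator (?I \<theta>' n) x"
      using pR_bounds(1)[of x] by (intro mult_right_mono) auto
    ultimately show ?thesis by linarith
  next
    assume "\<theta> = angL \<theta>'"
    then have "pL x * indicator (?I \<theta>' n) x \<le> transfer_angle ?h x"
      using mem(2)[of x] pR_pos[of x] by (simp add: transfer_angle_def indicator_def)
    moreover have "pmin * indicator (?I \<theta>' n) x \<le> pL x * indicator (?I \<theta>' n) x"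
      using pL_bounds(1)[of x] by (intro mult_right_mono) auto
    ultimately show ?thesis by linarith
  qed
  have hb: "\<bar>?h x\<bar> \<le> 1" for x by (simp add: indicator_def)
  have "pmin ^ Suc n \<le> pmin * measure \<nu> (?I \<theta>' n)"
    using Suc.IH[OF \<theta>'(1)] pmin_pos by simp
  also have "\<dots> = (\<integral>x. pmin * indicator (?I \<theta>' n) x \<partial>\<nu>)" by simp
  also have "\<dots> \<le> (\<integral>x. transfer_angle ?h x \<partial>\<nu>)"
  proof (rule integral_mono[OF _ _ le])
    show "integrable \<nu> (\<lambda>x. pmin * indicator (?I \<theta>' n) x)"
      by (rule integrable_bounded_borel[OF nu.finite_measure_axioms, of _ pmin])
         (use pmin_pos in \<open>auto simp: indicator_def\<close>)
    show "integrable \<nu> (transfer_angle ?h)"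
      by (rule integrable_bounded_borel[OF nu.finite_measure_axioms _ transfer_angle_bounded[OF hb]]) measurable
  qed
  also have "\<dots> = (\<integral>x. ?h x \<partial>\<nu>)" by (rule stationary[OF _ hb]) measurable
  also have "\<dots> = measure \<nu> (?I \<theta> (Suc n))" by simp
  finally show ?case .
qed

lemma mu0_open_pos:
  assumes W: "open W" and x: "x \<in> W" "x \<in> attractor lam"
  shows "0 < measure mu0 W"
proof -
  obtain s \<theta> where sx: "x = (s, \<theta>)" by fastforce
  have \<theta>: "\<theta> \<in> angle_set" and s: "s \<in> {0<..<3}"
    using x(2) unfolding attractor_eq regular_set_eq_Collect sx by auto
  obtain A B where AB: "open A" "open B" "s \<in> A" "\<theta> \<in> B" "A \<times> B \<subseteq> W"
    using open_prod_elim[OF W x(1)] unfolding sx by (metis mem_Sigma_iff)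
  obtain e where e: "0 < e" "ball s e \<subseteq> A \<inter> {0<..<3}"
    using AB s open_contains_ball[of "A \<inter> {0<..<3}"] by (metis IntI open_Int open_greaterThanLessThan)
  obtain e' where e': "0 < e'" "ball \<theta> e' \<subseteq> B" using AB open_contains_ball by blast
  have "0 < emeasure three_uniform A"
  proof -
    have "0 < emeasure lborel (ball s e)" using e by (simp add: ball_eq_greaterThanLessThan)
    also have "\<dots> \<le> emeasure lborel ({0<..<3} \<inter> A)" using e AB by (intro emeasure_mono) auto
    finally have pos: "0 < emeasure lborel ({0<..<3} \<inter> A)" .
    show ?thesis
      unfolding three_uniform_def using pos AB by (subst emeasure_uniform_measure) (auto simp: ennreal_zero_less_divide)
  qed
  moreover have "0 < emeasure \<nu> B"
  proof -
    obtain n where n: "lam ^ n * 4 < e'" using ex_lam_power_less[OF e'(1)] by blast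
    have "0 < pmin ^ n" using pmin_pos by simp
    also have "\<dots> \<le> measure \<nu> {\<theta> - lam ^ n * 4<..<\<theta> + lam ^ n * 4}" by (rule nu_ball_ge[OF \<theta>])
    also have "\<dots> \<le> measure \<nu> B"
      using AB n e' by (intro nu.finite_measure_mono) (auto simp: ball_eq_greaterThanLessThan)
    finally show ?thesis by (simp add: nu.emeasure_eq_measure)
  qed
  moreover have "emeasure mu0 (A \<times> B) = emeasure three_uniform A * emeasure \<nu> B"
    unfolding mu0_def using AB by (intro nu.emeasure_pair_measure_Times) auto
  ultimately have "0 < emeasure mu0 (A \<times> B)" by (simp add: ennreal_zero_less_mult_iff)
  also have "\<dots> \<le> emeasure mu0 W" using AB W by (intro emeasure_mono) auto
  finally show ?thesis by (simp add: mu0.emeasure_eq_measure)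
qed

end

section \<open>Ergodicity and transitivity\<close>

text \<open>
  Approximate the set from outside by an open set \<open>U\<close>, and the indicator of \<open>U\<close> from below by multiples of
  the distance to the complement of \<open>U\<close>, cut off at \<open>1\<close>.
\<close>

lemma ex_Lipschitz_approx_indicator:
  fixes M :: "'a::{second_countable_topology, complete_space} measure"
  assumes M: "finite_measure M" "sets M = sets borel" and A: "A \<in> sets borel" and e: "0 < (e :: real)"
  shows "\<exists>g L. g \<in> borel_measurable borel \<and> (\<forall>x. 0 \<le> g x \<and> g x \<le> 1) \<and> 0 \<le> L
    \<and> (\<forall>x y. \<bar>g x - g y\<bar> \<le> L * dist x y) \<and> (\<integral>x. \<bar>indicator A x - g x\<bar> \<partial>M) < e"
proof -
  interpret finite_measure M by (rule M)
  note [measurable_cong] = M(2)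
  note [measurable] = A
  have "emeasure M A < emeasure M A + ennreal (e / 2)"
    using e by (simp add: emeasure_eq_measure ennreal_less_iff flip: ennreal_plus)
  then have "(INF U\<in>{U. A \<subseteq> U \<and> open U}. emeasure M U) < emeasure M A + ennreal (e / 2)"
    using outer_regular[OF M(2) _ A] emeasure_finite[of "space M"] by simp
  then obtain U where U: "A \<subseteq> U" "open U" "emeasure M U < emeasure M A + ennreal (e / 2)"
    unfolding INF_less_iff by blast
  have [measurable]: "U \<in> sets borel" using U by simp
  have mU: "measure M U < measure M A + e / 2"
    using U(3) e by (simp add: emeasure_eq_measure ennreal_less_iff flip: ennreal_plus)
  define g where "g n x = (if U = UNIV then 1 else min 1 (real n * infdist x (- U)))" for n x
  have gm [measurable]: "g n \<in> borel_measurable borel" for n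
    unfolding g_def
    by (intro borel_measurable_continuous_onI continuous_intros)
       (cases "U = UNIV"; auto intro!: continuous_intros)
  have g01: "0 \<le> g n x \<and> g n x \<le> 1" for n x by (simp add: g_def infdist_nonneg)
  have gL: "\<bar>g n x - g n y\<bar> \<le> real n * dist x y" for n x y
  proof (cases "U = UNIV")
    case False
    have "\<bar>g n x - g n y\<bar> \<le> \<bar>real n * infdist x (- U) - real n * infdist y (- U)\<bar>"
      using False by (simp add: g_def)
    also have "\<dots> = real n * \<bar>infdist x (- U) - infdist y (- U)\<bar>"
      by (simp add: abs_mult flip: right_diff_distrib)
    also have "\<dots> \<le> real n * dist x y" by (intro mult_left_mono infdist_triangle_abs) simp
    finally show ?thesis .
  qed (simp add: g_def)
  have conv: "(\<lambda>n. \<bar>indicator U x - g n x\<bar>) \<longlonglongrightarrow> 0" for x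
  proof (cases "x \<in> U")
    case True
    have "eventually (\<lambda>n. \<bar>indicator U x - g n x\<bar> = 0) sequentially"
    proof (cases "U = UNIV")
      case False
      then have "- U \<noteq> {}" by auto
      then have "infdist x (- U) > 0"
        using True U(2) in_closed_iff_infdist_zero[of "- U" x] infdist_nonneg[of x "- U"]
        by (simp add: closed_Compl less_le)
      then obtain N :: nat where N: "1 < real N * infdist x (- U)"
        using reals_Archimedean3 by blast
      have "\<bar>indicator U x - g n x\<bar> = 0" if "N \<le> n" for n
      proof -
        have "real N * infdist x (- U) \<le> real n * infdist x (- U)"
          using that by (intro mult_right_mono infdist_nonneg) simp
        then show ?thesis using N False True by (simp add: g_def)
      qed
      then show ?thesis by (auto simp: eventually_sequentially)
    qed (simp add: g_def)
    then show ?thesis by (rule tendsto_eventually)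
  next
    case False
    then have "g n x = 0" for n by (auto simp: g_def)
    then show ?thesis using False by simp
  qed
  have "(\<lambda>n. \<integral>x. \<bar>indicator U x - g n x\<bar> \<partial>M) \<longlonglongrightarrow> (\<integral>x. 0 \<partial>M)"
  proof (rule integral_dominated_convergence[where w = "\<lambda>_. 1"])
    fix n
    have "norm \<bar>indicator U x - g n x\<bar> \<le> 1" for x
      using g01[of n x] by (cases "x \<in> U") auto
    then show "AE x in M. norm \<bar>indicator U x - g n x\<bar> \<le> 1" by simp
  qed (use conv in auto)
  then have "(\<lambda>n. \<integral>x. \<bar>indicator U x - g n x\<bar> \<partial>M) \<longlonglongrightarrow> 0" by simp
  then have "eventually (\<lambda>n. (\<integral>x. \<bar>indicator U x - g n x\<bar> \<partial>M) < e / 2) sequentially"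
    using e by (intro order_tendstoD(2)) auto
  then obtain n where n: "(\<integral>x. \<bar>indicator U x - g n x\<bar> \<partial>M) < e / 2" by (auto simp: eventually_sequentially)
  have int: "integrable M (\<lambda>x. \<bar>indicator B x - g n x\<bar>)" if [measurable]: "B \<in> sets borel" for B
  proof (rule integrable_bounded_borel[OF M(1)])
    fix x
    show "\<bar>\<bar>indicator B x - g n x\<bar>\<bar> \<le> 1" using g01[of n x] by (cases "x \<in> B") auto
  qed measurable
  have intUA: "integrable M (indicator (U - A) :: 'a \<Rightarrow> real)"
    by (rule integrable_bounded_borel[OF M(1), of _ 1]) (auto simp: indicator_def)
  have "(\<integral>x. \<bar>indicator A x - g n x\<bar> \<partial>M) \<le> (\<integral>x. indicator (U - A) x + \<bar>indicator U x - g n x\<bar> \<partial>M)"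
  proof (rule integral_mono)
    fix x
    show "\<bar>indicator A x - g n x\<bar> \<le> indicator (U - A) x + \<bar>indicator U x - g n x\<bar>"
      using U(1) g01[of n x] by (auto simp: indicator_def)
  qed (intro int Bochner_Integration.integrable_add intUA; measurable)+
  also have "\<dots> = measure M (U - A) + (\<integral>x. \<bar>indicator U x - g n x\<bar> \<partial>M)"
    by (subst Bochner_Integration.integral_add) (auto simp: int intUA)
  also have "measure M (U - A) = measure M U - measure M A"
    using U(1) by (intro finite_measure_Diff) auto
  finally have "(\<integral>x. \<bar>indicator A x - g n x\<bar> \<partial>M) < e" using mU n by linarith
  then show ?thesis using gm g01 gL by (intro exI[of _ "g n"] exI[of _ "real n"]) auto
qed

context contracting_pinball
begin

lemma borel_measurable_unbounce [measurable]: "unbounce \<in> borel_measurable borel"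
proof -
  have fl: "(\<lambda>x :: real \<times> real. \<lfloor>fst x\<rfloor>) \<in> measurable borel (count_space UNIV)"
    by (rule measurable_compose[OF borel_measurable_fst_plane measurable_real_floor])
  define l where "l k = real_of_int ((k - 1) mod 3)" for k :: int
  define r where "r k = real_of_int ((k + 1) mod 3)" for k :: int
  have [measurable]: "(\<lambda>x :: real \<times> real. l \<lfloor>fst x\<rfloor>) \<in> borel_measurable borel"
    "(\<lambda>x :: real \<times> real. r \<lfloor>fst x\<rfloor>) \<in> borel_measurable borel"
    using measurable_compose[OF fl, of l borel] measurable_compose[OF fl, of r borel] by simp_all
  define a where "a = (\<lambda>x. (l \<lfloor>fst x\<rfloor> + (1 - frac (fst x) * pR (pi/3 - snd x / lam)), pi/3 - snd x / lam))"
  define b where "b = (\<lambda>x. (r \<lfloor>fst x\<rfloor> + (1 - frac (fst x)) * pL (- pi/3 - snd x / lam), - pi/3 - snd x / lam))"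
  have [measurable]: "a \<in> borel_measurable borel" "b \<in> borel_measurable borel"
    unfolding a_def b_def by (intro borel_measurable_Pair; measurable)+
  have "unbounce = (\<lambda>x. if 0 < snd x then a x else b x)"
    by (rule ext) (simp only: unbounce_def case_prod_beta pt_def a_def b_def l_def r_def)
  also have "\<dots> \<in> borel_measurable borel" by measurable
  finally show ?thesis .
qed

lemma borel_measurable_unbounce_funpow [measurable]: "(unbounce ^^ n) \<in> borel_measurable borel"
  by (induction n) (auto intro: measurable_comp borel_measurable_unbounce simp: id_def)

text \<open>
  The inverse map contracts horizontal distances: its branches are the inverses of the expanding
  affine branches of the billiard map, and the branch depends on the angle only.
\<close>

lemma unbounce_funpow_contracts:
  assumes u: "0 < u" "u < 1" "0 < u'" "u' < 1"
  shows "\<exists>j v v' t. (unbounce ^^ n) (pt i u \<theta>) = pt j v t \<and> (unbounce ^^ n) (pt i u' \<theta>) = pt j v' t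
    \<and> 0 < v \<and> v < 1 \<and> 0 < v' \<and> v' < 1 \<and> \<bar>v - v'\<bar> \<le> (1 - pmin) ^ n"
proof (induction n)
  case 0
  have "\<bar>u - u'\<bar> \<le> 1" using u by linarith
  with u show ?case by (intro exI[of _ i] exI[of _ u] exI[of _ u'] exI[of _ \<theta>]) simp
next
  case (Suc n)
  then obtain j v v' t where *: "(unbounce ^^ n) (pt i u \<theta>) = pt j v t" "(unbounce ^^ n) (pt i u' \<theta>) = pt j v' t"
    "0 < v" "v < 1" "0 < v'" "v' < 1" "\<bar>v - v'\<bar> \<le> (1 - pmin) ^ n" by blast
  show ?case
  proof (cases "0 < t")
    case True
    define t' where "t' = pi/3 - t / lam"
    have p: "0 < pR t'" "pR t' < 1" "pR t' \<le> 1 - pmin" using pR_pos pR_less_1 pR_bounds by auto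
    have b: "0 < x * pR t'" "x * pR t' < 1" if "0 < x" "x < 1" for x
      using that p mult_strict_mono[of x 1 "pR t'" 1] by auto
    have "\<bar>(1 - v * pR t') - (1 - v' * pR t')\<bar> = \<bar>v - v'\<bar> * pR t'"
      using p by (simp add: abs_mult abs_minus_commute flip: left_diff_distrib)
    also have "\<dots> \<le> (1 - pmin) ^ n * (1 - pmin)"
      using * p pmin_less_1 by (intro mult_mono) auto
    finally show ?thesis
      using * b[of v] b[of v'] unbounce_pos[OF *(3,4) True, of j] unbounce_pos[OF *(5,6) True, of j]
      unfolding t'_def[symmetric]
      by (intro exI[of _ "j - 1"] exI[of _ "1 - v * pR t'"] exI[of _ "1 - v' * pR t'"] exI[of _ t'])
         (simp add: mult.commute)
  next
    case False
    define t' where "t' = - pi/3 - t / lam"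
    have p: "0 < pL t'" "pL t' < 1" "pL t' \<le> 1 - pmin" using pL_pos pL_less_1 pL_bounds by auto
    have b: "0 < (1 - x) * pL t'" "(1 - x) * pL t' < 1" if "0 < x" "x < 1" for x
      using that p mult_strict_mono[of "1 - x" 1 "pL t'" 1] by auto
    have "(1 - v) * pL t' - (1 - v') * pL t' = (v' - v) * pL t'" by (simp add: algebra_simps)
    then have "\<bar>(1 - v) * pL t' - (1 - v') * pL t'\<bar> = \<bar>v - v'\<bar> * pL t'"
      using p by (simp add: abs_mult abs_minus_commute)
    also have "\<dots> \<le> (1 - pmin) ^ n * (1 - pmin)"
      using * p pmin_less_1 by (intro mult_mono) auto
    finally show ?thesis
      using * b[of v] b[of v'] unbounce_nonpos[OF *(3,4) False, of j] unbounce_nonpos[OF *(5,6) False, of j]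
      unfolding t'_def[symmetric]
      by (intro exI[of _ "j + 1"] exI[of _ "(1 - v) * pL t'"] exI[of _ "(1 - v') * pL t'"] exI[of _ t'])
         (simp add: mult.commute)
  qed
qed

lemma dist_pt_horizontal: "dist (pt j v t) (pt j v' t) = \<bar>v - v'\<bar>"
  unfolding pt_eq[of j v] pt_eq[of j v'] by (simp add: dist_Pair_Pair dist_real_def)

lemma dist_pt_vertical: "dist (pt j v t) (pt j v t') = \<bar>t - t'\<bar>"
  unfolding pt_eq[of j v] by (simp add: dist_Pair_Pair dist_real_def)

lemma side_avg_mono:
  assumes F: "F \<in> borel_measurable borel" "\<And>x. \<bar>F x\<bar> \<le> B" and G: "G \<in> borel_measurable borel" "\<And>x. \<bar>G x\<bar> \<le> B'"
    and le: "\<And>u. 0 < u \<Longrightarrow> u < 1 \<Longrightarrow> F (pt i u \<theta>) \<le> G (pt i u \<theta>) + k"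
  shows "side_avg F i \<theta> \<le> side_avg G i \<theta> + k"
proof -
  have "side_avg F i \<theta> \<le> (\<integral>u. G (pt i u \<theta>) + k \<partial>unit_uniform)"
    unfolding side_avg_def
  proof (rule integral_mono_AE)
    show "AE u in unit_uniform. F (pt i u \<theta>) \<le> G (pt i u \<theta>) + k"
      using AE_unit_uniform le by (auto elim: eventually_mono)
    show "integrable unit_uniform (\<lambda>u. F (pt i u \<theta>))" by (rule integrable_side[OF F])
    show "integrable unit_uniform (\<lambda>u. G (pt i u \<theta>) + k)" using integrable_side[OF G] by simp
  qed
  also have "\<dots> = side_avg G i \<theta> + k"
    unfolding side_avg_def using unit_uniform.prob_space
    by (subst Bochner_Integration.integral_add[OF integrable_side[OF G]]) auto
  finally show ?thesis .
qed

end

context stationary_pinball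
begin

lemma integral_mu0_unbounce:
  fixes F :: "real \<times> real \<Rightarrow> real"
  assumes [measurable]: "F \<in> borel_measurable borel" and B: "\<And>x. \<bar>F x\<bar> \<le> B"
  shows "(\<integral>x. F (unbounce x) \<partial>mu0) = (\<integral>x. F x \<partial>mu0)"
proof -
  have "(\<integral>x. F (unbounce x) \<partial>mu0) = (\<integral>x. F (unbounce (pinball lam x)) \<partial>mu0)"
    by (rule integral_mu0_pinball[symmetric, OF _ B]) measurable
  also have "\<dots> = (\<integral>x. F x \<partial>mu0)"
  proof (rule integral_cong_AE)
    show "AE x in mu0. F (unbounce (pinball lam x)) = F x"
      using AE_attractor by eventually_elim (simp add: attractor_eq unbounce_pinball)
  qed measurable
  finally show ?thesis .
qed

lemma integral_mu0_unbounce_funpow: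
  fixes F :: "real \<times> real \<Rightarrow> real"
  assumes [measurable]: "F \<in> borel_measurable borel" and B: "\<And>x. \<bar>F x\<bar> \<le> B"
  shows "(\<integral>x. F ((unbounce ^^ n) x) \<partial>mu0) = (\<integral>x. F x \<partial>mu0)"
proof (induction n)
  case (Suc n)
  have "(\<integral>x. F ((unbounce ^^ n) (unbounce x)) \<partial>mu0) = (\<integral>x. F ((unbounce ^^ n) x) \<partial>mu0)"
    by (rule integral_mu0_unbounce[of "\<lambda>x. F ((unbounce ^^ n) x)", OF _ B]) measurable
  then show ?case using Suc by (simp add: funpow_swap1)
qed simp

lemma integral_mu0_pinball_funpow:
  fixes F :: "real \<times> real \<Rightarrow> real"
  assumes [measurable]: "F \<in> borel_measurable borel" and B: "\<And>x. \<bar>F x\<bar> \<le> B"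
  shows "(\<integral>x. F ((pinball lam ^^ n) x) \<partial>mu0) = (\<integral>x. F x \<partial>mu0)"
proof (induction n)
  case (Suc n)
  have "(\<integral>x. F ((pinball lam ^^ n) (pinball lam x)) \<partial>mu0) = (\<integral>x. F ((pinball lam ^^ n) x) \<partial>mu0)"
    by (rule integral_mu0_pinball[of "\<lambda>x. F ((pinball lam ^^ n) x)", OF _ B]) measurable
  then show ?case using Suc by (simp add: funpow_swap1)
qed simp

text \<open>
  Let \<open>g\<close> be a Lipschitz approximation of the indicator of an invariant set. The indicator is
  approximated equally well by \<open>g\<close> composed with a power of the inverse map, which is almost constant
  along each side, and by \<open>g\<close> composed with a power of the billiard map, whose averages over the
  sides are iterates of the transfer operator and hence almost equal. So the indicator is almost
  constant.
\<close>

lemma invariant_approx_const: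
  fixes e :: real
  assumes A: "A \<in> sets borel" and inv: "\<And>x. x \<in> attractor lam \<Longrightarrow> pinball lam x \<in> A \<longleftrightarrow> x \<in> A" and e: "0 < e"
  shows "\<exists>c. (\<integral>x. \<bar>indicator A x - c\<bar> \<partial>mu0) \<le> 5 * e"
proof -
  note [measurable] = A
  obtain g L where gm [measurable]: "g \<in> borel_measurable borel" and g01: "\<And>x. 0 \<le> g x \<and> g x \<le> 1"
    and L: "0 \<le> L" and gL: "\<And>x y. \<bar>g x - g y\<bar> \<le> L * dist x y"
    and gA: "(\<integral>x. \<bar>indicator A x - g x\<bar> \<partial>mu0) < e"
    using ex_Lipschitz_approx_indicator[OF mu0.finite_measure_axioms sets_mu0 A e] by blast
  have gb: "\<bar>g x\<bar> \<le> 1" for x using g01[of x] by simp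
  have "values_in 0 1 (side_avg g)"
    unfolding values_in_def using g01
    by (intro allI ballI conjI side_avg_bounds[OF gm gb, where a = 0 and b = 1]) auto
  moreover have "Lipschitz_J L (side_avg g)"
    unfolding Lipschitz_J_def
  proof (intro allI ballI)
    fix i x y
    show "\<bar>side_avg g i x - side_avg g i y\<bar> \<le> L * \<bar>x - y\<bar>"
      by (rule side_avg_diff_le[OF gm gm gb gb]) (use gL dist_pt_vertical in metis)
  qed
  ultimately obtain N c where c: "values_in (c - e) (c + e) ((transfer ^^ N) (side_avg g))"
    using transfer_convergence[OF _ _ side_periodic_side_avg e] by blast
  have "(\<lambda>n. (1 - pmin) ^ n * L) \<longlonglongrightarrow> 0"
    using pmin_pos pmin_less_1 by (intro tendsto_mult_left_zero LIMSEQ_realpow_zero) auto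
  then have "eventually (\<lambda>n. (1 - pmin) ^ n * L < e) sequentially"
    using e by (rule order_tendstoD(2))
  then obtain n where n: "(1 - pmin) ^ n * L < e" by (auto simp: eventually_sequentially)
  define gS where "gS x = g ((unbounce ^^ n) x)" for x
  define gT where "gT x = g ((pinball lam ^^ N) x)" for x
  have gSm [measurable]: "gS \<in> borel_measurable borel" and gTm [measurable]: "gT \<in> borel_measurable borel"
    unfolding gS_def gT_def by measurable
  have gSb: "\<bar>gS x\<bar> \<le> 1" and gTb: "\<bar>gT x\<bar> \<le> 1" for x using gb by (simp_all add: gS_def gT_def)
  define D1 where "D1 x = \<bar>indicator A x - gS x\<bar>" for x
  define D2 where "D2 x = \<bar>gS x - gT x\<bar>" for x
  define Dc where "Dc x = \<bar>indicator A x - c\<bar>" for x :: "real \<times> real"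
  have D1m [measurable]: "D1 \<in> borel_measurable borel" and D2m [measurable]: "D2 \<in> borel_measurable borel"
    and Dcm [measurable]: "Dc \<in> borel_measurable borel"
    unfolding D1_def D2_def Dc_def by measurable
  have gS01: "0 \<le> gS x" "gS x \<le> 1" and gT01: "0 \<le> gT x" "gT x \<le> 1" for x
    using g01 by (simp_all add: gS_def gT_def)
  have D1b: "\<bar>D1 x\<bar> \<le> 1" and D2b: "\<bar>D2 x\<bar> \<le> 1" and Dcb: "\<bar>Dc x\<bar> \<le> 1 + \<bar>c\<bar>" for x
    using gS01[of x] gT01[of x] by (auto simp: D1_def D2_def Dc_def indicator_def)
  have fibre: "side_avg Dc i \<theta> \<le> side_avg D1 i \<theta> + (side_avg D2 i \<theta> + 2 * e)" if \<theta>: "\<theta> \<in> J" for i \<theta>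
  proof (rule side_avg_mono[OF Dcm Dcb D1m D1b])
    fix u :: real assume u: "0 < u" "u < 1"
    let ?x = "pt i u \<theta>"
    have close: "gS ?x - e \<le> gS (pt i u' \<theta>) \<and> gS (pt i u' \<theta>) \<le> gS ?x + e" if u': "0 < u'" "u' < 1" for u'
    proof -
      obtain j v v' t where *: "(unbounce ^^ n) ?x = pt j v t" "(unbounce ^^ n) (pt i u' \<theta>) = pt j v' t"
        "\<bar>v - v'\<bar> \<le> (1 - pmin) ^ n"
        using unbounce_funpow_contracts[OF u u', of n i \<theta>] by blast
      have "\<bar>gS ?x - gS (pt i u' \<theta>)\<bar> \<le> L * \<bar>v - v'\<bar>"
        unfolding gS_def * using gL dist_pt_horizontal by metis
      also have "\<dots> \<le> L * (1 - pmin) ^ n" using * L by (intro mult_left_mono)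
      finally show ?thesis using n by (simp add: mult.commute abs_le_iff)
    qed
    have S: "gS ?x - e \<le> side_avg gS i \<theta>" "side_avg gS i \<theta> \<le> gS ?x + e"
      using close by (intro side_avg_bounds[OF gSm gSb]; blast)+
    have ST: "side_avg gS i \<theta> \<le> side_avg gT i \<theta> + side_avg D2 i \<theta>"
      "side_avg gT i \<theta> \<le> side_avg gS i \<theta> + side_avg D2 i \<theta>"
    proof -
      have split: "side_avg (\<lambda>x. F x + D2 x) i \<theta> = side_avg F i \<theta> + side_avg D2 i \<theta>"
        if F: "F \<in> borel_measurable borel" "\<And>x. \<bar>F x\<bar> \<le> 1" for F
        unfolding side_avg_def
        by (rule Bochner_Integration.integral_add[OF integrable_side[OF F] integrable_side[OF D2m D2b]])
      have b2: "\<bar>F x + D2 x\<bar> \<le> 2" if "\<And>x. \<bar>F x\<bar> \<le> 1" for F :: "real \<times> real \<Rightarrow> real" and x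
        using that[of x] D2b[of x] by linarith
      have "side_avg gS i \<theta> \<le> side_avg (\<lambda>x. gT x + D2 x) i \<theta> + 0"
        by (rule side_avg_mono[OF gSm gSb _ b2[OF gTb]]) (auto simp: D2_def)
      then show "side_avg gS i \<theta> \<le> side_avg gT i \<theta> + side_avg D2 i \<theta>" using split[OF gTm gTb] by simp
      have "side_avg gT i \<theta> \<le> side_avg (\<lambda>x. gS x + D2 x) i \<theta> + 0"
        by (rule side_avg_mono[OF gTm gTb _ b2[OF gSb]]) (auto simp: D2_def)
      then show "side_avg gT i \<theta> \<le> side_avg gS i \<theta> + side_avg D2 i \<theta>" using split[OF gSm gSb] by simp
    qed
    have "side_avg gT i \<theta> = (transfer ^^ N) (side_avg g) i \<theta>"
      using side_avg_pinball_funpow[OF gm gb \<theta>, of N i] by (simp add: comp_def gT_def[abs_def])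
    then have T: "c - e \<le> side_avg gT i \<theta>" "side_avg gT i \<theta> \<le> c + e"
      using values_inD[OF c \<theta>, of i] by simp_all
    have "\<bar>gS ?x - c\<bar> \<le> side_avg D2 i \<theta> + 2 * e"
      using S ST T by (simp add: abs_le_iff)
    then show "Dc ?x \<le> D1 ?x + (side_avg D2 i \<theta> + 2 * e)"
      unfolding Dc_def D1_def by linarith
  qed
  have mean: "mean_avg Dc \<theta> \<le> mean_avg D1 \<theta> + mean_avg D2 \<theta> + 2 * e" if "\<theta> \<in> J" for \<theta>
    using fibre[OF that, of 0] fibre[OF that, of 1] fibre[OF that, of 2] by (simp add: mean_avg_def field_simps)
  have int_mean: "integrable \<nu> (mean_avg F)"
    if "F \<in> borel_measurable borel" "\<And>x. \<bar>F x\<bar> \<le> B" for F B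
    by (rule integrable_bounded_borel[OF nu.finite_measure_axioms _ mean_avg_bounded[OF that]])
       (use that(1) in measurable)
  have "(\<integral>x. Dc x \<partial>mu0) = (\<integral>\<theta>. mean_avg Dc \<theta> \<partial>\<nu>)" by (rule integral_mu0[OF Dcm Dcb])
  also have "\<dots> \<le> (\<integral>\<theta>. mean_avg D1 \<theta> + mean_avg D2 \<theta> + 2 * e \<partial>\<nu>)"
  proof (rule integral_mono_AE)
    show "AE \<theta> in \<nu>. mean_avg Dc \<theta> \<le> mean_avg D1 \<theta> + mean_avg D2 \<theta> + 2 * e"
      using nu_J mean by (auto elim: eventually_mono)
    show "integrable \<nu> (mean_avg Dc)" by (rule int_mean[OF Dcm Dcb])
    show "integrable \<nu> (\<lambda>\<theta>. mean_avg D1 \<theta> + mean_avg D2 \<theta> + 2 * e)"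
      using int_mean[OF D1m D1b] int_mean[OF D2m D2b] by simp
  qed
  also have "\<dots> = (\<integral>\<theta>. mean_avg D1 \<theta> \<partial>\<nu>) + (\<integral>\<theta>. mean_avg D2 \<theta> \<partial>\<nu>) + 2 * e"
    using int_mean[OF D1m D1b] int_mean[OF D2m D2b] nu.prob_space by simp
  also have "\<dots> = (\<integral>x. D1 x \<partial>mu0) + (\<integral>x. D2 x \<partial>mu0) + 2 * e"
    by (simp only: integral_mu0[OF D1m D1b] integral_mu0[OF D2m D2b])
  finally have main: "(\<integral>x. Dc x \<partial>mu0) \<le> (\<integral>x. D1 x \<partial>mu0) + (\<integral>x. D2 x \<partial>mu0) + 2 * e" .
  define D where "D x = \<bar>indicator A x - g x\<bar>" for x
  have Dm [measurable]: "D \<in> borel_measurable borel" unfolding D_def by measurable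
  have Db: "\<bar>D x\<bar> \<le> 1" for x using g01[of x] by (auto simp: D_def indicator_def)
  have "x \<in> attractor lam \<Longrightarrow> (unbounce ^^ k) x \<in> attractor lam \<and> ((unbounce ^^ k) x \<in> A \<longleftrightarrow> x \<in> A)" for x k
  proof (induction k)
    case (Suc k)
    let ?y = "(unbounce ^^ k) x"
    have y: "?y \<in> regular_set" using Suc by (simp add: attractor_eq)
    note z = unbounce_regular_set[OF y]
    have "pinball lam (unbounce ?y) \<in> A \<longleftrightarrow> unbounce ?y \<in> A"
      using z(1) by (intro inv) (simp add: attractor_eq)
    then show ?case using z Suc by (simp add: attractor_eq)
  qed simp
  then have "AE x in mu0. D1 x = D ((unbounce ^^ n) x)"
    using AE_attractor by (auto elim!: eventually_mono simp: D1_def D_def gS_def indicator_def)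
  then have "(\<integral>x. D1 x \<partial>mu0) = (\<integral>x. D ((unbounce ^^ n) x) \<partial>mu0)" by (intro integral_cong_AE) auto
  also have "\<dots> = (\<integral>x. D x \<partial>mu0)" by (rule integral_mu0_unbounce_funpow[OF Dm Db])
  finally have I1: "(\<integral>x. D1 x \<partial>mu0) < e" using gA by (simp add: D_def)
  define D3 where "D3 x = \<bar>indicator A x - gT x\<bar>" for x
  have D3m [measurable]: "D3 \<in> borel_measurable borel" unfolding D3_def by measurable
  have D3b: "\<bar>D3 x\<bar> \<le> 1" for x using gT01[of x] by (auto simp: D3_def indicator_def)
  have "x \<in> attractor lam \<Longrightarrow> (pinball lam ^^ k) x \<in> attractor lam \<and> ((pinball lam ^^ k) x \<in> A \<longleftrightarrow> x \<in> A)" for x k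
    by (induction k) (auto simp: inv attractor_eq pinball_regular_set)
  then have "AE x in mu0. D3 x = D ((pinball lam ^^ N) x)"
    using AE_attractor by (auto elim!: eventually_mono simp: D3_def D_def gT_def indicator_def)
  then have "(\<integral>x. D3 x \<partial>mu0) = (\<integral>x. D ((pinball lam ^^ N) x) \<partial>mu0)" by (intro integral_cong_AE) auto
  also have "\<dots> = (\<integral>x. D x \<partial>mu0)" by (rule integral_mu0_pinball_funpow[OF Dm Db])
  finally have I3: "(\<integral>x. D3 x \<partial>mu0) < e" using gA by (simp add: D_def)
  have "(\<integral>x. D2 x \<partial>mu0) \<le> (\<integral>x. D1 x + D3 x \<partial>mu0)"
    by (intro integral_mono Bochner_Integration.integrable_add integrable_mu0[OF D1m D1b] integrable_mu0[OF D2m D2b]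
        integrable_mu0[OF D3m D3b]) (simp add: D1_def D2_def D3_def)
  also have "\<dots> = (\<integral>x. D1 x \<partial>mu0) + (\<integral>x. D3 x \<partial>mu0)"
    by (intro Bochner_Integration.integral_add integrable_mu0[OF D1m D1b] integrable_mu0[OF D3m D3b])
  finally have "(\<integral>x. Dc x \<partial>mu0) \<le> 5 * e" using main I1 I3 by linarith
  then show ?thesis by (auto simp: Dc_def)
qed

text \<open>
  For every constant \<open>c\<close>, the product \<open>m * (1 - m)\<close> is the integral of
  \<open>(indicator A - c) * (indicator A - m)\<close>, in which the second factor is bounded by \<open>1\<close>.
\<close>

theorem invariant_measure_0_or_1:
  assumes A: "A \<in> sets borel" and inv: "\<And>x. x \<in> attractor lam \<Longrightarrow> pinball lam x \<in> A \<longleftrightarrow> x \<in> A"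
  shows "measure mu0 A = 0 \<or> measure mu0 A = 1"
proof -
  note [measurable] = A
  define m where "m = measure mu0 A"
  have m: "0 \<le> m" "m \<le> 1" by (simp_all add: m_def)
  have "m * (1 - m) \<le> 0 + e" if "0 < e" for e
  proof -
    have "0 < e / 5" using that by simp
    from invariant_approx_const[OF A inv this]
    obtain c where c: "(\<integral>x. \<bar>indicator A x - c\<bar> \<partial>mu0) \<le> 5 * (e / 5)" by blast
    have i1: "integrable mu0 (\<lambda>x. (1 - m - c) * indicator A x + c * m)"
      by (rule integrable_mu0[of _ "\<bar>1 - m - c\<bar> + \<bar>c * m\<bar>"]) (auto simp: indicator_def)
    have i2: "integrable mu0 (\<lambda>x. \<bar>indicator A x - c\<bar>)"
      by (rule integrable_mu0[of _ "1 + \<bar>c\<bar>"]) (auto simp: indicator_def)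
    have "m * (1 - m) = (\<integral>x. (1 - m - c) * indicator A x + c * m \<partial>mu0)"
      using mu0.prob_space by (simp add: m_def algebra_simps mu0.emeasure_eq_measure)
    also have "\<dots> \<le> (\<integral>x. \<bar>indicator A x - c\<bar> \<partial>mu0)"
    proof (rule integral_mono[OF i1 i2])
      fix x
      have eq: "(1 - m - c) * indicator A x + c * m = (indicator A x - c) * (indicator A x - m)"
        by (cases "x \<in> A") (simp_all add: algebra_simps)
      have "\<bar>(indicator A x - c) * (indicator A x - m)\<bar> \<le> \<bar>indicator A x - c\<bar> * 1"
        unfolding abs_mult using m by (intro mult_left_mono) (auto simp: indicator_def)
      then show "(1 - m - c) * indicator A x + c * m \<le> \<bar>indicator A x - c\<bar>" unfolding eq by simp
    qed
    also have "\<dots> \<le> e" using c by simp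
    finally show ?thesis by simp
  qed
  then have "m * (1 - m) \<le> 0" by (rule field_le_epsilon)
  then have "m = 0 \<or> m = 1" using m by (auto simp: mult_le_0_iff)
  then show ?thesis by (simp add: m_def)
qed

lemma measure_mu0_vimage_pinball_funpow:
  assumes [measurable]: "W \<in> sets borel"
  shows "measure mu0 ((pinball lam ^^ n) -` W) = measure mu0 W"
proof -
  have "measure mu0 W = (\<integral>x. indicator W ((pinball lam ^^ n) x) \<partial>mu0)"
    using integral_mu0_pinball_funpow[of "indicator W" 1 n] by simp
  also have "\<dots> = (\<integral>x. indicator ((pinball lam ^^ n) -` W) x \<partial>mu0)"
    by (simp add: indicator_vimage)
  also have "\<dots> = measure mu0 ((pinball lam ^^ n) -` W)"
    by simp
  finally show ?thesis ..
qed

text \<open>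
  The set of points that visit a given open set infinitely often is invariant and has positive
  measure, hence full measure, so it meets every open set that meets the attractor.
\<close>

theorem transitive_attractor: "topologically_transitive (pinball lam) (attractor lam)"
  unfolding topologically_transitive_def
proof (intro allI impI, elim conjE)
  fix U V assume "openin (top_of_set (attractor lam)) U" "openin (top_of_set (attractor lam)) V" "U \<noteq> {}" "V \<noteq> {}"
  then obtain U' V' x y where U: "open U'" "U = attractor lam \<inter> U'" "x \<in> attractor lam" "x \<in> U'"
    and V: "open V'" "V = attractor lam \<inter> V'" "y \<in> attractor lam" "y \<in> V'"
    unfolding openin_open by blast
  have [measurable]: "U' \<in> sets borel" "V' \<in> sets borel" using U V by auto
  define B where "B k = (\<Union>N\<in>{k..}. (pinball lam ^^ N) -` V')" for k :: nat
  have pre [measurable]: "(pinball lam ^^ N) -` V' \<in> sets borel" for N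
    using measurable_sets[OF borel_measurable_pinball_funpow, of V' N] by simp
  have Bm [measurable]: "B k \<in> sets borel" for k
    unfolding B_def by measurable
  define R where "R = (\<Inter>k. B k)"
  have Rm: "R \<in> sets borel" unfolding R_def by measurable
  have "measure mu0 V' \<le> measure mu0 (B k)" for k
  proof -
    have "measure mu0 V' = measure mu0 ((pinball lam ^^ k) -` V')"
      by (rule measure_mu0_vimage_pinball_funpow[symmetric]) simp
    also have "\<dots> \<le> measure mu0 (B k)" by (intro mu0.finite_measure_mono) (auto simp: B_def)
    finally show ?thesis .
  qed
  moreover have "(\<lambda>k. measure mu0 (B k)) \<longlonglongrightarrow> measure mu0 R"
    unfolding R_def
  proof (rule mu0.finite_Lim_measure_decseq)
    show "decseq B" unfolding decseq_def B_def by (intro allI impI UN_mono) auto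
  qed auto
  ultimately have "measure mu0 V' \<le> measure mu0 R" by (intro LIMSEQ_le_const) auto
  then have "0 < measure mu0 R" using mu0_open_pos[OF V(1,4,3)] by simp
  moreover have "pinball lam x \<in> R \<longleftrightarrow> x \<in> R" for x
  proof -
    have R: "x \<in> R \<longleftrightarrow> (\<forall>k. \<exists>N\<ge>k. (pinball lam ^^ N) x \<in> V')" for x by (auto simp: R_def B_def)
    have "(\<forall>k. \<exists>N\<ge>k. (pinball lam ^^ Suc N) x \<in> V') \<longleftrightarrow> (\<forall>k. \<exists>N\<ge>k. (pinball lam ^^ N) x \<in> V')"
      by (metis Suc_le_D Suc_le_mono le_SucI)
    then show ?thesis unfolding R by (simp add: funpow_swap1)
  qed
  ultimately have "measure mu0 R = 1" using invariant_measure_0_or_1[OF Rm] by auto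
  then have "AE x in mu0. x \<in> R" using Rm by (simp add: mu0.prob_eq_1)
  with AE_attractor have ae: "AE x in mu0. x \<in> attractor lam \<inter> R" by eventually_elim simp
  have "attractor lam \<inter> R \<inter> U' \<noteq> {}"
  proof
    assume "attractor lam \<inter> R \<inter> U' = {}"
    then have "x \<notin> U'" if "x \<in> attractor lam \<inter> R" for x using that by blast
    with ae have "AE x in mu0. x \<notin> U'" by (rule eventually_mono)
    then have "measure mu0 U' = 0" by (subst mu0.prob_eq_0) auto
    then show False using mu0_open_pos[OF U(1,4,3)] by simp
  qed
  then obtain z where z: "z \<in> attractor lam" "z \<in> R" "z \<in> U'" by blast
  from z(2) obtain N where "(pinball lam ^^ N) z \<in> V'" by (auto simp: R_def B_def)
  moreover have "(pinball lam ^^ N) z \<in> attractor lam"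
    using z(1) pinball_funpow_image_regular_set by (force simp: attractor_eq)
  ultimately show "\<exists>N. (pinball lam ^^ N) ` U \<inter> V \<noteq> {}" using z U V by blast
qed

end

section \<open>The measure on the attractor and its disintegration\<close>

definition side_law :: "int \<times> real \<Rightarrow> (real \<times> real) measure" where
  "side_law h = distr unit_uniform borel (\<lambda>u. (of_int (fst h) + u, snd h))"

lemma side_point_measurable [measurable]:
  "(\<lambda>u. (c + u, \<theta>)) \<in> borel_measurable unit_uniform" for c \<theta> :: real
  by (intro borel_measurable_Pair) measurable

lemma prob_space_side_law: "prob_space (side_law h)"
  unfolding side_law_def by (rule unit_uniform.prob_space_distr) measurable

lemma sets_side_law [measurable_cong, simp]: "sets (side_law h) = sets borel"
  by (simp add: side_law_def)

lemma space_side_law [simp]: "space (side_law h) = UNIV"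
  by (simp add: side_law_def)

lemma emeasure_side_law:
  assumes [measurable]: "A \<in> sets borel"
  shows "emeasure (side_law h) A = (\<integral>\<^sup>+u. indicator A (of_int (fst h) + u, snd h) \<partial>unit_uniform)"
proof -
  have "emeasure (side_law h) A = (\<integral>\<^sup>+x. indicator A x \<partial>side_law h)" by simp
  also have "\<dots> = (\<integral>\<^sup>+u. indicator A (of_int (fst h) + u, snd h) \<partial>unit_uniform)"
    unfolding side_law_def by (rule nn_integral_distr) (auto intro: side_point_measurable)
  finally show ?thesis .
qed

lemma measure_side_law:
  assumes [measurable]: "A \<in> sets borel"
  shows "measure (side_law h) A = (\<integral>u. indicator A (of_int (fst h) + u, snd h) \<partial>unit_uniform)"
proof -
  have "measure (side_law h) A = (\<integral>x. indicator A x \<partial>side_law h)" by simp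
  also have "\<dots> = (\<integral>u. indicator A (of_int (fst h) + u, snd h) \<partial>unit_uniform)"
    unfolding side_law_def by (rule integral_distr) (auto intro: side_point_measurable)
  finally show ?thesis .
qed

lemma emeasure_side_law_measurable [measurable]:
  assumes [measurable]: "A \<in> sets borel"
  shows "(\<lambda>h. emeasure (side_law h) A) \<in> borel_measurable index_algebra"
proof -
  have [measurable]: "(\<lambda>x. (real_of_int (fst (fst x)) + snd x, snd (fst x))) \<in> borel_measurable (index_algebra \<Otimes>\<^sub>M unit_uniform)"
    by (intro borel_measurable_Pair) measurable
  have "(\<lambda>x. indicator A (real_of_int (fst (fst x)) + snd x, snd (fst x)) :: ennreal)
      \<in> borel_measurable (index_algebra \<Otimes>\<^sub>M unit_uniform)"
    by measurable
  then have "(\<lambda>h. \<integral>\<^sup>+u. indicator A (of_int (fst h) + u, snd h) \<partial>unit_uniform) \<in> borel_measurable index_algebra"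
    by (intro unit_uniform.borel_measurable_nn_integral) (simp add: case_prod_beta')
  then show ?thesis by (simp add: emeasure_side_law)
qed

lemma hor_index_measurable [measurable]: "hor_index \<in> measurable borel index_algebra"
proof -
  have "(\<lambda>x :: real \<times> real. \<lfloor>fst x\<rfloor>) \<in> measurable borel (count_space UNIV)"
    by (rule measurable_compose[OF borel_measurable_fst_plane measurable_real_floor])
  then have "(\<lambda>x :: real \<times> real. (\<lfloor>fst x\<rfloor>, snd x)) \<in> measurable borel index_algebra"
    by (intro measurable_Pair borel_measurable_snd_plane)
  moreover have "hor_index = (\<lambda>x. (\<lfloor>fst x\<rfloor>, snd x))" by (simp add: hor_index_def fun_eq_iff)
  ultimately show ?thesis by simp
qed

lemma AE_side_law_hor_interval: "AE p in side_law h. p \<in> hor_interval h"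
proof -
  have "{p. p \<in> hor_interval h} \<in> sets borel"
    unfolding hor_interval_def by (auto simp: case_prod_beta intro!: borel_Times)
  then show ?thesis
    unfolding side_law_def using AE_unit_uniform
    by (subst AE_distr_iff) (auto simp: hor_interval_def case_prod_beta intro: side_point_measurable elim: eventually_mono)
qed

lemma side_law_null:
  assumes N: "N \<in> null_sets lborel"
  shows "emeasure (side_law h) (fst -` N) = 0"
proof -
  have [measurable]: "N \<in> sets borel" using N by auto
  have [measurable]: "fst -` N \<in> sets (borel :: (real \<times> real) measure)"
    using measurable_sets[OF borel_measurable_fst_plane, of N] by simp
  have "0 = (\<integral>\<^sup>+u. indicator N u \<partial>lborel)" using N by auto
  also have "\<dots> = (\<integral>\<^sup>+u. indicator N (of_int (fst h) + u) \<partial>lborel)"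
    using nn_integral_real_affine[of "indicator N" 1 "of_int (fst h)"] by simp
  finally have "AE u in lborel. indicator N (of_int (fst h) + u) = (0 :: ennreal)"
    by (subst (asm) eq_commute) (simp add: nn_integral_0_iff_AE)
  then have "AE u in unit_uniform. indicator N (of_int (fst h) + u) = (0 :: ennreal)"
    unfolding unit_uniform_def by (intro AE_uniform_measureI) (auto elim: eventually_mono)
  then have "(\<integral>\<^sup>+u. indicator N (of_int (fst h) + u) \<partial>unit_uniform) = (0 :: ennreal)"
    by (simp add: nn_integral_0_iff_AE)
  then show ?thesis by (simp add: emeasure_side_law indicator_def)
qed

context stationary_pinball
begin

definition mu :: "(real \<times> real) measure" where
  "mu = restrict_space mu0 (attractor lam)"

lemma space_mu: "space mu = attractor lam"
  by (simp add: mu_def space_restrict_space)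

lemma sets_mu: "sets mu = sets (restrict_space borel (attractor lam))"
  unfolding mu_def by (rule sets_restrict_space_cong) simp

lemma sets_mu_iff: "A \<in> sets mu \<longleftrightarrow> A \<in> sets borel \<and> A \<subseteq> attractor lam"
  unfolding mu_def by (subst sets_restrict_space_iff) auto

lemma emeasure_mu: "A \<in> sets mu \<Longrightarrow> emeasure mu A = emeasure mu0 A"
  unfolding mu_def using sets_mu_iff by (intro emeasure_restrict_space) (auto simp: mu_def)

lemma emeasure_mu0_attractor: "emeasure mu0 (attractor lam) = 1"
  using AE_attractor by (intro mu0.emeasure_eq_1_AE) auto

lemma prob_space_mu: "prob_space mu"
proof
  have "attractor lam \<in> sets mu" using sets_mu_iff by auto
  then show "emeasure mu (space mu) = 1"
    by (simp add: space_mu emeasure_mu emeasure_mu0_attractor)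
qed

lemma pinball_attractor: "x \<in> attractor lam \<Longrightarrow> pinball lam x \<in> attractor lam"
  by (simp add: attractor_eq pinball_regular_set)

lemma invariant_mu: "invariant_measure (pinball lam) mu"
  unfolding invariant_measure_def
proof
  show meas: "pinball lam \<in> measurable mu mu"
    unfolding mu_def by (rule measurable_restrict_space3) (auto simp: pinball_attractor)
  show "distr mu mu (pinball lam) = mu"
  proof (rule measure_eqI)
    fix A assume "A \<in> sets (distr mu mu (pinball lam))"
    then have A: "A \<in> sets mu" by simp
    then have [measurable]: "A \<in> sets borel" using sets_mu_iff by auto
    have [measurable]: "pinball lam -` A \<in> sets borel"
      using measurable_sets[OF borel_measurable_pinball, of A] by simp
    have "pinball lam -` A \<inter> attractor lam \<in> sets mu" by (simp add: sets_mu_iff)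
    then have "emeasure (distr mu mu (pinball lam)) A = emeasure mu0 (pinball lam -` A \<inter> attractor lam)"
      using meas A by (simp add: emeasure_distr space_mu emeasure_mu)
    also have "\<dots> = emeasure mu0 (pinball lam -` A)"
      using AE_attractor by (intro emeasure_eq_AE) (auto elim: eventually_mono)
    also have "\<dots> = emeasure (distr mu0 borel (pinball lam)) A" by (simp add: emeasure_distr)
    also have "\<dots> = emeasure mu A" using A by (simp add: distr_mu0_pinball emeasure_mu)
    finally show "emeasure (distr mu mu (pinball lam)) A = emeasure mu A" .
  qed simp
qed

lemma ergodic_mu: "ergodic_measure (pinball lam) mu"
  unfolding ergodic_measure_def
proof (intro ballI impI)
  fix A assume A: "A \<in> sets mu" and inv: "pinball lam -` A \<inter> space mu = A"
  have "pinball lam x \<in> A \<longleftrightarrow> x \<in> A" if "x \<in> attractor lam" for x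
    using inv that by (auto simp: space_mu)
  then have "measure mu0 A = 0 \<or> measure mu0 A = 1"
    using A by (intro invariant_measure_0_or_1) (simp_all add: sets_mu_iff)
  then show "emeasure mu A = 0 \<or> emeasure mu A = 1"
    using A by (auto simp: emeasure_mu mu0.emeasure_eq_measure)
qed

lemma side_avg_indicator:
  assumes "A \<in> sets borel"
  shows "side_avg (indicator A) i \<theta> = measure (side_law (i mod 3, \<theta>)) A"
  unfolding measure_side_law[OF assms] side_avg_def by (simp add: pt_def)

lemma hor_index_pt: "0 < u \<Longrightarrow> u < 1 \<Longrightarrow> hor_index (pt i u \<theta>) = (i mod 3, \<theta>)"
  using floor_pt[of u i \<theta>] by (simp add: hor_index_def case_prod_beta)

text \<open>
  By Fubini, the uniform distribution on a side is carried by the attractor for almost every angle; it is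
  not for angles outside the angle set.
\<close>

definition full_side :: "int \<times> real \<Rightarrow> bool" where
  "full_side h \<longleftrightarrow> emeasure (side_law h) (attractor lam) = 1"

lemma pred_full_side [measurable]: "Measurable.pred index_algebra full_side"
  unfolding full_side_def by measurable

lemma AE_full_side: "AE x in mu0. full_side (hor_index x)"
proof (rule AE_mu0I)
  show "Measurable.pred borel (\<lambda>x. full_side (hor_index x))" by measurable
  let ?F = "indicator (- attractor lam) :: real \<times> real \<Rightarrow> real"
  have Fb: "\<bar>?F x\<bar> \<le> 1" for x by (simp add: indicator_def)
  have Fm: "?F \<in> borel_measurable borel" by measurable
  have avg0: "0 \<le> side_avg ?F i \<theta>" for i \<theta> by (rule side_avg_bounds[OF Fm Fb, where b = 1]) (auto simp: indicator_def)
  have "(\<integral>\<theta>. mean_avg ?F \<theta> \<partial>\<nu>) = (\<integral>x. ?F x \<partial>mu0)" by (rule integral_mu0[OF Fm Fb, symmetric])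
  also have "\<dots> = 0" using AE_attractor by (intro integral_eq_zero_AE) (auto elim: eventually_mono)
  finally have "(\<integral>\<theta>. mean_avg ?F \<theta> \<partial>\<nu>) = 0" .
  moreover have "integrable \<nu> (mean_avg ?F)"
    by (rule integrable_bounded_borel[OF nu.finite_measure_axioms _ mean_avg_bounded[OF Fm Fb]]) (use Fm in measurable)
  moreover have "AE \<theta> in \<nu>. 0 \<le> mean_avg ?F \<theta>" using avg0 by (simp add: mean_avg_def)
  ultimately have "AE \<theta> in \<nu>. mean_avg ?F \<theta> = 0" by (simp add: integral_nonneg_eq_0_iff_AE)
  then show "AE \<theta> in \<nu>. \<forall>i. AE u in unit_uniform. full_side (hor_index (pt i u \<theta>))"
  proof (eventually_elim, intro allI)
    fix \<theta> and i :: int assume "mean_avg ?F \<theta> = 0"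
    then have "side_avg ?F 0 \<theta> + side_avg ?F 1 \<theta> + side_avg ?F 2 \<theta> = 0" by (simp add: mean_avg_def)
    then have z: "side_avg ?F 0 \<theta> = 0" "side_avg ?F 1 \<theta> = 0" "side_avg ?F 2 \<theta> = 0"
      using avg0[of 0 \<theta>] avg0[of 1 \<theta>] avg0[of 2 \<theta>] by linarith+
    obtain k where k: "i mod 3 = k" "k = 0 \<or> k = 1 \<or> k = 2" using mod_3_cases by blast
    have m: "measure (side_law (j mod 3, \<theta>)) (- attractor lam) = side_avg ?F j \<theta>" for j
      by (rule side_avg_indicator[symmetric]) measurable
    have "measure (side_law (k, \<theta>)) (- attractor lam) = 0"
      using k(2) m[of 0] m[of 1] m[of 2] z by (elim disjE) simp_all
    then have "measure (side_law (k, \<theta>)) (attractor lam) = 1"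
      using prob_space.prob_compl[OF prob_space_side_law, of "attractor lam" "(k, \<theta>)"]
      by (simp add: Compl_eq_Diff_UNIV)
    then have full: "full_side (k, \<theta>)"
      using prob_space_side_law[of "(k, \<theta>)"]
      by (simp add: full_side_def finite_measure.emeasure_eq_measure prob_space_def)
    show "AE u in unit_uniform. full_side (hor_index (pt i u \<theta>))"
      using AE_unit_uniform by eventually_elim (simp add: hor_index_pt k(1) full)
  qed
qed

text \<open>
  The kernel takes the value \<open>mu\<close> on the null set of sides on which the attractor misses a set of
  positive length, as a kernel must consist of probability measures on the attractor.
\<close>

definition side_kernel :: "int \<times> real \<Rightarrow> (real \<times> real) measure" where
  "side_kernel h = (if full_side h then restrict_space (side_law h) (attractor lam) else mu)"

lemma sets_side_kernel: "sets (side_kernel h) = sets mu"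
  unfolding side_kernel_def mu_def by (auto intro!: sets_restrict_space_cong)

lemma emeasure_side_kernel:
  assumes "A \<in> sets mu"
  shows "emeasure (side_kernel h) A = (if full_side h then emeasure (side_law h) A else emeasure mu A)"
  using assms by (auto simp: side_kernel_def sets_mu_iff intro!: emeasure_restrict_space)

lemma prob_space_side_kernel: "prob_space (side_kernel h)"
proof
  have "space (side_kernel h) = attractor lam"
    using sets_eq_imp_space_eq[OF sets_side_kernel] by (simp add: space_mu)
  moreover have "attractor lam \<in> sets mu" by (simp add: sets_mu_iff)
  ultimately show "emeasure (side_kernel h) (space (side_kernel h)) = 1"
    by (simp add: emeasure_side_kernel emeasure_mu emeasure_mu0_attractor) (simp add: full_side_def)
qed

lemma side_kernel_measurable: "side_kernel \<in> measurable index_algebra (prob_algebra mu)"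
proof (rule measurable_prob_algebraI)
  show "side_kernel \<in> measurable index_algebra (subprob_algebra mu)"
  proof (rule measurable_subprob_algebra)
    fix A assume A: "A \<in> sets mu"
    then have [measurable]: "A \<in> sets borel" by (simp add: sets_mu_iff)
    show "(\<lambda>h. emeasure (side_kernel h) A) \<in> borel_measurable index_algebra"
      unfolding emeasure_side_kernel[OF A] by measurable
  qed (auto simp: sets_side_kernel intro: prob_space_imp_subprob_space prob_space_side_kernel)
qed (rule prob_space_side_kernel)

lemma AE_distr_mu_index:
  assumes [measurable]: "Measurable.pred index_algebra P"
    and "AE x in mu0. P (hor_index x)"
  shows "AE h in distr mu index_algebra hor_index. P h"
proof -
  have [measurable]: "hor_index \<in> measurable mu index_algebra"
    unfolding mu_def by (rule measurable_restrict_space1) measurable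
  have "AE x in mu. P (hor_index x)"
    unfolding mu_def using assms(2) by (subst AE_restrict_space_iff) (auto elim: eventually_mono)
  then show ?thesis by (subst AE_distr_iff) (auto simp: pred_def)
qed

lemma emeasure_mu_disintegration:
  assumes A: "A \<in> sets mu"
  shows "emeasure mu A = (\<integral>\<^sup>+h. emeasure (side_kernel h) A \<partial>distr mu index_algebra hor_index)"
proof -
  have [measurable]: "A \<in> sets borel" using A by (simp add: sets_mu_iff)
  have idx [measurable]: "hor_index \<in> measurable mu index_algebra"
    unfolding mu_def by (rule measurable_restrict_space1) measurable
  have km: "(\<lambda>h. emeasure (side_kernel h) A) \<in> borel_measurable index_algebra"
    unfolding emeasure_side_kernel[OF A] by measurable
  define E where "E x = measure (side_law (hor_index x)) A" for x
  have Em [measurable]: "E \<in> borel_measurable borel"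
    unfolding E_def measure_def by measurable
  have Eb: "\<bar>E x\<bar> \<le> 1" for x unfolding E_def using prob_space.prob_le_1[OF prob_space_side_law] by simp
  have avg: "side_avg E i \<theta> = side_avg (indicator A) i \<theta>" for i \<theta>
  proof -
    have "side_avg E i \<theta> = (\<integral>u. measure (side_law (i mod 3, \<theta>)) A \<partial>unit_uniform)"
      unfolding side_avg_def
    proof (rule integral_cong_AE)
      show "AE u in unit_uniform. E (pt i u \<theta>) = measure (side_law (i mod 3, \<theta>)) A"
        using AE_unit_uniform by eventually_elim (simp add: E_def hor_index_pt)
    qed measurable
    then show ?thesis using unit_uniform.prob_space by (simp add: side_avg_indicator)
  qed
  have "(\<integral>\<^sup>+h. emeasure (side_kernel h) A \<partial>distr mu index_algebra hor_index)
      = (\<integral>\<^sup>+x. emeasure (side_kernel (hor_index x)) A \<partial>mu)"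
    by (rule nn_integral_distr[OF idx]) (use km in simp)
  also have "\<dots> = (\<integral>\<^sup>+x. emeasure (side_kernel (hor_index x)) A * indicator (attractor lam) x \<partial>mu0)"
    unfolding mu_def by (rule nn_integral_restrict_space) simp
  also have "\<dots> = (\<integral>\<^sup>+x. ennreal (E x) \<partial>mu0)"
  proof (rule nn_integral_cong_AE)
    show "AE x in mu0. emeasure (side_kernel (hor_index x)) A * indicator (attractor lam) x = ennreal (E x)"
      using AE_attractor AE_full_side
    proof eventually_elim
      fix x assume "x \<in> attractor lam" "full_side (hor_index x)"
      then show "emeasure (side_kernel (hor_index x)) A * indicator (attractor lam) x = ennreal (E x)"
        using prob_space_side_law[of "hor_index x"] A
        by (simp add: emeasure_side_kernel E_def finite_measure.emeasure_eq_measure prob_space_def)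
    qed
  qed
  also have "\<dots> = ennreal (\<integral>x. E x \<partial>mu0)"
    by (rule nn_integral_eq_integral[OF integrable_mu0[OF Em Eb]]) (simp add: E_def)
  also have "(\<integral>x. E x \<partial>mu0) = (\<integral>x. indicator A x \<partial>mu0)"
  proof -
    have "mean_avg E = mean_avg (indicator A)" by (simp add: mean_avg_def fun_eq_iff avg)
    then show ?thesis
      using integral_mu0[OF Em Eb] integral_mu0[of "indicator A" 1] by (simp add: indicator_def)
  qed
  also have "ennreal (\<integral>x. indicator A x \<partial>mu0) = emeasure mu A"
    using A by (simp add: emeasure_mu mu0.emeasure_eq_measure)
  finally show ?thesis ..
qed

theorem abs_cont_mu: "abs_cont_on_horizontals mu"
  unfolding abs_cont_on_horizontals_def
proof (intro exI conjI)
  have full: "AE h in distr mu index_algebra hor_index. full_side h"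
    by (rule AE_distr_mu_index[OF pred_full_side AE_full_side])
  show "hor_disintegration mu side_kernel"
    unfolding hor_disintegration_def
  proof (intro conjI ballI side_kernel_measurable emeasure_mu_disintegration)
    show "AE h in distr mu index_algebra hor_index. AE p in side_kernel h. p \<in> hor_interval h"
      using full
    proof eventually_elim
      fix h assume "full_side h"
      then have eq: "side_kernel h = restrict_space (side_law h) (attractor lam)"
        by (simp add: side_kernel_def)
      show "AE p in side_kernel h. p \<in> hor_interval h"
        unfolding eq using AE_side_law_hor_interval[of h]
        by (subst AE_restrict_space_iff) (auto elim: eventually_mono)
    qed
  qed
  show "AE h in distr mu index_algebra hor_index. absolutely_continuous lborel (distr (side_kernel h) borel fst)"
    using full
  proof eventually_elim
    fix h assume h: "full_side h"
    show "absolutely_continuous lborel (distr (side_kernel h) borel fst)"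
      unfolding absolutely_continuous_def
    proof
      fix N :: "real set" assume N: "N \<in> null_sets lborel"
      then have [measurable]: "N \<in> sets borel" by auto
      have pre: "fst -` N \<in> sets (borel :: (real \<times> real) measure)"
        using measurable_sets[OF borel_measurable_fst_plane, of N] by simp
      have fst_meas: "fst \<in> measurable (side_kernel h) borel"
      proof -
        have "fst \<in> measurable (side_law h) borel"
          by (subst measurable_cong_sets[OF sets_side_law refl]) (rule borel_measurable_fst_plane)
        then show ?thesis using h by (simp add: side_kernel_def measurable_restrict_space1)
      qed
      have sp: "space (side_kernel h) = attractor lam"
        using sets_eq_imp_space_eq[OF sets_side_kernel] by (simp add: space_mu)
      have "emeasure (distr (side_kernel h) borel fst) N = emeasure (side_kernel h) (fst -` N \<inter> attractor lam)"
        using fst_meas by (subst emeasure_distr) (auto simp: sp)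
      also have "\<dots> = emeasure (side_law h) (fst -` N \<inter> attractor lam)"
        using h pre by (subst emeasure_side_kernel) (auto simp: sets_mu_iff)
      also have "\<dots> \<le> emeasure (side_law h) (fst -` N)" using pre by (intro emeasure_mono) auto
      also have "\<dots> = 0" by (rule side_law_null[OF N])
      finally show "N \<in> null_sets (distr (side_kernel h) borel fst)" by (auto simp: null_sets_def)
    qed
  qed
qed

end

theorem theorem1:
  fixes lam :: real
  assumes "0 < lam" and "lam < 1/3"
  shows "pinball lam ` attractor lam \<subseteq> attractor lam
    \<and> topologically_transitive (pinball lam) (attractor lam)
    \<and> (\<exists>C. cantor_set C \<and> attractor lam homeomorphic ({0..3} \<times> C) - Sing lam)
    \<and> (\<exists>\<mu>. prob_space \<mu>
          \<and> sets \<mu> = sets (restrict_space borel (attractor lam))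
          \<and> invariant_measure (pinball lam) \<mu>
          \<and> ergodic_measure (pinball lam) \<mu>
          \<and> abs_cont_on_horizontals \<mu>)"
proof -
  interpret contracting_pinball lam by unfold_locales (use assms in auto)
  obtain \<nu> where \<nu>: "real_distribution \<nu>" "AE \<theta> in \<nu>. \<theta> \<in> J"
    "\<And>h B. h \<in> borel_measurable borel \<Longrightarrow> (\<And>x. \<bar>h x\<bar> \<le> B) \<Longrightarrow>
      (\<integral>x. transfer_angle h x \<partial>\<nu>) = (\<integral>x. h x \<partial>\<nu>)"
    using ex_stationary by metis
  interpret stationary_pinball lam \<nu>
    by (intro stationary_pinball.intro stationary_pinball_axioms.intro contracting_pinball_axioms \<nu>)
  show ?thesis
  proof (intro conjI exI)
    show "pinball lam ` attractor lam \<subseteq> attractor lam" using pinball_attractor by blast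
    show "topologically_transitive (pinball lam) (attractor lam)" by (rule transitive_attractor)
    show "cantor_set angle_set" by (rule cantor_set_angle_set)
    show "attractor lam homeomorphic ({0..3} \<times> angle_set) - Sing lam"
      unfolding attractor_eq regular_set_eq by (rule homeomorphic_refl)
    show "prob_space mu" by (rule prob_space_mu)
    show "sets mu = sets (restrict_space borel (attractor lam))" by (rule sets_mu)
    show "invariant_measure (pinball lam) mu" by (rule invariant_mu)
    show "ergodic_measure (pinball lam) mu" by (rule ergodic_mu)
    show "abs_cont_on_horizontals mu" by (rule abs_cont_mu)
  qed
qed

end
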